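(* Consider the weight $6$ part $C^{\bullet}_{GF}(\mathfrak{ham}_4^0,Sp(4,\mathbb{R}))_6$ of the Gel'fand-Kalinin-Fuks cochain complex of $\mathfrak{ham}_4^0$ relative to $Sp(4,\mathbb{R})$. The dimensions of its cochain spaces in degrees $0,1,2,3,4,5,6$ are $0,0,1,1,0,4,4$ respectively, and the Betti numbers (dimensions of the cohomology groups) in degrees $0,1,\dots,6$ are all $0$.
   Context: On $\mathbb{R}^4$ with coordinates $x_1,x_2,x_3,x_4$ use the Poisson bracket $\{f,g\}=\frac{\partial f}{\partial x_1}\frac{\partial g}{\partial x_4}+\frac{\partial f}{\partial x_2}\frac{\partial g}{\partial x_3}-\frac{\partial f}{\partial x_3}\frac{\partial g}{\partial x_2}-\frac{\partial f}{\partial x_4}\frac{\partial g}{\partial x_1}$. Let $\mathfrak{ham}_4^0$ be the Lie algebra of Hamiltonian vector fields with polynomial potentials vanishing at the origin, identified with the Lie algebra, under $\{\cdot,\cdot\}$, of real polynomials all of whose homogeneous components have degree $\ge 2$. Let $\mathfrak{S}_\ell$ be the dual space of the space of homogeneous polynomials of degree $\ell$. Nonzero elements of $\mathfrak{S}_\ell$ have weight $\ell-2$, and nonzero elements of $\mathfrak{S}_{\ell_1}\wedge\cdots\wedge\mathfrak{S}_{\ell_s}$ have weight $\sum_i(\ell_i-2)$. The degree $m$, weight $w$ cochain space is $$C^m_{GF}(\mathfrak{ham}_4^0)_w=\bigoplus \Lambda^{k_2}\mathfrak{S}_2\wedge\Lambda^{k_3}\mathfrak{S}_3\wedge\cdots\wedge\Lambda^{k_s}\mathfrak{S}_s,$$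 the sum being over all finite sequences of non-negative integers $(k_2,k_3,\dots)$ with $\sum_i k_i=m$ and $\sum_i k_i(i-2)=w$. The coboundary operator $d$ is the (degree $+1$) antiderivation determined on $1$-cochains by $(d z)(f,g)=-\langle z,\{f,g\}\rangle$; it preserves weight. The relative cochain space $C^m_{GF}(\mathfrak{ham}_4^0,Sp(4,\mathbb{R}))_w$ consists of those $\sigma\in C^m_{GF}(\mathfrak{ham}_4^0)_w$ with $i_{\hat J(\xi)}\sigma=0$ and $i_{\hat J(\xi)}d\sigma=0$ for all $\xi\in\mathfrak{sp}(4,\mathbb{R})$, where $J$ is the momentum mapping of the linear action of $Sp(4,\mathbb{R})$ on $\mathbb{R}^4$, so that $\hat J(\xi)$ ranges over all homogeneous quadratic polynomials, and $i$ denotes interior product. (Equivalently, it is the space of $Sp(4,\mathbb{R})$-invariant cochains in which $\mathfrak{S}_2$ does not appear.) These form a complex under $d$ for each fixed $w$; the Betti number in degree $m$ is the dimension of its degree $m$ cohomology. *)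

theory Defs
  imports "HOL-Analysis.Analysis" "HOL-Library.Poly_Mapping" "HOL-Library.Function_Algebras"
    "HOL-Library.Multiset"
begin

section \<open>Polynomials in four variables and the Poisson bracket\<close>

text \<open>The four variables are indexed by the type \<^typ>\<open>4\<close>, whose elements are \<open>1, 2, 3, 4\<close>
  (as in \<^typ>\<open>real ^ 4\<close>; note that \<open>4 = 0\<close> in this type).\<close>

type_synonym mono4 = "4 \<Rightarrow>\<^sub>0 nat"
type_synonym poly4 = "mono4 \<Rightarrow>\<^sub>0 real"

definition mono_degree :: "mono4 \<Rightarrow> nat" where
  "mono_degree a = (\<Sum>i\<in>UNIV. Poly_Mapping.lookup a i)"

definition homogeneous :: "nat \<Rightarrow> poly4 \<Rightarrow> bool" where
  "homogeneous l p \<longleftrightarrow> (\<forall>a\<in>Poly_Mapping.keys p. mono_degree a = l)"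

definition const4 :: "real \<Rightarrow> poly4" where
  "const4 c = Poly_Mapping.single 0 c"

definition var4 :: "4 \<Rightarrow> poly4" where
  "var4 i = Poly_Mapping.single (Poly_Mapping.single i 1) 1"

definition pderiv4 :: "4 \<Rightarrow> poly4 \<Rightarrow> poly4" where
  "pderiv4 i p = (\<Sum>a\<in>Poly_Mapping.keys p.
     Poly_Mapping.single (a - Poly_Mapping.single i 1)
       (real (Poly_Mapping.lookup a i) * Poly_Mapping.lookup p a))"

definition poisson :: "poly4 \<Rightarrow> poly4 \<Rightarrow> poly4" where
  "poisson f g = pderiv4 1 f * pderiv4 4 g + pderiv4 2 f * pderiv4 3 g
               - pderiv4 3 f * pderiv4 2 g - pderiv4 4 f * pderiv4 1 g"

lemma lookup_pderiv4:
  "Poly_Mapping.lookup (pderiv4 i p) a =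
     real (Poly_Mapping.lookup a i + 1) * Poly_Mapping.lookup p (a + Poly_Mapping.single i 1)"
proof -
  let ?e = "Poly_Mapping.single i (1::nat)"
  have e: "b - ?e = a \<longleftrightarrow> b = a + ?e" if "Poly_Mapping.lookup b i \<noteq> 0" for b
  proof
    assume "b - ?e = a"
    then have "Poly_Mapping.lookup b j = Poly_Mapping.lookup (a + ?e) j" for j
      using that by (auto simp: lookup_add lookup_minus lookup_single when_def)
    then show "b = a + ?e" by (intro poly_mapping_eqI)
  qed simp
  have "Poly_Mapping.lookup (pderiv4 i p) a =
      (\<Sum>b\<in>Poly_Mapping.keys p. (if b = a + ?e then
         real (Poly_Mapping.lookup b i) * Poly_Mapping.lookup p b else 0))"
    unfolding pderiv4_def lookup_sum
    by (intro sum.cong refl) (use e in \<open>auto simp: lookup_single when_def\<close>)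
  also have "\<dots> = real (Poly_Mapping.lookup a i + 1) * Poly_Mapping.lookup p (a + ?e)"
    by (subst sum.delta) (auto simp: lookup_add in_keys_iff)
  finally show ?thesis .
qed

lemma pderiv4_add: "pderiv4 i (p + q) = pderiv4 i p + pderiv4 i q"
  by (rule poly_mapping_eqI) (simp add: lookup_pderiv4 lookup_add algebra_simps)

lemma lookup_const4_mult:
  "Poly_Mapping.lookup (const4 c * p) a = c * Poly_Mapping.lookup p a"
proof -
  have "const4 c * p = Poly_Mapping.map ((*) c) p"
    by (simp add: const4_def mult_map_scale_conv_mult)
  then show ?thesis by (simp add: Poly_Mapping.map.rep_eq when_def)
qed

lemma pderiv4_const4_mult: "pderiv4 i (const4 c * p) = const4 c * pderiv4 i p"
  by (rule poly_mapping_eqI) (simp add: lookup_pderiv4 lookup_const4_mult)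

lemma const4_add: "const4 (c + d) = const4 c + const4 d"
  by (simp add: const4_def single_add)

lemma const4_mult: "const4 (c * d) = const4 c * const4 d"
  by (simp add: const4_def mult_single)

lemma const4_1: "const4 1 = 1"
  by (simp add: const4_def)

lemma mono_degree_add: "mono_degree (a + b) = mono_degree a + mono_degree b"
  by (simp add: mono_degree_def lookup_add sum.distrib)

lemma mono_degree_single: "mono_degree (Poly_Mapping.single i n) = n"
  by (simp add: mono_degree_def lookup_single when_def)

lemma keys_pderiv4: "a \<in> Poly_Mapping.keys (pderiv4 i p) \<Longrightarrow>
    a + Poly_Mapping.single i 1 \<in> Poly_Mapping.keys p"
  by (auto simp: in_keys_iff lookup_pderiv4)

lemma degree_pderiv4:
  assumes "\<forall>a\<in>Poly_Mapping.keys p. 2 \<le> mono_degree a" "a \<in> Poly_Mapping.keys (pderiv4 i p)"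
  shows "1 \<le> mono_degree a"
proof -
  have "2 \<le> mono_degree (a + Poly_Mapping.single i 1)"
    using assms keys_pderiv4 by simp
  then show ?thesis by (simp add: mono_degree_add mono_degree_single)
qed

lemma degree_pderiv4_mult:
  assumes f: "\<forall>a\<in>Poly_Mapping.keys f. 2 \<le> mono_degree a"
    and g: "\<forall>a\<in>Poly_Mapping.keys g. 2 \<le> mono_degree a"
    and a: "a \<in> Poly_Mapping.keys (pderiv4 i f * pderiv4 j g)"
  shows "2 \<le> mono_degree a"
proof -
  have "a \<in> {b + c | b c. b \<in> Poly_Mapping.keys (pderiv4 i f) \<and> c \<in> Poly_Mapping.keys (pderiv4 j g)}"
    by (rule subsetD[OF keys_mult a])
  then obtain b c where "b \<in> Poly_Mapping.keys (pderiv4 i f)"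
      "c \<in> Poly_Mapping.keys (pderiv4 j g)" "a = b + c"
    by auto
  then show ?thesis
    using degree_pderiv4[OF f, of b i] degree_pderiv4[OF g, of c j] by (simp add: mono_degree_add)
qed

lemma degree_poisson:
  assumes f: "\<forall>a\<in>Poly_Mapping.keys f. 2 \<le> mono_degree a"
    and g: "\<forall>a\<in>Poly_Mapping.keys g. 2 \<le> mono_degree a"
    and a: "a \<in> Poly_Mapping.keys (poisson f g)"
  shows "2 \<le> mono_degree a"
proof -
  consider i j where "a \<in> Poly_Mapping.keys (pderiv4 i f * pderiv4 j g)"
    using a unfolding poisson_def
    by (auto dest!: subsetD[OF keys_diff] subsetD[OF keys_add])
  then show ?thesis by cases (rule degree_pderiv4_mult[OF f g])
qed

section \<open>The Lie algebra of polynomials without terms of degree 0 and 1\<close>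

typedef ham = "{p :: poly4. \<forall>a\<in>Poly_Mapping.keys p. 2 \<le> mono_degree a}"
  morphisms poly_of Ham
  by (rule exI[of _ 0]) simp

setup_lifting type_definition_ham

instantiation ham :: real_vector
begin

lift_definition zero_ham :: ham is 0 by simp
lift_definition plus_ham :: "ham \<Rightarrow> ham \<Rightarrow> ham" is "(+)"
  by (auto dest!: subsetD[OF keys_add])
lift_definition uminus_ham :: "ham \<Rightarrow> ham" is uminus by simp
lift_definition minus_ham :: "ham \<Rightarrow> ham \<Rightarrow> ham" is "(-)"
  by (auto dest!: subsetD[OF keys_diff])
lift_definition scaleR_ham :: "real \<Rightarrow> ham \<Rightarrow> ham" is "\<lambda>c p. const4 c * p"
  by (auto simp: in_keys_iff lookup_const4_mult)

instance
proof
  fix a b c :: ham and x y :: real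
  show "a + b + c = a + (b + c)" by transfer (rule add.assoc)
  show "a + b = b + a" by transfer (rule add.commute)
  show "0 + a = a" by transfer (rule add_0)
  show "- a + a = 0" by transfer (rule left_minus)
  show "a - b = a + - b" by transfer (rule diff_conv_add_uminus)
  show "x *\<^sub>R (a + b) = x *\<^sub>R a + x *\<^sub>R b" by transfer (rule distrib_left)
  show "(x + y) *\<^sub>R a = x *\<^sub>R a + y *\<^sub>R a" by transfer (simp only: const4_add distrib_right)
  show "x *\<^sub>R y *\<^sub>R a = (x * y) *\<^sub>R a" by transfer (simp only: const4_mult mult.assoc)
  show "1 *\<^sub>R a = a" by transfer (simp only: const4_1 mult_1)
qed

end

lift_definition bracket :: "ham \<Rightarrow> ham \<Rightarrow> ham" is poisson
  by (metis degree_poisson)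

section \<open>The momentum mapping of the linear symplectic action\<close>

definition omega :: "real ^ 4 \<Rightarrow> real ^ 4 \<Rightarrow> real" where
  "omega u v = u $ 1 * v $ 4 + u $ 2 * v $ 3 - u $ 3 * v $ 2 - u $ 4 * v $ 1"

definition sp4 :: "(real ^ 4 ^ 4) set" where
  "sp4 = {A. \<forall>u v. omega (A *v u) v + omega u (A *v v) = 0}"

text \<open>The Hamiltonian of the linear vector field \<open>x \<mapsto> A x\<close> is the quadratic polynomial
  \<open>omega (A x) x / 2\<close>. (With the opposite sign convention the set of all
  \<open>J_hat A\<close>, \<open>A \<in> sp4\<close>, is the same.)\<close>

definition J_poly :: "real ^ 4 ^ 4 \<Rightarrow> poly4" where
  "J_poly A = (\<Sum>i\<in>UNIV. \<Sum>j\<in>UNIV.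
     const4 (omega (A *v axis i 1) (axis j 1) / 2) * (var4 i * var4 j))"

lemma homogeneous_sum: "(\<And>i. i \<in> I \<Longrightarrow> homogeneous l (p i)) \<Longrightarrow> homogeneous l (sum p I)"
  unfolding homogeneous_def using keys_sum[of p I] by blast

lemma homogeneous_J_poly: "homogeneous 2 (J_poly A)"
  unfolding J_poly_def
  by (intro homogeneous_sum)
     (auto simp: homogeneous_def const4_def var4_def mult_single mono_degree_add mono_degree_single)

lift_definition J_hat :: "real ^ 4 ^ 4 \<Rightarrow> ham" is J_poly
  using homogeneous_J_poly by (simp add: homogeneous_def)

lemma lookup_J_poly:
  "Poly_Mapping.lookup (J_poly A) a = (\<Sum>i\<in>UNIV. \<Sum>j\<in>UNIV.
     if a = Poly_Mapping.single i 1 + Poly_Mapping.single j 1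
     then omega (A *v axis i 1) (axis j 1) / 2 else 0)"
  unfolding J_poly_def const4_def var4_def mult_single lookup_sum
  by (intro sum.cong refl) (auto simp: lookup_single when_def)

lemma mono_degree_2D:
  assumes "mono_degree a = 2"
  shows "\<exists>k l. a = Poly_Mapping.single k 1 + Poly_Mapping.single l 1"
proof -
  have split: "\<exists>k b. a = Poly_Mapping.single k 1 + b \<and> mono_degree b = n"
    if "mono_degree a = Suc n" for a n
  proof -
    have "\<exists>k. Poly_Mapping.lookup a k \<noteq> 0"
    proof (rule ccontr)
      assume "\<nexists>k. Poly_Mapping.lookup a k \<noteq> 0"
      then have "mono_degree a = 0" by (simp add: mono_degree_def)
      then show False using that by simp
    qed
    then obtain k where k: "Poly_Mapping.lookup a k \<noteq> 0" ..
    define b where "b = a - Poly_Mapping.single k 1"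
    have "a = Poly_Mapping.single k 1 + b"
      unfolding b_def using k
      by (intro poly_mapping_eqI) (auto simp: lookup_add lookup_minus lookup_single when_def)
    moreover from this have "mono_degree b = n"
      using that by (simp add: mono_degree_add mono_degree_single)
    ultimately show ?thesis by blast
  qed
  obtain k b where k: "a = Poly_Mapping.single k 1 + b" "mono_degree b = 1"
    using split[of a 1] assms by auto
  obtain l c where l: "b = Poly_Mapping.single l 1 + c" "mono_degree c = 0"
    using split[of b 0] k by auto
  have "c = 0"
    using l(2) by (intro poly_mapping_eqI) (simp add: mono_degree_def)
  then show ?thesis using k l by auto
qed

lemma single_add_single_eq_iff:
  "Poly_Mapping.single k (1::nat) + Poly_Mapping.single l 1 =
     Poly_Mapping.single i 1 + Poly_Mapping.single j 1 \<longleftrightarrow> (i = k \<and> j = l) \<or> (i = l \<and> j = k)"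
  (is "?L \<longleftrightarrow> ?R")
proof
  assume L: ?L
  have *: "(if k = r then 1 else 0) + (if l = r then 1 else 0) =
      (if i = r then 1 else 0) + (if j = r then 1 else (0::nat))" for r
    using arg_cong[OF L, of "\<lambda>a. Poly_Mapping.lookup a r"]
    by (simp add: lookup_add lookup_single when_def split: if_splits)
  have "k = i \<or> l = i" using *[of i] by (auto split: if_splits)
  then show ?R
  proof
    assume "k = i" then show ?R using *[of j] by (simp split: if_splits)
  next
    assume "l = i" then show ?R using *[of j] by (simp split: if_splits)
  qed
qed (auto simp: add.commute)

theorem range_J_hat: "J_hat ` sp4 = {f. homogeneous 2 (poly_of f)}"
proof
  show "J_hat ` sp4 \<subseteq> {f. homogeneous 2 (poly_of f)}"
    by (auto simp: J_hat.rep_eq homogeneous_J_poly)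
  show "{f. homogeneous 2 (poly_of f)} \<subseteq> J_hat ` sp4"
  proof
    fix f assume "f \<in> {f. homogeneous 2 (poly_of f)}"
    then have hom: "homogeneous 2 (poly_of f)" by simp
    define h where "h i j = Poly_Mapping.lookup (poly_of f)
      (Poly_Mapping.single i 1 + Poly_Mapping.single j 1) * (if i = j then 2 else 1)" for i j
    define A :: "real ^ 4 ^ 4" where "A = (\<chi> r i. if r = 1 then h i 4 else if r = 2 then h i 3
      else if r = 3 then - h i 2 else - h i 1)"
    have A: "A $ 1 $ i = h i 4" "A $ 2 $ i = h i 3" "A $ 3 $ i = - h i 2" "A $ 4 $ i = - h i 1" for i
      by (simp_all add: A_def)
    have sym: "h i j = h j i" for i j
      by (simp add: h_def add.commute)
    have "omega (A *v u) v + omega u (A *v v) = 0" for u v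
      unfolding omega_def matrix_vector_mult_def
      by (simp add: sum_4 A sym[of 2 1] sym[of 3 1] sym[of 4 1] sym[of 3 2] sym[of 4 2] sym[of 4 3]
          algebra_simps)
    then have sp: "A \<in> sp4" by (simp add: sp4_def)
    have om: "omega (A *v axis i 1) (axis j 1) = h i j" for i j
      using exhaust_4[of j] by (auto simp: omega_def matrix_vector_mul_component A axis_def
          inner_vec_def if_distrib[of "(*) _"] cong: if_cong)
    have "J_poly A = poly_of f"
    proof (rule poly_mapping_eqI)
      fix a
      show "Poly_Mapping.lookup (J_poly A) a = Poly_Mapping.lookup (poly_of f) a"
      proof (cases "mono_degree a = 2")
        case False
        then have "Poly_Mapping.lookup (poly_of f) a = 0" "Poly_Mapping.lookup (J_poly A) a = 0"
          using hom homogeneous_J_poly[of A] by (auto simp: homogeneous_def in_keys_iff)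
        then show ?thesis by simp
      next
        case True
        then obtain k l where a: "a = Poly_Mapping.single k 1 + Poly_Mapping.single l 1"
          using mono_degree_2D by blast
        have "Poly_Mapping.lookup (J_poly A) a = (\<Sum>i\<in>UNIV. \<Sum>j\<in>UNIV.
            if (i = k \<and> j = l) \<or> (i = l \<and> j = k) then h i j / 2 else 0)"
          unfolding lookup_J_poly om a single_add_single_eq_iff ..
        also have "\<dots> = (\<Sum>i\<in>UNIV. \<Sum>j\<in>UNIV. (if j = l then if i = k then h k l / 2 else 0 else 0)
            + (if j = k then if i = l then if k = l then 0 else h k l / 2 else 0 else 0))"
          by (intro sum.cong refl) (auto simp: sym)
        also have "\<dots> = Poly_Mapping.lookup (poly_of f) a"
          by (simp add: sum.distrib a h_def)
        finally show ?thesis .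
      qed
    qed
    then have "f = J_hat A"
      by (metis J_hat.rep_eq poly_of_inject)
    then show "f \<in> J_hat ` sp4" using sp by blast
  qed
qed

section \<open>Cochains\<close>

instantiation "fun" :: (type, real_vector) real_vector
begin

definition scaleR_fun :: "real \<Rightarrow> ('a \<Rightarrow> 'b) \<Rightarrow> 'a \<Rightarrow> 'b" where
  "scaleR_fun c f = (\<lambda>x. c *\<^sub>R f x)"

instance
  by standard (simp_all add: scaleR_fun_def fun_eq_iff scaleR_add_right scaleR_add_left)

end

text \<open>An \<open>m\<close>-cochain is an alternating multilinear form on the Lie algebra; it is
  represented by a function on argument lists that vanishes on all lists of length
  other than \<open>m\<close>.\<close>

type_synonym form = "ham list \<Rightarrow> real"

text \<open>Interior multiplication by \<open>f\<close>.\<close>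

definition contract :: "ham \<Rightarrow> form \<Rightarrow> form" where
  "contract f s = (\<lambda>fs. s (f # fs))"

definition parity :: "form \<Rightarrow> form" where
  "parity s = (\<lambda>fs. (-1) ^ length fs * s fs)"

text \<open>The exterior product, normalised by
  \<open>(z1 \<and> z2) (f, g) = z1 f * z2 g - z1 g * z2 f\<close> for 1-forms. The recursion says that
  interior multiplication by \<open>f\<close> is an antiderivation.\<close>

primrec wedge :: "form \<Rightarrow> form \<Rightarrow> form" where
  "wedge s t [] = s [] * t []"
| "wedge s t (f # fs) = wedge (contract f s) t fs + wedge (parity s) (contract f t) fs"

definition unit_form :: form where
  "unit_form = (\<lambda>fs. if fs = [] then 1 else 0)"

definition one_form :: "(ham \<Rightarrow> real) \<Rightarrow> form" where
  "one_form z = (\<lambda>fs. case fs of [f] \<Rightarrow> z f | _ \<Rightarrow> 0)"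

definition wedge_list :: "(ham \<Rightarrow> real) list \<Rightarrow> form" where
  "wedge_list zs = foldr (\<lambda>z. wedge (one_form z)) zs unit_form"

text \<open>The dual of the space of homogeneous polynomials of degree \<open>l\<close>, its elements being
  extended by zero to the other homogeneous components.\<close>

definition hom_dual :: "nat \<Rightarrow> (ham \<Rightarrow> real) set" where
  "hom_dual l = {z. linear z \<and> (\<forall>k f. k \<noteq> l \<longrightarrow> homogeneous k (poly_of f) \<longrightarrow> z f = 0)}"

text \<open>A sequence of exponents \<open>(k\<^sub>2, k\<^sub>3, \<dots>)\<close> is encoded as the multiset in which \<open>l\<close>
  occurs \<open>k\<^sub>l\<close> times; \<open>ext_power D\<close> is the space
  \<open>\<Lambda>\<close>\<open>k\<^sub>2\<close> \<open>hom_dual 2\<close> \<open>\<and>\<close> \<open>\<Lambda>\<close>\<open>k\<^sub>3\<close> \<open>hom_dual 3\<close> \<open>\<and>\<close> \<open>\<dots>\<close>\<close>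

definition ext_power :: "nat multiset \<Rightarrow> form set" where
  "ext_power D = span {wedge_list zs | zs.
     list_all2 (\<lambda>l z. z \<in> hom_dual l) (sorted_list_of_multiset D) zs}"

definition cochains :: "nat \<Rightarrow> nat \<Rightarrow> form set" where
  "cochains m w = span (\<Union>D\<in>{D. (\<forall>l\<in>#D. 2 \<le> l) \<and> size D = m \<and> (\<Sum>l\<in>#D. l - 2) = w}.
     ext_power D)"

definition coboundary :: "form \<Rightarrow> form" where
  "coboundary s = (\<lambda>fs. \<Sum>j<length fs. \<Sum>i<j.
     (-1) ^ (i + j) * s (bracket (fs ! i) (fs ! j) # nths fs (- {i, j})))"

definition relative_cochains :: "nat \<Rightarrow> nat \<Rightarrow> form set" where
  "relative_cochains m w = {s \<in> cochains m w.
     \<forall>A\<in>sp4. contract (J_hat A) s = 0 \<and> contract (J_hat A) (coboundary s) = 0}"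

text \<open>On cochains, \<^const>\<open>coboundary\<close> is the antiderivation that is determined on 1-cochains by
  \<open>(d z) (f, g) = - z (bracket f g)\<close>: see \<open>coboundary_one_form\<close> and \<open>coboundary_wedge\<close> below.\<close>

lemma scaleR_fun_apply: "(c *\<^sub>R s) fs = c *\<^sub>R s fs"
  by (simp add: scaleR_fun_def)

lemma contract_add: "contract f (s + t) = contract f s + contract f t"
  and contract_diff: "contract f (s - t) = contract f s - contract f t"
  and contract_minus: "contract f (- s) = - contract f s"
  and contract_zero: "contract f 0 = 0"
  and contract_scaleR: "contract f (c *\<^sub>R s) = c *\<^sub>R contract f s"
  by (simp_all add: contract_def fun_eq_iff scaleR_fun_def)

lemma parity_add: "parity (s + t) = parity s + parity t"
  and parity_diff: "parity (s - t) = parity s - parity t"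
  and parity_minus: "parity (- s) = - parity s"
  and parity_zero: "parity 0 = 0"
  and parity_scaleR: "parity (c *\<^sub>R s) = c *\<^sub>R parity s"
  by (simp_all add: parity_def fun_eq_iff scaleR_fun_def algebra_simps)

lemma parity_parity: "parity (parity s) = s"
  by (simp add: parity_def fun_eq_iff flip: power_add mult.assoc)

lemma contract_parity: "contract f (parity s) = - parity (contract f s)"
  by (simp add: contract_def parity_def fun_eq_iff)

lemma contract_wedge: "contract f (wedge s t) = wedge (contract f s) t + wedge (parity s) (contract f t)"
  by (rule ext) (simp add: contract_def)

lemma wedge_add_left: "wedge (s + s') t = wedge s t + wedge s' t"
proof
  fix fs show "wedge (s + s') t fs = (wedge s t + wedge s' t) fs"
    by (induction fs arbitrary: s s' t) (simp_all add: contract_add parity_add algebra_simps)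
qed

lemma wedge_add_right: "wedge s (t + t') = wedge s t + wedge s t'"
proof
  fix fs show "wedge s (t + t') fs = (wedge s t + wedge s t') fs"
    by (induction fs arbitrary: s t t') (simp_all add: contract_add algebra_simps)
qed

lemma wedge_scaleR_left: "wedge (c *\<^sub>R s) t = c *\<^sub>R wedge s t"
proof
  fix fs show "wedge (c *\<^sub>R s) t fs = (c *\<^sub>R wedge s t) fs"
    by (induction fs arbitrary: s t)
       (simp_all add: contract_scaleR parity_scaleR scaleR_fun_apply algebra_simps)
qed

lemma wedge_scaleR_right: "wedge s (c *\<^sub>R t) = c *\<^sub>R wedge s t"
proof
  fix fs show "wedge s (c *\<^sub>R t) fs = (c *\<^sub>R wedge s t) fs"
    by (induction fs arbitrary: s t)
       (simp_all add: contract_scaleR scaleR_fun_apply algebra_simps)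
qed

lemma minus_eq_scaleR: "- s = (-1) *\<^sub>R (s :: form)"
  by simp

lemma wedge_minus_left: "wedge (- s) t = - wedge s t"
  unfolding minus_eq_scaleR[of s] wedge_scaleR_left by simp

lemma wedge_minus_right: "wedge s (- t) = - wedge s t"
  unfolding minus_eq_scaleR[of t] wedge_scaleR_right by simp

lemma wedge_diff_left: "wedge (s - s') t = wedge s t - wedge s' t"
  by (simp only: diff_conv_add_uminus wedge_add_left wedge_minus_left)

lemma wedge_diff_right: "wedge s (t - t') = wedge s t - wedge s t'"
  by (simp only: diff_conv_add_uminus wedge_add_right wedge_minus_right)

definition alternating :: "form \<Rightarrow> bool" where
  "alternating s \<longleftrightarrow> (\<forall>xs a b ys. s (xs @ a # b # ys) = - s (xs @ b # a # ys))"

lemma alternatingD: "alternating s \<Longrightarrow> s (xs @ a # b # ys) = - s (xs @ b # a # ys)"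
  unfolding alternating_def by blast

lemma alternating_contract: "alternating s \<Longrightarrow> alternating (contract f s)"
  unfolding alternating_def contract_def append_Cons[symmetric] by blast

lemma alternating_parity: "alternating s \<Longrightarrow> alternating (parity s)"
proof -
  assume s: "alternating s"
  show ?thesis
    unfolding alternating_def
  proof (intro allI)
    fix xs a b ys
    show "parity s (xs @ a # b # ys) = - parity s (xs @ b # a # ys)"
      unfolding parity_def alternatingD[OF s, of xs a b ys] by simp
  qed
qed

lemma alternating_contract_swap:
  "alternating s \<Longrightarrow> contract a (contract b s) = - contract b (contract a s)"
  using alternatingD[of s "[]" b a] by (simp add: contract_def fun_eq_iff)

lemma alternating_add:
  assumes "alternating s" "alternating t"
  shows "alternating (s + t)"
  unfolding alternating_def
proof (intro allI)
  fix xs a b ys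
  show "(s + t) (xs @ a # b # ys) = - (s + t) (xs @ b # a # ys)"
    using assms[THEN alternatingD, of xs a b ys] by simp
qed

lemma alternating_scaleR:
  assumes "alternating s"
  shows "alternating (c *\<^sub>R s)"
  unfolding alternating_def
proof (intro allI)
  fix xs a b ys
  show "(c *\<^sub>R s) (xs @ a # b # ys) = - (c *\<^sub>R s) (xs @ b # a # ys)"
    using alternatingD[OF assms, of xs a b ys] by (simp add: scaleR_fun_apply)
qed

lemma alternating_zero: "alternating 0"
  by (simp add: alternating_def)

lemma alternating_wedge:
  assumes "alternating s" "alternating t"
  shows "alternating (wedge s t)"
proof -
  have "wedge s t (xs @ a # b # ys) = - wedge s t (xs @ b # a # ys)" for xs a b ys
    using assms
  proof (induction xs arbitrary: s t)
    case Nil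
    show ?case
      unfolding append_Nil wedge.simps contract_parity parity_parity wedge_minus_left
        alternating_contract_swap[OF Nil(1), of a b] alternating_contract_swap[OF Nil(2), of a b]
        wedge_minus_right
      by (simp add: parity_minus wedge_minus_left)
  next
    case (Cons x xs)
    then show ?case
      by (simp add: alternating_contract alternating_parity)
  qed
  then show ?thesis unfolding alternating_def by blast
qed

lemma alternating_move:
  "alternating s \<Longrightarrow> s (xs @ h # ys) = (-1) ^ length xs * s (h # xs @ ys)"
proof (induction xs arbitrary: s)
  case (Cons x xs)
  have "s ((x # xs) @ h # ys) = contract x s (xs @ h # ys)"
    by (simp add: contract_def)
  also have "\<dots> = (-1) ^ length xs * contract x s (h # xs @ ys)"
    using Cons by (simp add: alternating_contract)
  also have "contract x s (h # xs @ ys) = - s ([] @ h # x # xs @ ys)"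
    using alternatingD[OF Cons.prems, of "[]" x h] by (simp add: contract_def)
  finally show ?case by simp
qed simp

definition lie :: "ham \<Rightarrow> form \<Rightarrow> form" where
  "lie f s = (\<lambda>fs. - (\<Sum>k<length fs. s (fs[k := bracket f (fs ! k)])))"

lemma lie_add: "lie f (s + t) = lie f s + lie f t"
  and lie_parity: "lie f (parity s) = parity (lie f s)"
  by (simp_all add: lie_def parity_def fun_eq_iff sum.distrib sum_distrib_left)

lemma contract_lie: "contract g (lie f s) = lie f (contract g s) - contract (bracket f g) s"
proof
  fix fs
  show "contract g (lie f s) fs = (lie f (contract g s) - contract (bracket f g) s) fs"
    unfolding lie_def contract_def minus_apply list.size add_Suc_right add_0_right
      sum.lessThan_Suc_shift nth_Cons_0 nth_Cons_Suc list_update.simps nat.case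
    by simp
qed

lemma lie_wedge: "lie f (wedge s t) = wedge (lie f s) t + wedge s (lie f t)"
proof
  fix fs show "lie f (wedge s t) fs = (wedge (lie f s) t + wedge s (lie f t)) fs"
  proof (induction fs arbitrary: s t)
    case Nil
    show ?case by (simp add: lie_def)
  next
    case (Cons g fs)
    have "lie f (wedge s t) (g # fs) = contract g (lie f (wedge s t)) fs"
      by (simp add: contract_def)
    also have "\<dots> = (lie f (wedge (contract g s) t) + lie f (wedge (parity s) (contract g t))
        - (wedge (contract (bracket f g) s) t + wedge (parity s) (contract (bracket f g) t))) fs"
      by (simp only: contract_lie contract_wedge lie_add)
    finally show ?case
      by (simp add: Cons.IH contract_lie lie_parity wedge_diff_left wedge_diff_right)
  qed
qed

lemma nths_Cons_Suc: "nths (f # fs) (- {0, Suc j}) = nths fs (- {j})"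
  "nths (f # fs) (- {Suc i, Suc j}) = f # nths fs (- {i, j})"
  by (simp_all add: nths_Cons Compl_eq)

lemma nths_drop1: "j < length fs \<Longrightarrow> nths fs (- {j}) = take j fs @ drop (Suc j) fs"
proof (induction fs arbitrary: j)
  case (Cons f fs)
  show ?case
  proof (cases j)
    case 0
    then show ?thesis by (simp add: nths_Cons Compl_eq nths_all)
  next
    case (Suc k)
    then show ?thesis using Cons by (simp add: nths_Cons Compl_eq)
  qed
qed simp

lemma contract_coboundary:
  assumes "alternating s"
  shows "contract f (coboundary s) = lie f s - coboundary (contract f s)"
proof
  fix fs
  have 1: "s (fs[j := h]) = (-1) ^ j * s (h # nths fs (- {j}))" if "j < length fs" for j h
    using alternating_move[OF assms, of "take j fs" h "drop (Suc j) fs"] that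
    by (simp add: nths_drop1 upd_conv_take_nth_drop)
  have 2: "s (h # f # xs) = - s (f # h # xs)" for h xs
    using alternatingD[OF assms, of "[]" h f] by simp
  have "contract f (coboundary s) fs = (\<Sum>j<length fs.
      - ((-1) ^ j * s (bracket f (fs ! j) # nths fs (- {j})))
      + (\<Sum>i<j. (-1) ^ (i + j) * s (bracket (fs ! i) (fs ! j) # f # nths fs (- {i, j}))))"
    by (simp add: contract_def coboundary_def sum.lessThan_Suc_shift nths_Cons_Suc
        del: sum.lessThan_Suc)
  also have "\<dots> = (\<Sum>j<length fs. - s (fs[j := bracket f (fs ! j)])
      - (\<Sum>i<j. (-1) ^ (i + j) * contract f s (bracket (fs ! i) (fs ! j) # nths fs (- {i, j}))))"
    by (intro sum.cong refl) (simp add: 1 2 contract_def sum_negf flip: power_add mult.assoc)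
  also have "\<dots> = (lie f s - coboundary (contract f s)) fs"
    by (simp add: lie_def coboundary_def sum_subtractf sum_negf)
  finally show "contract f (coboundary s) fs = (lie f s - coboundary (contract f s)) fs" .
qed

lemma coboundary_add: "coboundary (s + t) = coboundary s + coboundary t"
  and coboundary_scaleR: "coboundary (c *\<^sub>R s) = c *\<^sub>R coboundary s"
  by (simp_all add: coboundary_def fun_eq_iff scaleR_fun_def sum.distrib sum_distrib_left
      algebra_simps)

lemma linear_coboundary: "linear coboundary"
  by (rule linearI) (rule coboundary_add, rule coboundary_scaleR)

lemma length_nths_drop2: "i < j \<Longrightarrow> j < length fs \<Longrightarrow> length fs = Suc (Suc (length (nths fs (- {i, j}))))"
proof -
  assume a: "i < j" "j < length fs"
  have "{k. k < length fs \<and> k \<in> - {i, j}} = {..<length fs} - {i, j}" by auto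
  then show ?thesis using a by (simp add: length_nths card_Diff_subset)
qed

lemma coboundary_parity: "coboundary (parity s) = - parity (coboundary s)"
proof
  fix fs
  have "(-1) ^ (i + j) * parity s (bracket (fs ! i) (fs ! j) # nths fs (- {i, j})) =
      - ((-1) ^ length fs * ((-1) ^ (i + j) * s (bracket (fs ! i) (fs ! j) # nths fs (- {i, j}))))"
    if "j < length fs" "i < j" for i j
    unfolding parity_def length_nths_drop2[OF that(2,1)] by simp
  then have "coboundary (parity s) fs = (\<Sum>j<length fs. \<Sum>i<j.
      - ((-1) ^ length fs * ((-1) ^ (i + j) * s (bracket (fs ! i) (fs ! j) # nths fs (- {i, j})))))"
    unfolding coboundary_def by (intro sum.cong refl) simp_all
  also have "\<dots> = - ((-1) ^ length fs * coboundary s fs)"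
    unfolding coboundary_def sum_distrib_left sum_negf ..
  finally show "coboundary (parity s) fs = (- parity (coboundary s)) fs"
    unfolding parity_def[of "coboundary s"] uminus_apply .
qed

lemma coboundary_wedge_alternating:
  assumes "alternating s" "alternating t"
  shows "coboundary (wedge s t) = wedge (coboundary s) t + wedge (parity s) (coboundary t)"
proof
  fix fs
  show "coboundary (wedge s t) fs = (wedge (coboundary s) t + wedge (parity s) (coboundary t)) fs"
    using assms
  proof (induction fs arbitrary: s t)
    case Nil
    show ?case by (simp add: coboundary_def)
  next
    case (Cons f fs)
    note alt = alternating_wedge alternating_contract alternating_parity Cons.prems
    have e: "wedge (coboundary (parity s)) (contract f t) = - wedge (parity (coboundary s)) (contract f t)"
      unfolding coboundary_parity wedge_minus_left ..
    have "coboundary (wedge s t) (f # fs) = contract f (coboundary (wedge s t)) fs"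
      by (simp add: contract_def)
    also have "\<dots> = (lie f (wedge s t) - (coboundary (wedge (contract f s) t)
        + coboundary (wedge (parity s) (contract f t)))) fs"
      by (simp only: contract_coboundary alt contract_wedge coboundary_add)
    finally show ?case
      by (simp only: wedge.simps plus_fun_apply minus_apply uminus_apply Cons.IH alt lie_wedge e
          contract_coboundary contract_parity parity_parity wedge_diff_left
          wedge_diff_right wedge_minus_left wedge_minus_right)
  qed
qed

lemma alternating_one_form: "alternating (one_form z)"
proof -
  have "one_form z (xs @ a # b # ys) = 0" for xs a b ys
    by (cases xs; cases "tl xs") (auto simp: one_form_def split: list.splits)
  then show ?thesis by (simp add: alternating_def)
qed

lemma alternating_unit_form: "alternating unit_form"
  by (simp add: alternating_def unit_form_def)

lemma alternating_wedge_list: "alternating (wedge_list zs)"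
  unfolding wedge_list_def
  by (induction zs) (simp_all add: alternating_unit_form alternating_wedge alternating_one_form)

lemma wedge_list_support: "length fs \<noteq> length zs \<Longrightarrow> wedge_list zs fs = 0"
proof -
  have c: "contract f (one_form z) = z f *\<^sub>R unit_form" for f z
    by (auto simp: contract_def one_form_def unit_form_def fun_eq_iff scaleR_fun_def split: list.splits)
  have u: "wedge unit_form t = t" for t
  proof
    fix gs show "wedge unit_form t gs = t gs"
    proof (induction gs arbitrary: t)
      case (Cons g gs)
      have "contract g unit_form = 0 *\<^sub>R unit_form" "parity unit_form = unit_form"
        by (auto simp: contract_def parity_def unit_form_def fun_eq_iff scaleR_fun_def)
      then show ?case
        by (simp only: wedge.simps wedge_scaleR_left Cons.IH) (simp add: contract_def scaleR_fun_def)
    qed (simp add: unit_form_def)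
  qed
  have o: "parity (one_form z) = - one_form z" for z
    by (auto simp: parity_def one_form_def fun_eq_iff split: list.splits)
  have s: "wedge (one_form z) t gs = 0"
    if "\<And>fs. length fs \<noteq> n \<Longrightarrow> t fs = 0" "length gs \<noteq> Suc n" for z t n gs
    using that
  proof (induction gs arbitrary: t n)
    case (Cons g gs)
    have "wedge (one_form z) (contract g t) gs = 0"
    proof (cases n)
      case 0
      then have "contract g t = 0 *\<^sub>R t"
        using Cons.prems(1) by (simp add: contract_def fun_eq_iff scaleR_fun_def)
      then show ?thesis by (simp only: wedge_scaleR_right) (simp add: scaleR_fun_def)
    next
      case (Suc k)
      show ?thesis
        by (rule Cons.IH[of k]) (use Suc Cons.prems in \<open>auto simp: contract_def\<close>)
    qed
    then show ?case
      using Cons.prems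
      by (simp only: wedge.simps c o u wedge_scaleR_left wedge_minus_left scaleR_fun_apply uminus_apply)
        simp
  qed (simp add: one_form_def)
  show "length fs \<noteq> length zs \<Longrightarrow> wedge_list zs fs = 0"
  proof (induction zs arbitrary: fs)
    case Nil
    then show ?case by (simp add: wedge_list_def unit_form_def)
  next
    case (Cons z zs)
    have "wedge_list (z # zs) fs = wedge (one_form z) (wedge_list zs) fs"
      by (simp add: wedge_list_def)
    then show ?case using s[of "length zs" "wedge_list zs" fs z] Cons by simp
  qed
qed

lemma cochains_induct:
  assumes "s \<in> cochains m w" "P 0"
    and "\<And>s t. P s \<Longrightarrow> P t \<Longrightarrow> P (s + t)" "\<And>c s. P s \<Longrightarrow> P (c *\<^sub>R s)"
    and "\<And>zs. length zs = m \<Longrightarrow> P (wedge_list zs)"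
  shows "P s"
proof -
  have sub: "subspace {s. P s}"
    using assms(2-4) by (simp add: subspace_def)
  have "ext_power D \<subseteq> {s. P s}" if "size D = m" for D
    unfolding ext_power_def
  proof (rule span_minimal[OF _ sub], clarify)
    fix zs assume "list_all2 (\<lambda>l z. z \<in> hom_dual l) (sorted_list_of_multiset D) zs"
    then have "length zs = size D"
      by (metis list_all2_lengthD mset_sorted_list_of_multiset size_mset)
    then show "P (wedge_list zs)" using assms(5) that by simp
  qed
  then have "cochains m w \<subseteq> {s. P s}"
    unfolding cochains_def by (intro span_minimal[OF _ sub]) auto
  then show ?thesis using assms(1) by auto
qed

lemma alternating_cochains: "s \<in> cochains m w \<Longrightarrow> alternating s"
  by (erule cochains_induct)
     (fact alternating_zero | rule alternating_add alternating_scaleR alternating_wedge_list; assumption)+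

lemma cochains_support:
  assumes "s \<in> cochains m w" "length fs \<noteq> m"
  shows "s fs = 0"
  using assms(1)
  by (rule cochains_induct[where P = "\<lambda>s. s fs = 0"])
     (use assms(2) in \<open>simp_all add: scaleR_fun_def wedge_list_support\<close>)

lemma parity_cochains: "s \<in> cochains m w \<Longrightarrow> parity s = (-1) ^ m *\<^sub>R s"
  by (rule ext) (auto simp: parity_def scaleR_fun_def dest: cochains_support)

theorem coboundary_one_form:
  "coboundary (one_form z) fs = (case fs of [f, g] \<Rightarrow> - z (bracket f g) | _ \<Rightarrow> 0)"
proof (cases "length fs = 2")
  case True
  then obtain f g where fs: "fs = [f, g]"
    by (auto simp: length_Suc_conv numeral_2_eq_2)
  have "{..<Suc (Suc 0)} = {0, 1}" by auto
  then show ?thesis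
    by (simp add: fs coboundary_def one_form_def nths_Cons)
next
  case False
  have "one_form z (h # nths fs (- {i, j})) = 0" if "i < j" "j < length fs" for h i j
    using length_nths_drop2[OF that] False by (auto simp: one_form_def split: list.splits)
  then have "coboundary (one_form z) fs = 0"
    unfolding coboundary_def by (intro sum.neutral ballI) simp
  then show ?thesis using False by (auto split: list.splits)
qed

theorem coboundary_wedge:
  assumes "s \<in> cochains m w" "t \<in> cochains m' w'"
  shows "coboundary (wedge s t) = wedge (coboundary s) t + (-1) ^ m *\<^sub>R wedge s (coboundary t)"
  using coboundary_wedge_alternating[OF assms[THEN alternating_cochains]]
  by (simp add: parity_cochains[OF assms(1)] wedge_scaleR_left)

section \<open>Cohomology\<close>

definition cocycles :: "nat \<Rightarrow> nat \<Rightarrow> form set" where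
  "cocycles m w = {s \<in> relative_cochains m w. coboundary s = 0}"

fun coboundaries :: "nat \<Rightarrow> nat \<Rightarrow> form set" where
  "coboundaries 0 w = {0}"
| "coboundaries (Suc m) w = coboundary ` relative_cochains m w"

text \<open>The library's \<^const>\<open>dim\<close> is 0 for infinite-dimensional spaces; the following predicates
  include finite-dimensionality.\<close>

definition has_dimension :: "'a::real_vector set \<Rightarrow> nat \<Rightarrow> bool" where
  "has_dimension V n \<longleftrightarrow> (\<exists>B. finite B \<and> card B = n \<and> independent B \<and> span B = V)"

lemma has_dimension_dim: "has_dimension V n \<Longrightarrow> dim V = n"
  unfolding has_dimension_def by (metis dim_span_eq_card_independent)

text \<open>There are \<open>n\<close> elements of \<open>V\<close> whose classes form a basis of \<open>V / W\<close>.\<close>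

definition quotient_has_dimension :: "'a::real_vector set \<Rightarrow> 'a set \<Rightarrow> nat \<Rightarrow> bool" where
  "quotient_has_dimension V W n \<longleftrightarrow> (\<exists>B. finite B \<and> card B = n \<and> B \<subseteq> V \<and>
     (\<forall>c. (\<Sum>b\<in>B. c b *\<^sub>R b) \<in> W \<longrightarrow> (\<forall>b\<in>B. c b = 0)) \<and>
     (\<forall>v\<in>V. \<exists>c. v - (\<Sum>b\<in>B. c b *\<^sub>R b) \<in> W))"

definition has_betti_number :: "nat \<Rightarrow> nat \<Rightarrow> nat \<Rightarrow> bool" where
  "has_betti_number m w n \<longleftrightarrow> quotient_has_dimension (cocycles m w) (coboundaries m w) n"

end

theory Submission
  imports Defs
begin

text \<open>A relative cochain is an alternating multilinear form that is invariant under the quadratic monomials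
  \<open>X\<close> and vanishes if one of its arguments is quadratic. Its coordinates are its values on tuples of
  monomials. Upper bounds: every equation \<open>lie X s T = 0\<close> is a sparse linear relation between coordinates.
  By invariance it suffices to know the coordinates that contain \<open>x\<^sub>1\<^sup>k\<close> and \<open>x\<^sub>4\<^sup>l\<close>, and these can be computed
  one after the other from relations with a single unknown, starting with 1, 1, 0, 4, 4 coordinates in
  degrees 2 to 6. Expressing the coordinates in degrees 2 and 5 by the initial
  ones, the equation \<open>coboundary s = 0\<close> becomes a regular linear system, so that the coboundary operator is
  injective there. Lower bounds: contracting derivatives at 0 along the edges of a graph with the Poisson bivector
  gives invariants, which are evaluated on truncated exponentials of linear forms. One graph in degree 2 and four
  graphs in degree 5 are enough, as the degrees 3 and 6 then follow by injectivity. The two resulting isomorphisms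
  make all Betti numbers vanish.\<close>

section \<open>The Poisson bracket\<close>

text \<open>The obstacle is size. Degree 5 concerns forms on a space of dimension C(20,4) * 35 =
  169575, degree 6 forms on one of dimension C(20,6) = 38760, and every computation is carried out
  by rewriting. A relation with a single unknown is checked by one multiplication and addition,
  without elimination. Such a chain of relations yields upper bounds only: it does not show that the
  coordinates left free satisfy all the other relations. Existence therefore needs a construction
  whose invariance holds for a conceptual reason, and the count is exact because the two bounds
  agree. Exponentials serve as test functions because they are eigenvectors of all partial
  derivatives. A graph with eight edges expands into 4^8 terms, but on exponentials each edge
  collapses to one symplectic pairing. Cochains are defined as spans of exterior products, whereas
  both bounds work with functions on tuples. They meet in an intrinsic description: a form is a
  cochain if and only if it is alternating, multilinear, and concentrated in one length and one
  weight.\<close>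

lemma pderiv4_diff: "pderiv4 i (p - q) = pderiv4 i p - pderiv4 i q"
  by (rule poly_mapping_eqI) (simp add: lookup_pderiv4 lookup_minus algebra_simps)

lemma pderiv4_single:
  "pderiv4 i (Poly_Mapping.single a c) =
    Poly_Mapping.single (a - Poly_Mapping.single i 1) (real (Poly_Mapping.lookup a i) * c)"
  by (cases "c = 0") (simp_all add: pderiv4_def)

lemma poly4_induct [case_names single add]:
  assumes "\<And>a c. P (Poly_Mapping.single a c)" "\<And>p q. P p \<Longrightarrow> P q \<Longrightarrow> P (p + q)"
  shows "P (p :: poly4)"
proof (induction p rule: update_induct)
  case const
  then show ?case using assms(1)[of 0 0] by simp
next
  case (update f a b)
  then have "Poly_Mapping.update a b f = f + Poly_Mapping.single a b"
    by (intro poly_mapping_eqI) (auto simp: lookup_update lookup_add lookup_single when_def in_keys_iff)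
  then show ?case using assms update by simp
qed

lemma pderiv4_mult: "pderiv4 i (p * q) = pderiv4 i p * q + p * pderiv4 i q"
proof -
  let ?e = "Poly_Mapping.single i (1::nat)"
  \<comment> \<open>Subtraction of exponents is truncated, so a shift passes through a sum only
    where the exponent of variable \<open>i\<close> is positive. Where it is 0, the derivative
    carries the coefficient 0.\<close>
  have shift: "a - ?e + b = a + b - ?e" if "Poly_Mapping.lookup a i \<noteq> 0" for a b :: mono4
    using that by (intro poly_mapping_eqI) (auto simp: lookup_add lookup_minus lookup_single when_def)
  have single: "pderiv4 i (Poly_Mapping.single a c * Poly_Mapping.single b d) =
      pderiv4 i (Poly_Mapping.single a c) * Poly_Mapping.single b d
      + Poly_Mapping.single a c * pderiv4 i (Poly_Mapping.single b d)" for a b c d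
  proof (cases "Poly_Mapping.lookup a i = 0"; cases "Poly_Mapping.lookup b i = 0")
    assume "Poly_Mapping.lookup a i \<noteq> 0" "Poly_Mapping.lookup b i \<noteq> 0"
    then show ?thesis
      using shift[of a b] shift[of b a]
      by (simp add: mult_single pderiv4_single lookup_add algebra_simps flip: single_add)
  next
    assume "Poly_Mapping.lookup a i \<noteq> 0" "Poly_Mapping.lookup b i = 0"
    then show ?thesis
      using shift[of a b] by (simp add: mult_single pderiv4_single lookup_add algebra_simps)
  next
    assume "Poly_Mapping.lookup a i = 0" "Poly_Mapping.lookup b i \<noteq> 0"
    then show ?thesis
      using shift[of b a] by (simp add: mult_single pderiv4_single lookup_add algebra_simps)
  qed (simp add: mult_single pderiv4_single lookup_add)
  have "pderiv4 i (Poly_Mapping.single a c * q) =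
      pderiv4 i (Poly_Mapping.single a c) * q + Poly_Mapping.single a c * pderiv4 i q" for a c
    by (induction q rule: poly4_induct) (simp_all add: single distrib_left pderiv4_add algebra_simps)
  then show ?thesis
    by (induction p rule: poly4_induct) (simp_all add: distrib_right pderiv4_add algebra_simps)
qed

lemma pderiv4_commute: "pderiv4 i (pderiv4 j p) = pderiv4 j (pderiv4 i p)"
  by (rule poly_mapping_eqI)
     (auto simp: lookup_pderiv4 lookup_add lookup_single when_def add_ac mult_ac)

text \<open>Written as a commutator of adjoint operators, which is the form that
  \<open>lie_jacobi\<close> consumes.\<close>

lemma poisson_jacobi:
  "poisson (poisson f g) h = poisson f (poisson g h) - poisson g (poisson f h)"
  unfolding poisson_def
  by (simp add: pderiv4_add pderiv4_diff pderiv4_mult pderiv4_commute[of 2 1] pderiv4_commute[of 3 1]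
      pderiv4_commute[of 3 2] pderiv4_commute[of 4 1] pderiv4_commute[of 4 2] pderiv4_commute[of 4 3]
      algebra_simps)

text \<open>The bivector has constant coefficients, so partial derivatives are derivations of the
  bracket.\<close>

lemma pderiv4_poisson: "pderiv4 i (poisson f g) = poisson (pderiv4 i f) g + poisson f (pderiv4 i g)"
  unfolding poisson_def
  by (simp add: pderiv4_add pderiv4_diff pderiv4_mult pderiv4_commute[of i] algebra_simps)

lemma poisson_const4_right: "poisson f (const4 c * g) = const4 c * poisson f g"
  and poisson_const4_left: "poisson (const4 c * f) g = const4 c * poisson f g"
  unfolding poisson_def by (simp_all only: pderiv4_const4_mult distrib_left right_diff_distrib mult.assoc mult.left_commute)

lemma poisson_add_right: "poisson f (g + h) = poisson f g + poisson f h"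
  and poisson_add_left: "poisson (f + g) h = poisson f h + poisson g h"
  unfolding poisson_def by (simp_all add: pderiv4_add algebra_simps)

lemma bracket_add_right: "bracket f (g + h) = bracket f g + bracket f h"
  by transfer (rule poisson_add_right)

lemma bracket_scaleR_right: "bracket f (c *\<^sub>R g) = c *\<^sub>R bracket f g"
  by transfer (rule poisson_const4_right)

lemma linear_bracket: "linear (bracket f)"
  by (intro linearI bracket_add_right bracket_scaleR_right)

lemma linear_bracket_left: "linear (\<lambda>f. bracket f g)"
  by (rule linearI; transfer) (rule poisson_add_left poisson_const4_left)+

lemma bracket_jacobi: "bracket (bracket f g) h = bracket f (bracket g h) - bracket g (bracket f h)"
  by transfer (rule poisson_jacobi)

section \<open>Monomials\<close>

text \<open>Tuples of numbers make monomials comparable by evaluation; \<open>expo_map\<close> is a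
  bijection onto \<open>mono4\<close>.\<close>

type_synonym expo = "nat \<times> nat \<times> nat \<times> nat"

fun expo_map :: "expo \<Rightarrow> mono4" where
  "expo_map (a, b, c, d) = Poly_Mapping.single 1 a + Poly_Mapping.single 2 b
     + Poly_Mapping.single 3 c + Poly_Mapping.single 4 d"

fun deg :: "expo \<Rightarrow> nat" where
  "deg (a, b, c, d) = a + b + c + d"

lemma lookup_expo_map:
  "Poly_Mapping.lookup (expo_map (a, b, c, d)) 1 = a"
  "Poly_Mapping.lookup (expo_map (a, b, c, d)) 2 = b"
  "Poly_Mapping.lookup (expo_map (a, b, c, d)) 3 = c"
  "Poly_Mapping.lookup (expo_map (a, b, c, d)) 4 = d"
  by (simp_all add: lookup_add lookup_single when_def)

lemma mono4_eqI:
  assumes "Poly_Mapping.lookup a 1 = Poly_Mapping.lookup b 1"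
    "Poly_Mapping.lookup a 2 = Poly_Mapping.lookup b 2"
    "Poly_Mapping.lookup a 3 = Poly_Mapping.lookup b 3"
    "Poly_Mapping.lookup a 4 = Poly_Mapping.lookup b 4"
  shows "a = (b :: mono4)"
proof (rule poly_mapping_eqI)
  fix i :: 4
  show "Poly_Mapping.lookup a i = Poly_Mapping.lookup b i"
    using exhaust_4[of i] assms by auto
qed

lemma inj_expo_map: "expo_map p = expo_map q \<longleftrightarrow> p = q"
proof
  assume "expo_map p = expo_map q"
  then have "Poly_Mapping.lookup (expo_map p) i = Poly_Mapping.lookup (expo_map q) i" for i
    by simp
  from this[of 1] this[of 2] this[of 3] this[of 4] show "p = q"
    by (cases p; cases q) (simp only: lookup_expo_map)
qed simp

lemma expo_map_surj: "\<exists>p. a = expo_map p"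
  by (rule exI[of _ "(Poly_Mapping.lookup a 1, Poly_Mapping.lookup a 2,
        Poly_Mapping.lookup a 3, Poly_Mapping.lookup a 4)"])
     (rule mono4_eqI, simp_all only: lookup_expo_map)

lemma mono_degree_expo_map: "mono_degree (expo_map p) = deg p"
  by (cases p) (simp add: mono_degree_add mono_degree_single)

text \<open>Below degree 2 there is no such element of \<open>ham\<close>. The default 0 keeps
  \<open>mon\<close> total, and a multilinear form vanishes on tuples that contain it.\<close>

definition mon :: "expo \<Rightarrow> ham" where
  "mon p = (if 2 \<le> deg p then Ham (Poly_Mapping.single (expo_map p) 1) else 0)"

lemma poly_of_mon: "2 \<le> deg p \<Longrightarrow> poly_of (mon p) = Poly_Mapping.single (expo_map p) 1"
  by (simp add: mon_def Ham_inverse mono_degree_expo_map)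

lemma mon_eq_0: "deg p < 2 \<Longrightarrow> mon p = 0"
  by (simp add: mon_def)

lemma homogeneous_mon: "homogeneous (deg p) (poly_of (mon p))"
  by (cases "2 \<le> deg p")
     (auto simp: poly_of_mon homogeneous_def mono_degree_expo_map mon_eq_0 zero_ham.rep_eq)

definition coef :: "expo \<Rightarrow> ham \<Rightarrow> real" where
  "coef p f = Poly_Mapping.lookup (poly_of f) (expo_map p)"

lemma linear_coef: "linear (coef p)"
  by (rule linearI)
     (simp_all add: coef_def plus_ham.rep_eq scaleR_ham.rep_eq lookup_add lookup_const4_mult)

lemma coef_low: "deg p < 2 \<Longrightarrow> coef p f = 0"
  using poly_of[of f] by (force simp: coef_def in_keys_iff mono_degree_expo_map)

lemma coef_mon: "coef p (mon q) = (if p = q \<and> 2 \<le> deg q then 1 else 0)"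
  by (cases "2 \<le> deg q")
     (auto simp: coef_def poly_of_mon lookup_single when_def inj_expo_map mon_eq_0 zero_ham.rep_eq)

lemma coef_sum: "coef p (\<Sum>i\<in>I. g i) = (\<Sum>i\<in>I. coef p (g i))"
  by (rule linear_sum[OF linear_coef])

lemma coef_scaleR: "coef p (c *\<^sub>R f) = c * coef p f"
  using linear_cmul[OF linear_coef, of p c f] by simp

lemma ham_eqI:
  assumes "\<And>p. coef p f = coef p g"
  shows "f = g"
proof -
  have "poly_of f = poly_of g"
    using assms expo_map_surj by (intro poly_mapping_eqI) (metis coef_def)
  then show ?thesis by (simp add: poly_of_inject)
qed

lemma finite_coef: "finite {p. coef p f \<noteq> 0}"
proof -
  have "inj_on expo_map {p. coef p f \<noteq> 0}"
    by (simp add: inj_on_def inj_expo_map)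
  moreover have "finite (expo_map ` {p. coef p f \<noteq> 0})"
    by (rule finite_subset[of _ "Poly_Mapping.keys (poly_of f)"]) (auto simp: coef_def in_keys_iff)
  ultimately show ?thesis using finite_imageD by blast
qed

lemma ham_expand:
  assumes "finite M" "{p. coef p f \<noteq> 0} \<subseteq> M"
  shows "f = (\<Sum>p\<in>M. coef p f *\<^sub>R mon p)"
proof (rule ham_eqI)
  fix q
  have "coef q (\<Sum>p\<in>M. coef p f *\<^sub>R mon p) = (\<Sum>p\<in>M. if p = q then coef q f else 0)"
    unfolding coef_sum by (intro sum.cong refl) (auto simp: coef_scaleR coef_mon coef_low)
  also have "\<dots> = coef q f"
    using assms by auto
  finally show "coef q f = coef q (\<Sum>p\<in>M. coef p f *\<^sub>R mon p)" ..
qed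

lemma linear_expand:
  assumes "linear z" "finite M" "{p. coef p f \<noteq> 0} \<subseteq> M"
  shows "z f = (\<Sum>p\<in>M. coef p f *\<^sub>R z (mon p))"
proof -
  have "z f = z (\<Sum>p\<in>M. coef p f *\<^sub>R mon p)"
    using ham_expand[OF assms(2,3)] by simp
  then show ?thesis
    by (simp add: linear_sum[OF assms(1)] linear_cmul[OF assms(1)])
qed

text \<open>A power of a variable that would become negative comes with the coefficient 0, hence the
  filter.\<close>

fun br :: "expo \<Rightarrow> expo \<Rightarrow> (int \<times> expo) list" where
  "br (a, b, c, d) (a', b', c', d') = filter (\<lambda>(k, _). k \<noteq> 0)
     [(int a * int d' - int d * int a', (a + a' - 1, b + b', c + c', d + d' - 1)),
      (int b * int c' - int c * int b', (a + a', b + b' - 1, c + c' - 1, d + d'))]"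

lemma deg_br: "(k, r) \<in> set (br p q) \<Longrightarrow> deg r + 2 = deg p + deg q"
proof (cases p; cases q)
  fix a b c d a' b' c' d'
  assume kr: "(k, r) \<in> set (br p q)" and pq: "p = (a, b, c, d)" "q = (a', b', c', d')"
  \<comment> \<open>The truncated \<open>- 1\<close> in \<open>br\<close> is harmless: if an
    exponent sum is 0, both products in the coefficient are 0 and the filter has removed the
    term.\<close>
  have "int a * int d' - int d * int a' = 0" if "a + a' = 0 \<or> d + d' = 0"
    using that by auto
  moreover have "int b * int c' - int c * int b' = 0" if "b + b' = 0 \<or> c + c' = 0"
    using that by auto
  ultimately show ?thesis
    using kr unfolding pq by (cases "a + a' = 0"; cases "d + d' = 0"; cases "b + b' = 0"; cases "c + c' = 0")
      (auto split: if_splits)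
qed

lemma sum_list_filter_0:
  fixes z :: "'a \<Rightarrow> 'b::real_vector"
  shows "(\<Sum>(k, r)\<leftarrow>filter (\<lambda>(k, _). k \<noteq> 0) xs. real_of_int k *\<^sub>R z r) = (\<Sum>(k, r)\<leftarrow>xs. real_of_int k *\<^sub>R z r)"
  by (induction xs) auto

lemma single_pderiv4_mult:
  "pderiv4 i (Poly_Mapping.single (expo_map p) 1) * pderiv4 j (Poly_Mapping.single (expo_map q) 1) =
   Poly_Mapping.single ((expo_map p - Poly_Mapping.single i 1) + (expo_map q - Poly_Mapping.single j 1))
     (real (Poly_Mapping.lookup (expo_map p) i) * real (Poly_Mapping.lookup (expo_map q) j))"
  by (simp add: pderiv4_single mult_single)

lemma poisson_single:
  "poisson (Poly_Mapping.single (expo_map (a, b, c, d)) 1) (Poly_Mapping.single (expo_map (a', b', c', d')) 1) =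
    Poly_Mapping.single (expo_map (a + a' - 1, b + b', c + c', d + d' - 1)) (real a * real d' - real d * real a')
    + Poly_Mapping.single (expo_map (a + a', b + b' - 1, c + c' - 1, d + d')) (real b * real c' - real c * real b')"
proof -
  \<comment> \<open>Exponents have to agree only under a nonzero coefficient, which absorbs the
    truncated subtractions.\<close>
  have single_cong: "Poly_Mapping.single x e = Poly_Mapping.single y e"
    if "e \<noteq> 0 \<Longrightarrow> x = y" for x y :: mono4 and e :: real
    using that by (cases "e = 0") auto
  have e1: "Poly_Mapping.single ((expo_map (a, b, c, d) - Poly_Mapping.single 1 1) + (expo_map (a', b', c', d') - Poly_Mapping.single 4 1))
       (real a * real d') = Poly_Mapping.single (expo_map (a + a' - 1, b + b', c + c', d + d' - 1)) (real a * real d')"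
    by (rule single_cong) (auto intro!: mono4_eqI simp: lookup_add lookup_minus lookup_single when_def)
  have e4: "Poly_Mapping.single ((expo_map (a, b, c, d) - Poly_Mapping.single 4 1) + (expo_map (a', b', c', d') - Poly_Mapping.single 1 1))
       (real d * real a') = Poly_Mapping.single (expo_map (a + a' - 1, b + b', c + c', d + d' - 1)) (real d * real a')"
    by (rule single_cong) (auto intro!: mono4_eqI simp: lookup_add lookup_minus lookup_single when_def)
  have e2: "Poly_Mapping.single ((expo_map (a, b, c, d) - Poly_Mapping.single 2 1) + (expo_map (a', b', c', d') - Poly_Mapping.single 3 1))
       (real b * real c') = Poly_Mapping.single (expo_map (a + a', b + b' - 1, c + c' - 1, d + d')) (real b * real c')"
    by (rule single_cong) (auto intro!: mono4_eqI simp: lookup_add lookup_minus lookup_single when_def)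
  have e3: "Poly_Mapping.single ((expo_map (a, b, c, d) - Poly_Mapping.single 3 1) + (expo_map (a', b', c', d') - Poly_Mapping.single 2 1))
       (real c * real b') = Poly_Mapping.single (expo_map (a + a', b + b' - 1, c + c' - 1, d + d')) (real c * real b')"
    by (rule single_cong) (auto intro!: mono4_eqI simp: lookup_add lookup_minus lookup_single when_def)
  show ?thesis
    unfolding poisson_def single_pderiv4_mult lookup_expo_map e1 e2 e3 e4 single_diff
    by simp
qed

lemma bracket_mon:
  assumes "2 \<le> deg p" "2 \<le> deg q"
  shows "bracket (mon p) (mon q) = (\<Sum>(k, r)\<leftarrow>br p q. real_of_int k *\<^sub>R mon r)"
proof (rule ham_eqI)
  fix s
  obtain a b c d a' b' c' d' where pq: "p = (a, b, c, d)" "q = (a', b', c', d')"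
    by (metis prod_cases4)
  have d: "2 \<le> deg r" if "(k, r) \<in> set (br p q)" for k r
    using deg_br[OF that] assms by simp
  have "coef s (\<Sum>(k, r)\<leftarrow>xs. real_of_int k *\<^sub>R mon r) =
      (\<Sum>(k, r)\<leftarrow>xs. real_of_int k * (if s = r \<and> 2 \<le> deg r then 1 else 0))" for xs
    by (induction xs) (auto simp: linear_add[OF linear_coef] coef_scaleR coef_mon linear_0[OF linear_coef])
  also have "(\<Sum>(k, r)\<leftarrow>br p q. real_of_int k * (if s = r \<and> 2 \<le> deg r then 1 else 0)) =
      (\<Sum>(k, r)\<leftarrow>br p q. real_of_int k *\<^sub>R (if s = r then 1 else 0))"
    by (intro arg_cong[of _ _ sum_list] map_cong refl) (use d in auto)
  finally have "coef s (\<Sum>(k, r)\<leftarrow>br p q. real_of_int k *\<^sub>R mon r) =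
      (\<Sum>(k, r)\<leftarrow>br p q. real_of_int k *\<^sub>R (if s = r then 1 else 0))" .
  moreover have "coef s (bracket (mon p) (mon q)) = (\<Sum>(k, r)\<leftarrow>br p q. real_of_int k *\<^sub>R (if s = r then 1 else 0))"
    unfolding coef_def bracket.rep_eq poly_of_mon[OF assms(1)] poly_of_mon[OF assms(2)]
    unfolding pq poisson_single br.simps sum_list_filter_0
    by (auto simp: lookup_add lookup_single when_def inj_expo_map simp del: expo_map.simps)
  ultimately show "coef s (bracket (mon p) (mon q)) = coef s (\<Sum>(k, r)\<leftarrow>br p q. real_of_int k *\<^sub>R mon r)"
    by simp
qed

section \<open>Cochains as alternating multilinear forms\<close>

lemma sum_form_apply: "(\<Sum>i\<in>I. (g i :: form)) fs = (\<Sum>i\<in>I. g i fs)"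
  by (induction I rule: infinite_finite_induct) simp_all

lemma contract_Cons: "s (f # fs) = contract f s fs"
  by (simp add: contract_def)

lemma contract_sum: "contract f (\<Sum>i\<in>I. g i) = (\<Sum>i\<in>I. contract f (g i))"
  by (rule ext) (simp add: contract_def sum_form_apply)

definition multilinear :: "form \<Rightarrow> bool" where
  "multilinear s \<longleftrightarrow> (\<forall>xs ys. linear (\<lambda>f. s (xs @ f # ys)))"

lemma multilinearD: "multilinear s \<Longrightarrow> linear (\<lambda>f. s (xs @ f # ys))"
  by (simp add: multilinear_def)

lemma multilinear_contract: "multilinear s \<Longrightarrow> multilinear (contract f s)"
  unfolding multilinear_def contract_def append_Cons[symmetric] by blast

lemma contract_add_left: "multilinear s \<Longrightarrow> contract (f + g) s = contract f s + contract g s"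
  and contract_scaleR_left: "multilinear s \<Longrightarrow> contract (c *\<^sub>R f) s = c *\<^sub>R contract f s"
  using linear_add[OF multilinearD[of s "[]"]] linear_cmul[OF multilinearD[of s "[]"]]
  by (simp_all add: contract_def fun_eq_iff scaleR_fun_apply)

lemma contract_0_left: "multilinear s \<Longrightarrow> contract 0 s = 0"
  using contract_scaleR_left[of s 0 0] by simp

lemma contract_diff_left: "multilinear s \<Longrightarrow> contract (f - g) s = contract f s - contract g s"
  using linear_diff[OF multilinearD[of s "[]"]] by (simp add: contract_def fun_eq_iff)

lemma multilinear_zero: "multilinear 0"
  by (simp add: multilinear_def linear_zero)

lemma multilinear_add: "multilinear s \<Longrightarrow> multilinear t \<Longrightarrow> multilinear (s + t)"
  by (simp add: multilinear_def linear_compose_add)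

lemma multilinear_scaleR: "multilinear s \<Longrightarrow> multilinear (c *\<^sub>R s)"
  by (simp add: multilinear_def scaleR_fun_apply linear_compose_scale_right
      del: real_scaleR_def)

lemma multilinear_parity: "multilinear s \<Longrightarrow> multilinear (parity s)"
  using linear_compose_scale_right[of "\<lambda>f. s (xs @ f # ys)" "(-1) ^ Suc (length xs + length ys)" for xs ys]
  by (simp add: multilinear_def parity_def)

lemma multilinear_wedge:
  assumes "multilinear s" "multilinear t"
  shows "multilinear (wedge s t)"
proof -
  have "linear (\<lambda>f. wedge s t (xs @ f # ys))" for xs ys
    using assms
  proof (induction xs arbitrary: s t)
    case Nil
    then show ?case
      by (intro linearI) (simp_all add: contract_add_left contract_scaleR_left wedge_add_left
          wedge_add_right wedge_scaleR_left wedge_scaleR_right scaleR_fun_apply algebra_simps)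
  next
    case (Cons x xs)
    show ?case
      unfolding append_Cons wedge.simps
      by (intro linear_compose_add Cons.IH multilinear_contract multilinear_parity Cons.prems)
  qed
  then show ?thesis by (simp add: multilinear_def)
qed

lemma multilinear_unit_form: "multilinear unit_form"
  by (simp add: multilinear_def unit_form_def linear_zero)

lemma multilinear_one_form:
  assumes "linear z"
  shows "multilinear (one_form z)"
proof -
  have "linear (\<lambda>f. one_form z (xs @ f # ys))" for xs ys
    by (cases xs; cases ys; cases "tl xs") (simp_all add: one_form_def assms linear_zero)
  then show ?thesis by (simp add: multilinear_def)
qed

lemma form_eq_0I:
  assumes "multilinear s" "\<And>T. s (map mon T) = 0"
  shows "s = 0"
proof
  fix fs show "s fs = 0 fs"
    using assms
  proof (induction fs arbitrary: s)
    case Nil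
    then show ?case using Nil(2)[of "[]"] by simp
  next
    case (Cons f fs)
    have "s (mon p # fs) = 0" for p
      using Cons.IH[of "contract (mon p) s"] Cons.prems(2)[of "p # _"] multilinear_contract[OF Cons.prems(1)]
      by (simp add: contract_def)
    moreover have "s (f # fs) = (\<Sum>p\<in>{p. coef p f \<noteq> 0}. coef p f *\<^sub>R s (mon p # fs))"
      using linear_expand[OF multilinearD[OF Cons.prems(1), of "[]" fs] finite_coef order_refl, of f] by simp
    ultimately show ?case by simp
  qed
qed

section \<open>Length and weight of forms\<close>

definition of_length :: "nat \<Rightarrow> form \<Rightarrow> bool" where
  "of_length m s \<longleftrightarrow> (\<forall>fs. length fs \<noteq> m \<longrightarrow> s fs = 0)"

text \<open>The weight is an integer because contractions subtract from it without a lower bound; a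
  form of negative weight vanishes on all monomial tuples.\<close>

definition weighted :: "int \<Rightarrow> form \<Rightarrow> bool" where
  "weighted w s \<longleftrightarrow> (\<forall>T. (\<forall>p\<in>set T. 2 \<le> deg p) \<longrightarrow> (\<Sum>p\<leftarrow>T. int (deg p) - 2) \<noteq> w \<longrightarrow> s (map mon T) = 0)"

lemma weightedD: "weighted w s \<Longrightarrow> \<forall>p\<in>set T. 2 \<le> deg p \<Longrightarrow> (\<Sum>p\<leftarrow>T. int (deg p) - 2) \<noteq> w \<Longrightarrow> s (map mon T) = 0"
  by (simp add: weighted_def)

lemma of_length_contract: "of_length (Suc m) s \<Longrightarrow> of_length m (contract f s)"
  by (simp add: of_length_def contract_def)

lemma weighted_contract:
  assumes "weighted w s" "2 \<le> deg p"
  shows "weighted (w - (int (deg p) - 2)) (contract (mon p) s)"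
  unfolding weighted_def
proof (intro allI impI)
  fix T assume T: "\<forall>p\<in>set T. 2 \<le> deg p" "(\<Sum>p\<leftarrow>T. int (deg p) - 2) \<noteq> w - (int (deg p) - 2)"
  then show "contract (mon p) s (map mon T) = 0"
    using weightedD[OF assms(1), of "p # T"] assms(2) by (simp add: contract_def)
qed

lemma weighted_parity: "weighted w s \<Longrightarrow> weighted w (parity s)"
  by (simp add: weighted_def parity_def)

lemma weighted_add: "weighted w s \<Longrightarrow> weighted w t \<Longrightarrow> weighted w (s + t)"
  by (simp add: weighted_def)

lemma weighted_scaleR: "weighted w s \<Longrightarrow> weighted w (c *\<^sub>R s)"
  by (simp add: weighted_def scaleR_fun_apply)

lemma weighted_wedge:
  assumes "weighted v s" "weighted w t"
  shows "weighted (v + w) (wedge s t)"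
proof -
  have "wedge s t (map mon T) = 0"
    if "\<forall>p\<in>set T. 2 \<le> deg p" "(\<Sum>p\<leftarrow>T. int (deg p) - 2) \<noteq> v + w" for T
    using assms that
  proof (induction T arbitrary: s t v w)
    case Nil
    then have "v \<noteq> 0 \<or> w \<noteq> 0" by auto
    then show ?case
      using weightedD[OF Nil(1), of "[]"] weightedD[OF Nil(2), of "[]"] by auto
  next
    case (Cons p T)
    have p: "2 \<le> deg p" using Cons.prems by simp
    have "wedge (contract (mon p) s) t (map mon T) = 0"
      by (rule Cons.IH[OF weighted_contract[OF Cons.prems(1) p] Cons.prems(2)]) (use Cons.prems in auto)
    moreover have "wedge (parity s) (contract (mon p) t) (map mon T) = 0"
      by (rule Cons.IH[OF weighted_parity[OF Cons.prems(1)] weighted_contract[OF Cons.prems(2) p]])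
         (use Cons.prems in auto)
    ultimately show ?case by simp
  qed
  then show ?thesis by (simp add: weighted_def)
qed

lemma weighted_one_form:
  assumes "z \<in> hom_dual l"
  shows "weighted (int l - 2) (one_form z)"
  unfolding weighted_def
proof (intro allI impI)
  fix T assume T: "\<forall>p\<in>set T. 2 \<le> deg p" "(\<Sum>p\<leftarrow>T. int (deg p) - 2) \<noteq> int l - 2"
  show "one_form z (map mon T) = 0"
  proof (cases "\<exists>p. T = [p]")
    case True
    then obtain p where p: "T = [p]" by blast
    then have "deg p \<noteq> l" using T by auto
    then have "z (mon p) = 0"
      using assms homogeneous_mon[of p] unfolding hom_dual_def by blast
    then show ?thesis by (simp add: p one_form_def)
  next
    case False
    then show ?thesis by (auto simp: one_form_def split: list.splits)
  qed
qed

lemma weighted_unit_form: "weighted 0 unit_form"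
proof -
  have "(\<Sum>p\<leftarrow>T. int (deg p) - 2) \<noteq> 0 \<Longrightarrow> T \<noteq> []" for T by auto
  then show ?thesis by (auto simp: weighted_def unit_form_def)
qed

definition cochain_form :: "nat \<Rightarrow> int \<Rightarrow> form \<Rightarrow> bool" where
  "cochain_form m w s \<longleftrightarrow> alternating s \<and> multilinear s \<and> of_length m s \<and> weighted w s"

lemma wedge_list_Cons: "wedge_list (z # zs) = wedge (one_form z) (wedge_list zs)"
  by (simp add: wedge_list_def)

lemma cochain_form_wedge_list:
  assumes "list_all2 (\<lambda>l z. z \<in> hom_dual l) ls zs"
  shows "cochain_form (length ls) (\<Sum>l\<leftarrow>ls. int l - 2) (wedge_list zs)"
proof -
  have "multilinear (wedge_list zs) \<and> weighted (\<Sum>l\<leftarrow>ls. int l - 2) (wedge_list zs)"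
    using assms
  proof (induction rule: list_all2_induct)
    case Nil
    show ?case
      by (simp add: wedge_list_def multilinear_unit_form weighted_unit_form)
  next
    case (Cons l ls z zs)
    have "linear z" using Cons(1) by (simp add: hom_dual_def)
    then show ?case
      unfolding wedge_list_Cons using Cons
      by (auto intro: multilinear_wedge multilinear_one_form weighted_wedge weighted_one_form)
  qed
  moreover have "of_length (length ls) (wedge_list zs)"
    using list_all2_lengthD[OF assms] by (simp add: of_length_def wedge_list_support)
  ultimately show ?thesis
    by (simp add: cochain_form_def alternating_wedge_list)
qed

lemma subspace_cochain_form: "subspace {s. cochain_form m w s}"
  unfolding subspace_def cochain_form_def
  by (auto simp: of_length_def alternating_zero multilinear_zero scaleR_fun_apply
      alternating_add alternating_scaleR multilinear_add multilinear_scaleR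
      weighted_add weighted_scaleR) (simp add: weighted_def)

section \<open>Reordering exterior products of 1-forms\<close>

lemma contract_one_form: "contract f (one_form z) = z f *\<^sub>R unit_form"
  by (auto simp: contract_def one_form_def unit_form_def fun_eq_iff scaleR_fun_def split: list.splits)

lemma wedge_unit_form: "wedge unit_form t = t"
proof
  fix gs show "wedge unit_form t gs = t gs"
  proof (induction gs arbitrary: t)
    case (Cons g gs)
    have "contract g unit_form = 0 *\<^sub>R unit_form" "parity unit_form = unit_form"
      by (auto simp: contract_def parity_def unit_form_def fun_eq_iff scaleR_fun_def)
    then show ?case
      by (simp only: wedge.simps wedge_scaleR_left Cons.IH) (simp add: contract_def scaleR_fun_def)
  qed (simp add: unit_form_def)
qed

lemma parity_one_form: "parity (one_form z) = - one_form z"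
  by (auto simp: parity_def one_form_def fun_eq_iff split: list.splits)

lemma contract_wedge_one_form:
  "contract f (wedge (one_form z) t) = z f *\<^sub>R t - wedge (one_form z) (contract f t)"
  by (simp add: contract_wedge contract_one_form wedge_scaleR_left wedge_unit_form parity_one_form
      wedge_minus_left)

lemma wedge_zero_right: "wedge s 0 = 0"
  using wedge_scaleR_right[of s 0 0] by simp

text \<open>Contraction with \<open>f\<close> gives two terms that are exchanged with opposite signs
  when \<open>z\<close> and \<open>z'\<close> are swapped, plus the same claim for
  \<open>contract f t\<close>. Thus induction on the arguments suffices, without associativity of
  \<open>wedge\<close>.\<close>

lemma wedge_one_form_swap:
  "wedge (one_form z) (wedge (one_form z') t) = - wedge (one_form z') (wedge (one_form z) t)"
proof
  fix fs
  show "wedge (one_form z) (wedge (one_form z') t) fs = (- wedge (one_form z') (wedge (one_form z) t)) fs"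
  proof (induction fs arbitrary: t)
    case Nil
    show ?case by (simp add: one_form_def)
  next
    case (Cons f fs)
    have "contract f (wedge (one_form z) (wedge (one_form z') t)) = z f *\<^sub>R wedge (one_form z') t
        - z' f *\<^sub>R wedge (one_form z) t + wedge (one_form z) (wedge (one_form z') (contract f t))" for z z'
      unfolding contract_wedge_one_form wedge_diff_right wedge_scaleR_right by simp
    then have "wedge (one_form z) (wedge (one_form z') t) (f # fs) = z f * wedge (one_form z') t fs
        - z' f * wedge (one_form z) t fs + wedge (one_form z) (wedge (one_form z') (contract f t)) fs" for z z'
      by (simp only: contract_Cons minus_apply plus_fun_apply scaleR_fun_apply real_scaleR_def)
    then show ?case
      by (simp add: Cons.IH del: wedge.simps)
  qed
qed

lemma wedge_minus_cases: "t = u \<or> t = - u \<Longrightarrow> wedge s t = wedge s u \<or> wedge s t = - wedge s u"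
  by (auto simp: wedge_minus_right)

lemma wedge_list_move:
  "wedge_list (us @ z # vs) = wedge_list (z # us @ vs) \<or> wedge_list (us @ z # vs) = - wedge_list (z # us @ vs)"
proof (induction us)
  case (Cons u us)
  then show ?case
    using wedge_minus_cases[OF Cons, of "one_form u"] wedge_one_form_swap[of u z]
    by (auto simp: wedge_list_Cons)
qed simp

lemma wedge_list_perm:
  "mset xs = mset ys \<Longrightarrow> wedge_list xs = wedge_list ys \<or> wedge_list xs = - wedge_list ys"
proof (induction xs arbitrary: ys)
  case (Cons x xs)
  then have "x \<in> set ys" by (metis list.set_intros(1) mset_eq_setD)
  then obtain us vs where ys: "ys = us @ x # vs" by (meson split_list)
  then have "mset xs = mset (us @ vs)" using Cons.prems by simp
  from wedge_minus_cases[OF Cons.IH[OF this], of "one_form x"] wedge_list_move[of us x vs]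
  show ?case unfolding ys wedge_list_Cons by auto
qed simp

text \<open>Unlike in \<open>ext_power\<close>, the degrees need not be sorted, so that a factor can
  be prepended in an induction.\<close>

definition typed_lists :: "nat \<Rightarrow> nat \<Rightarrow> (ham \<Rightarrow> real) list set" where
  "typed_lists m w = {zs. \<exists>ls. list_all2 (\<lambda>l z. z \<in> hom_dual l) ls zs \<and> (\<forall>l\<in>set ls. 2 \<le> l)
      \<and> length ls = m \<and> (\<Sum>l\<leftarrow>ls. l - 2) = w}"

text \<open>Sorting the factors along with their degrees gives the shape demanded by
  \<open>ext_power\<close>; the product changes at most by a sign, which the span absorbs.\<close>

lemma wedge_list_in_cochains:
  assumes "zs \<in> typed_lists m w"
  shows "wedge_list zs \<in> cochains m w"
proof -
  obtain ls where ls: "list_all2 (\<lambda>l z. z \<in> hom_dual l) ls zs" "\<forall>l\<in>set ls. 2 \<le> l"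
    "length ls = m" "(\<Sum>l\<leftarrow>ls. l - 2) = w"
    using assms by (auto simp: typed_lists_def)
  define ps where "ps = zip ls zs"
  define qs where "qs = sort_key fst ps"
  have len: "length ls = length zs" using ls(1) by (rule list_all2_lengthD)
  have ps: "map fst ps = ls" "map snd ps = zs" "\<forall>(l, z)\<in>set ps. z \<in> hom_dual l"
    using ls(1) len by (auto simp: ps_def list_all2_iff)
  have mq: "mset qs = mset ps" by (simp add: qs_def)
  have "sorted_list_of_multiset (mset ls) = sort ls" by simp
  also have "\<dots> = map fst qs"
  proof (rule properties_for_sort)
    show "mset (map fst qs) = mset ls" using mq ps(1) by (metis mset_map)
    show "sorted (map fst qs)" by (simp add: qs_def)
  qed
  finally have srt: "sorted_list_of_multiset (mset ls) = map fst qs" .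
  have "\<forall>(l, z)\<in>set qs. z \<in> hom_dual l" using ps(3) mset_eq_setD[OF mq] by simp
  then have "list_all2 (\<lambda>l z. z \<in> hom_dual l) (map fst qs) (map snd qs)"
    by (auto simp: list_all2_map1 list_all2_map2 list_all2_same)
  then have "wedge_list (map snd qs) \<in> ext_power (mset ls)"
    unfolding ext_power_def srt by (intro span_base) blast
  moreover have "(\<Sum>l\<in>#mset ls. l - 2) = w"
    using ls(4) by (metis mset_map sum_mset_sum_list)
  ultimately have q: "wedge_list (map snd qs) \<in> cochains m w"
    unfolding cochains_def using ls(2,3) by (intro span_base UN_I[of "mset ls"]) auto
  have "mset (map snd qs) = mset zs" using mq ps(2) by (metis mset_map)
  then have "wedge_list zs = wedge_list (map snd qs) \<or> wedge_list zs = - wedge_list (map snd qs)"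
    using wedge_list_perm[of zs "map snd qs"] by simp
  then show ?thesis
    using q span_neg[of "wedge_list (map snd qs)"] unfolding cochains_def by auto
qed

lemma subspace_cochains: "subspace (cochains m w)"
  by (simp add: cochains_def)

lemma cochains_eq: "cochains m w = span (wedge_list ` typed_lists m w)"
proof
  have "ext_power D \<subseteq> span (wedge_list ` typed_lists m w)"
    if "\<forall>l\<in>#D. 2 \<le> l" "size D = m" "(\<Sum>l\<in>#D. l - 2) = w" for D
    unfolding ext_power_def
  proof (rule span_mono, clarify)
    fix zs assume zs: "list_all2 (\<lambda>l z. z \<in> hom_dual l) (sorted_list_of_multiset D) zs"
    have m: "mset (sorted_list_of_multiset D) = D" by simp
    have "(\<Sum>l\<leftarrow>sorted_list_of_multiset D. l - 2) = w"
      using that(3) by (metis m mset_map sum_mset_sum_list)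
    moreover have "length (sorted_list_of_multiset D) = m"
      using that(2) m by (metis size_mset)
    ultimately show "wedge_list zs \<in> wedge_list ` typed_lists m w"
      using zs that(1) by (auto simp: typed_lists_def intro!: imageI exI[of _ "sorted_list_of_multiset D"])
  qed
  then show "cochains m w \<subseteq> span (wedge_list ` typed_lists m w)"
    unfolding cochains_def by (intro span_minimal) auto
  show "span (wedge_list ` typed_lists m w) \<subseteq> cochains m w"
    by (rule span_minimal) (auto simp: wedge_list_in_cochains subspace_cochains)
qed

lemma cochains_imp_cochain_form:
  assumes "s \<in> cochains m w"
  shows "cochain_form m (int w) s"
proof -
  have "wedge_list ` typed_lists m w \<subseteq> {s. cochain_form m (int w) s}"
  proof clarify
    fix zs assume "zs \<in> typed_lists m w"
    then obtain ls where ls: "list_all2 (\<lambda>l z. z \<in> hom_dual l) ls zs" "\<forall>l\<in>set ls. 2 \<le> l"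
      "length ls = m" "(\<Sum>l\<leftarrow>ls. l - 2) = w"
      by (auto simp: typed_lists_def)
    have "(\<Sum>l\<leftarrow>ls. int l - 2) = int (\<Sum>l\<leftarrow>ls. l - 2)"
      using ls(2) by (induction ls) (auto simp: of_nat_diff)
    then show "cochain_form m (int w) (wedge_list zs)"
      using cochain_form_wedge_list[OF ls(1)] ls(3,4) by simp
  qed
  then have "span (wedge_list ` typed_lists m w) \<subseteq> {s. cochain_form m (int w) s}"
    by (rule span_minimal) (rule subspace_cochain_form)
  then show ?thesis using assms cochains_eq by blast
qed

text \<open>By induction, both sides have the same interior products.\<close>

lemma sum_wedge_contract:
  assumes "alternating s" "of_length m s"
    and "\<And>f. contract f s = (\<Sum>p\<in>M. coef p f *\<^sub>R contract (mon p) s)"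
  shows "(\<Sum>p\<in>M. wedge (one_form (coef p)) (contract (mon p) s)) = real m *\<^sub>R s"
  using assms
proof (induction m arbitrary: s)
  case 0
  have c: "contract f s = 0" for f
    using 0(2) by (simp add: of_length_def contract_def fun_eq_iff)
  show ?case by (simp only: c wedge_zero_right) simp
next
  case (Suc m)
  note swap = alternating_contract_swap[OF Suc.prems(1)]
  show ?case
  proof
    fix fs
    show "(\<Sum>p\<in>M. wedge (one_form (coef p)) (contract (mon p) s)) fs = (real (Suc m) *\<^sub>R s) fs"
    proof (cases fs)
      case Nil
      then show ?thesis
        using Suc.prems(2) by (simp add: sum_form_apply one_form_def of_length_def scaleR_fun_apply)
    next
      case (Cons f gs)
      have e: "contract g (contract f s) = (\<Sum>p\<in>M. coef p g *\<^sub>R contract (mon p) (contract f s))" for g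
        unfolding swap[of g f] swap[of _ f] Suc.prems(3)[of g] contract_sum contract_scaleR
        by (simp add: sum_negf)
      have IH: "(\<Sum>p\<in>M. wedge (one_form (coef p)) (contract (mon p) (contract f s))) = real m *\<^sub>R contract f s"
        by (rule Suc.IH[OF alternating_contract[OF Suc.prems(1)] of_length_contract[OF Suc.prems(2)] e])
      have "contract f (\<Sum>p\<in>M. wedge (one_form (coef p)) (contract (mon p) s)) =
          (\<Sum>p\<in>M. coef p f *\<^sub>R contract (mon p) s) + (\<Sum>p\<in>M. wedge (one_form (coef p)) (contract (mon p) (contract f s)))"
        unfolding contract_sum contract_wedge_one_form swap[of f] wedge_minus_right
        by (simp add: sum.distrib)
      also have "\<dots> = contract f (real (Suc m) *\<^sub>R s)"
        unfolding IH Suc.prems(3)[of f, symmetric] contract_scaleR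
        by (simp add: algebra_simps)
      finally show ?thesis
        unfolding Cons contract_Cons[of _ f] by simp
    qed
  qed
qed

lemma coef_hom_dual: "coef p \<in> hom_dual (deg p)"
proof -
  have "coef p f = 0" if "homogeneous k (poly_of f)" "k \<noteq> deg p" for k f
    using that by (metis coef_def homogeneous_def in_keys_iff mono_degree_expo_map)
  then show ?thesis by (simp add: hom_dual_def linear_coef)
qed

lemma wedge_one_form_cochains:
  assumes "s \<in> cochains m w" "z \<in> hom_dual l" "2 \<le> l"
  shows "wedge (one_form z) s \<in> cochains (Suc m) (w + (l - 2))"
proof -
  have sub: "subspace {s. wedge (one_form z) s \<in> cochains (Suc m) (w + (l - 2))}"
    using subspace_cochains[of "Suc m" "w + (l - 2)"]
    by (simp add: subspace_def wedge_zero_right wedge_add_right wedge_scaleR_right)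
  have "wedge_list ` typed_lists m w \<subseteq> {s. wedge (one_form z) s \<in> cochains (Suc m) (w + (l - 2))}"
  proof clarify
    fix zs assume "zs \<in> typed_lists m w"
    then obtain ls where ls: "list_all2 (\<lambda>l z. z \<in> hom_dual l) ls zs" "\<forall>l\<in>set ls. 2 \<le> l"
      "length ls = m" "(\<Sum>l\<leftarrow>ls. l - 2) = w"
      by (auto simp: typed_lists_def)
    have "z # zs \<in> typed_lists (Suc m) (w + (l - 2))"
      unfolding typed_lists_def using ls assms(2,3) by (auto intro!: exI[of _ "l # ls"])
    then show "wedge (one_form z) (wedge_list zs) \<in> cochains (Suc m) (w + (l - 2))"
      unfolding wedge_list_Cons[symmetric] by (rule wedge_list_in_cochains)
  qed
  from span_minimal[OF this sub] show ?thesis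
    using assms(1) cochains_eq by blast
qed

lemma finite_deg_le: "finite {p. deg p \<le> n}"
  by (rule finite_subset[of _ "{..n} \<times> {..n} \<times> {..n} \<times> {..n}"]) auto

text \<open>An argument of degree above \<open>w + 2\<close> exceeds the weight on its own, and the
  other arguments cannot compensate because their weights are nonnegative.\<close>

lemma weighted_contract_high:
  assumes "weighted (int w) s" "multilinear s" "w + 2 < deg p"
  shows "contract (mon p) s = 0"
proof (rule form_eq_0I)
  show "multilinear (contract (mon p) s)" using assms(2) by (rule multilinear_contract)
  fix T
  show "contract (mon p) s (map mon T) = 0"
  proof (cases "\<forall>q\<in>set T. 2 \<le> deg q")
    case True
    then have "0 \<le> (\<Sum>q\<leftarrow>T. int (deg q) - 2)"
      by (induction T) (auto simp del: deg.simps)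
    then show ?thesis
      using weightedD[OF assms(1), of "p # T"] True assms(3) by (simp add: contract_def del: deg.simps)
  next
    case False
    then obtain q where "q \<in> set T" "mon q = 0" by (auto simp: mon_eq_0)
    then obtain us vs where "T = us @ q # vs" by (meson split_list)
    then show ?thesis
      using linear_0[OF multilinearD[OF assms(2), of "mon p # map mon us" "map mon vs"]] \<open>mon q = 0\<close>
      by (simp add: contract_def)
  qed
qed

text \<open>Euler's identity \<open>sum_wedge_contract\<close> writes \<open>Suc m\<close> times the
  form as a sum of products of coordinate 1-forms with contractions, to which the induction
  hypothesis applies. The sum is finite because the weight bounds the degree of an argument.\<close>

lemma cochain_form_imp_cochains: "cochain_form m (int w) s \<Longrightarrow> s \<in> cochains m w"
proof (induction m arbitrary: w s)
  case 0
  have s: "s = s [] *\<^sub>R unit_form"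
  proof
    fix fs
    have "of_length 0 s" using 0 by (simp add: cochain_form_def)
    then show "s fs = (s [] *\<^sub>R unit_form) fs"
      by (cases fs) (simp_all add: of_length_def unit_form_def scaleR_fun_apply)
  qed
  show ?case
  proof (cases "w = 0")
    case True
    have "[] \<in> typed_lists 0 0" by (simp add: typed_lists_def)
    from wedge_list_in_cochains[OF this] have "unit_form \<in> cochains 0 0"
      by (simp add: wedge_list_def)
    then have "s [] *\<^sub>R unit_form \<in> cochains 0 0"
      by (rule subspace_scale[OF subspace_cochains])
    then show ?thesis unfolding True using s by argo
  next
    case False
    then have "s [] = 0"
      using 0 weightedD[of "int w" s "[]"] by (simp add: cochain_form_def)
    then have "s [] *\<^sub>R unit_form = 0" by simp
    with s have "s = 0" by argo
    then show ?thesis by (simp only: subspace_0[OF subspace_cochains])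
  qed
next
  case (Suc m)
  define M where "M = {p. 2 \<le> deg p \<and> deg p \<le> w + 2}"
  have s: "alternating s" "multilinear s" "of_length (Suc m) s" "weighted (int w) s"
    using Suc.prems by (simp_all add: cochain_form_def)
  have fin: "finite M"
    by (rule finite_subset[OF _ finite_deg_le[of "w + 2"]]) (auto simp: M_def)
  have expand: "contract f s = (\<Sum>p\<in>M. coef p f *\<^sub>R contract (mon p) s)" for f
  proof
    fix fs
    define N where "N = M \<union> {p. coef p f \<noteq> 0}"
    have "contract f s fs = (\<Sum>p\<in>N. coef p f *\<^sub>R s (mon p # fs))"
      unfolding contract_def
      using linear_expand[OF multilinearD[OF s(2), of "[]" fs], of N f] fin finite_coef[of f]
      by (simp add: N_def)
    \<comment> \<open>The support of \<open>f\<close> may leave \<open>M\<close>, but the additional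
      monomials have degree above \<open>w + 2\<close> and contribute nothing, so that
      \<open>M\<close> does not depend on \<open>f\<close>.\<close>
    also have "\<dots> = (\<Sum>p\<in>M. coef p f *\<^sub>R s (mon p # fs))"
    proof (rule sum.mono_neutral_right)
      show "finite N" using fin finite_coef by (simp add: N_def)
      show "\<forall>p\<in>N - M. coef p f *\<^sub>R s (mon p # fs) = 0"
      proof
        fix p assume "p \<in> N - M"
        then have "w + 2 < deg p"
          using coef_low[of p f] by (auto simp: N_def M_def not_le)
        then show "coef p f *\<^sub>R s (mon p # fs) = 0"
          using weighted_contract_high[OF s(4,2)] by (simp add: contract_Cons)
      qed
    qed (auto simp: N_def)
    finally show "contract f s fs = (\<Sum>p\<in>M. coef p f *\<^sub>R contract (mon p) s) fs"
      by (simp add: sum_form_apply scaleR_fun_apply contract_def)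
  qed
  have "wedge (one_form (coef p)) (contract (mon p) s) \<in> cochains (Suc m) w" if "p \<in> M" for p
  proof -
    have p: "2 \<le> deg p" "deg p \<le> w + 2" using that by (simp_all add: M_def)
    then have w: "int w - (int (deg p) - 2) = int (w + 2 - deg p)" by (simp add: of_nat_diff)
    have "contract (mon p) s \<in> cochains m (w + 2 - deg p)"
      using Suc.IH[of "w + 2 - deg p" "contract (mon p) s"] weighted_contract[OF s(4) p(1)]
        alternating_contract[OF s(1)] multilinear_contract[OF s(2)] of_length_contract[OF s(3)]
      unfolding w by (simp add: cochain_form_def)
    from wedge_one_form_cochains[OF this coef_hom_dual p(1)] show ?thesis
      using p by simp
  qed
  then have "(\<Sum>p\<in>M. wedge (one_form (coef p)) (contract (mon p) s)) \<in> cochains (Suc m) w"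
    by (rule subspace_sum[OF subspace_cochains])
  then have "(1 / real (Suc m)) *\<^sub>R (real (Suc m) *\<^sub>R s) \<in> cochains (Suc m) w"
    unfolding sum_wedge_contract[OF s(1,3) expand] by (rule subspace_scale[OF subspace_cochains])
  then show ?case by simp
qed

lemma cochains_iff: "s \<in> cochains m w \<longleftrightarrow> cochain_form m (int w) s"
  using cochains_imp_cochain_form cochain_form_imp_cochains by blast

section \<open>The coboundary operator preserves cochains\<close>

lemma lie_diff: "lie f (s - t) = lie f s - lie f t"
  by (simp add: lie_def fun_eq_iff sum_subtractf)

lemma lie_scaleR: "lie f (c *\<^sub>R s) = c *\<^sub>R lie f s"
  by (simp add: lie_def fun_eq_iff scaleR_fun_def sum_distrib_left)

lemma lie_minus: "lie f (- s) = - lie f s"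
  by (simp add: lie_def fun_eq_iff sum_negf)

lemma coboundary_diff: "coboundary (s - t) = coboundary s - coboundary t"
  and coboundary_minus: "coboundary (- s) = - coboundary s"
  using linear_diff[OF linear_coboundary] linear_neg[OF linear_coboundary] by auto

lemma lie_Nil: "lie f s [] = 0"
  by (simp add: lie_def)

lemma coboundary_Nil: "coboundary s [] = 0"
  by (simp add: coboundary_def)

lemma lie_Cons: "lie f s (g # fs) = lie f (contract g s) fs - contract (bracket f g) s fs"
  by (simp only: contract_Cons contract_lie minus_apply)

text \<open>Cartan's formula as a recursion on the argument list. The following properties of
  \<open>coboundary\<close> are proved by induction along it.\<close>

lemma coboundary_Cons:
  "alternating s \<Longrightarrow> coboundary s (f # fs) = lie f s fs - coboundary (contract f s) fs"
  by (simp only: contract_Cons contract_coboundary minus_apply)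

lemma linear_contract: "multilinear s \<Longrightarrow> linear (\<lambda>f. contract f s fs)"
  using multilinearD[of s "[]" fs] by (simp add: contract_def)

lemma multilinear_lie:
  assumes "multilinear s"
  shows "multilinear (lie f s)"
proof -
  have "linear (\<lambda>g. lie f s (xs @ g # ys))" for xs ys
    using assms
  proof (induction xs arbitrary: s)
    case Nil
    have "linear (\<lambda>g. lie f (contract g s) ys)"
      by (rule linearI) (simp_all add: contract_add_left[OF Nil] contract_scaleR_left[OF Nil] lie_add
          lie_scaleR scaleR_fun_apply)
    moreover have "linear (\<lambda>g. contract (bracket f g) s ys)"
      using linear_compose[OF linear_bracket linear_contract[OF Nil]] by (simp add: o_def)
    ultimately show ?case
      unfolding append_Nil lie_Cons by (rule linear_compose_sub)
  next
    case (Cons x xs)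
    show ?case
      unfolding append_Cons lie_Cons
      by (intro linear_compose_sub Cons.IH multilinear_contract Cons.prems
          multilinearD[OF multilinear_contract[OF Cons.prems]])
  qed
  then show ?thesis by (simp add: multilinear_def)
qed

lemma linear_lie: "multilinear s \<Longrightarrow> linear (\<lambda>f. lie f s fs)"
proof (induction fs arbitrary: s)
  case Nil
  then show ?case by (simp add: lie_Nil linear_zero)
next
  case (Cons g fs)
  have "linear (\<lambda>f. contract (bracket f g) s fs)"
    using linear_compose[OF linear_bracket_left linear_contract[OF Cons.prems]] by (simp add: o_def)
  then show ?case
    unfolding lie_Cons
    by (intro linear_compose_sub Cons.IH multilinear_contract Cons.prems)
qed

lemma multilinear_coboundary:
  assumes "alternating s" "multilinear s"
  shows "multilinear (coboundary s)"
proof -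
  have "linear (\<lambda>g. coboundary s (xs @ g # ys))" for xs ys
    using assms
  proof (induction xs arbitrary: s)
    case Nil
    have "linear (\<lambda>g. coboundary (contract g s) ys)"
      by (rule linearI) (simp_all add: contract_add_left[OF Nil(2)] contract_scaleR_left[OF Nil(2)]
          coboundary_add coboundary_scaleR scaleR_fun_apply)
    then show ?case
      unfolding append_Nil coboundary_Cons[OF Nil(1)]
      by (intro linear_compose_sub linear_lie Nil(2))
  next
    case (Cons x xs)
    show ?case
      unfolding append_Cons coboundary_Cons[OF Cons.prems(1)]
      by (intro linear_compose_sub Cons.IH alternating_contract multilinear_contract Cons.prems
          multilinearD[OF multilinear_lie[OF Cons.prems(2)]])
  qed
  then show ?thesis by (simp add: multilinear_def)
qed

lemma alternating_lie:
  assumes "alternating s"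
  shows "alternating (lie f s)"
  unfolding alternating_def
proof (intro allI)
  fix xs a b ys
  show "lie f s (xs @ a # b # ys) = - lie f s (xs @ b # a # ys)"
    using assms
  proof (induction xs arbitrary: s)
    case Nil
    have e: "lie f s (a # b # ys) = lie f (contract b (contract a s)) ys
        - contract (bracket f b) (contract a s) ys - contract b (contract (bracket f a) s) ys" for a b
      by (simp add: lie_Cons contract_def)
    note swap = alternating_contract_swap[OF Nil]
    show ?case
      unfolding append_Nil e swap[of b a] swap[of "bracket f b" a] swap[of b "bracket f a"] lie_minus
      by simp
  next
    case (Cons x xs)
    show ?case
      unfolding append_Cons lie_Cons Cons.IH[OF alternating_contract[OF Cons.prems]]
        alternatingD[OF alternating_contract[OF Cons.prems], of _ xs a b]
      by simp
  qed
qed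

lemma lie_jacobi:
  assumes "multilinear s"
  shows "lie (bracket f g) s = lie f (lie g s) - lie g (lie f s)"
proof
  fix fs
  show "lie (bracket f g) s fs = (lie f (lie g s) - lie g (lie f s)) fs"
    using assms
  proof (induction fs arbitrary: s)
    case Nil
    then show ?case by (simp add: lie_Nil)
  next
    case (Cons h fs)
    have "contract (bracket (bracket f g) h) s fs =
        contract (bracket f (bracket g h)) s fs - contract (bracket g (bracket f h)) s fs"
      unfolding bracket_jacobi contract_diff_left[OF Cons.prems] by simp
    then show ?case
      using Cons.IH[OF multilinear_contract[OF Cons.prems], of h]
      unfolding minus_apply lie_Cons contract_lie lie_diff by simp
  qed
qed

text \<open>Feeding a first argument \<open>g\<close> to both sides and applying Cartan's formula
  leaves the commutator of \<open>lie f\<close> and \<open>lie g\<close>, compared with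
  \<open>lie (bracket f g)\<close>, together with the same claim for
  \<open>contract g s\<close>.\<close>

lemma lie_coboundary:
  assumes "alternating s" "multilinear s"
  shows "lie f (coboundary s) = coboundary (lie f s)"
proof
  fix fs
  show "lie f (coboundary s) fs = coboundary (lie f s) fs"
    using assms
  proof (induction fs arbitrary: s)
    case Nil
    show ?case by (simp add: lie_Nil coboundary_Nil)
  next
    case (Cons g fs)
    note alt = Cons.prems(1)
    have "lie f (coboundary s) (g # fs) = lie f (lie g s) fs - lie f (coboundary (contract g s)) fs
        - lie (bracket f g) s fs + coboundary (contract (bracket f g) s) fs"
      unfolding lie_Cons contract_coboundary[OF alt] lie_diff by simp
    moreover have "coboundary (lie f s) (g # fs) = lie g (lie f s) fs
        - coboundary (lie f (contract g s)) fs + coboundary (contract (bracket f g) s) fs"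
      unfolding coboundary_Cons[OF alternating_lie[OF alt]] contract_lie coboundary_diff by simp
    moreover have "lie f (coboundary (contract g s)) fs = coboundary (lie f (contract g s)) fs"
      by (rule Cons.IH) (intro alternating_contract multilinear_contract Cons.prems)+
    ultimately show ?case
      unfolding lie_jacobi[OF Cons.prems(2)] by simp
  qed
qed

text \<open>Peeling off the first two arguments leaves an expression that is antisymmetric in them,
  since the bracket and the double contraction are. Later positions follow by induction.\<close>

lemma alternating_coboundary:
  assumes "alternating s" "multilinear s"
  shows "alternating (coboundary s)"
  unfolding alternating_def
proof (intro allI)
  fix xs a b ys
  show "coboundary s (xs @ a # b # ys) = - coboundary s (xs @ b # a # ys)"
    using assms
  proof (induction xs arbitrary: s)
    case Nil
    note alt = Nil(1)
    have e: "coboundary s (a # b # ys) = lie a (contract b s) ys - contract (bracket a b) s ys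
        - lie b (contract a s) ys + coboundary (contract b (contract a s)) ys" for a b
      unfolding coboundary_Cons[OF alt] coboundary_Cons[OF alternating_contract[OF alt]] lie_Cons by simp
    have "bracket b a = - bracket a b"
      by transfer (simp add: poisson_def algebra_simps)
    then have "contract (bracket b a) s = - contract (bracket a b) s"
      using contract_scaleR_left[OF Nil(2), of "-1" "bracket a b"] by simp
    then show ?case
      unfolding append_Nil e alternating_contract_swap[OF alt, of b a] coboundary_minus by simp
  next
    case (Cons x xs)
    show ?case
      unfolding append_Cons coboundary_Cons[OF Cons.prems(1)]
        Cons.IH[OF alternating_contract[OF Cons.prems(1)] multilinear_contract[OF Cons.prems(2)]]
        alternatingD[OF alternating_lie[OF Cons.prems(1)], of _ xs a b]
      by simp
  qed
qed

section \<open>Lie derivatives as formal combinations of monomial tuples\<close>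

fun lterms :: "expo \<Rightarrow> expo list \<Rightarrow> (int \<times> expo list) list" where
  "lterms X [] = []"
| "lterms X (p # T) = map (\<lambda>(k, q). (k, q # T)) (br X p) @ map (\<lambda>(k, U). (k, p # U)) (lterms X T)"

definition lincomb :: "form \<Rightarrow> (int \<times> expo list) list \<Rightarrow> real" where
  "lincomb s L = (\<Sum>(k, U)\<leftarrow>L. real_of_int k * s (map mon U))"

lemma lincomb_simps [simp]:
  "lincomb s [] = 0"
  "lincomb s ((k, U) # L) = real_of_int k * s (map mon U) + lincomb s L"
  "lincomb s (L @ L') = lincomb s L + lincomb s L'"
  by (simp_all add: lincomb_def)

lemma lincomb_Cons: "lincomb s (map (\<lambda>(k, U). (k, p # U)) L) = lincomb (contract (mon p) s) L"
  by (induction L) (auto simp: contract_def)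

lemma lincomb_eq_0: "\<forall>(k, U)\<in>set L. s (map mon U) = 0 \<Longrightarrow> lincomb s L = 0"
  by (induction L) auto

lemma lie_lterms:
  assumes "multilinear s" "2 \<le> deg X" "\<forall>p\<in>set T. 2 \<le> deg p"
  shows "lie (mon X) s (map mon T) = - lincomb s (lterms X T)"
  using assms(1,3)
proof (induction T arbitrary: s)
  case Nil
  show ?case by (simp add: lie_Nil)
next
  case (Cons p T)
  have lin: "linear (\<lambda>f. s (f # map mon T))"
    using multilinearD[OF Cons.prems(1), of "[]"] by simp
  have "contract (\<Sum>(k, r)\<leftarrow>xs. real_of_int k *\<^sub>R mon r) s (map mon T) =
      lincomb s (map (\<lambda>(k, q). (k, q # T)) xs)" for xs
    by (induction xs) (auto simp: linear_0[OF lin] linear_add[OF lin] linear_cmul[OF lin]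
        contract_def)
  then have "contract (bracket (mon X) (mon p)) s (map mon T) = lincomb s (map (\<lambda>(k, q). (k, q # T)) (br X p))"
    using bracket_mon[OF assms(2)] Cons.prems by simp
  then show ?case
    using Cons.IH[OF multilinear_contract[OF Cons.prems(1)]] Cons.prems(2)
    by (simp add: lie_Cons lincomb_Cons)
qed

text \<open>A bracket lowers the total degree by 2, so a quadratic \<open>X\<close> preserves the
  degree in each slot. Hence the relations \<open>lie X s T = 0\<close> never mix different degree
  patterns.\<close>

lemma lterms_deg:
  assumes "(k, U) \<in> set (lterms X T)" "2 \<le> deg X" "\<forall>p\<in>set T. 2 \<le> deg p"
  shows "(\<forall>p\<in>set U. 2 \<le> deg p) \<and> (\<Sum>p\<leftarrow>U. int (deg p) - 2) = (\<Sum>p\<leftarrow>T. int (deg p) - 2) + (int (deg X) - 2)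
     \<and> (deg X = 2 \<longrightarrow> map deg U = map deg T)"
  using assms(1,3)
proof (induction T arbitrary: U)
  case (Cons p T)
  from Cons.prems(1) consider r where "(k, r) \<in> set (br X p)" "U = r # T"
    | V where "(k, V) \<in> set (lterms X T)" "U = p # V"
    by auto
  then show ?case
  proof cases
    case 1
    then show ?thesis using deg_br[OF 1(1)] Cons.prems(2) assms(2) by auto
  next
    case 2
    then show ?thesis using Cons.IH[OF 2(1)] Cons.prems(2) by auto
  qed
qed simp

lemma weighted_lie:
  assumes "weighted w s" "multilinear s" "2 \<le> deg X"
  shows "weighted (w - (int (deg X) - 2)) (lie (mon X) s)"
  unfolding weighted_def
proof (intro allI impI)
  fix T assume T: "\<forall>p\<in>set T. 2 \<le> deg p" "(\<Sum>p\<leftarrow>T. int (deg p) - 2) \<noteq> w - (int (deg X) - 2)"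
  have "s (map mon U) = 0" if "(k, U) \<in> set (lterms X T)" for k U
    using weightedD[OF assms(1), of U] lterms_deg[OF that assms(3) T(1)] T(2) by auto
  then have "lincomb s (lterms X T) = 0"
    by (intro lincomb_eq_0) blast
  then show "lie (mon X) s (map mon T) = 0"
    using lie_lterms[OF assms(2,3) T(1)] by simp
qed

lemma weighted_coboundary:
  assumes "alternating s" "multilinear s" "weighted w s"
  shows "weighted w (coboundary s)"
proof -
  have "coboundary s (map mon T) = 0"
    if "\<forall>p\<in>set T. 2 \<le> deg p" "(\<Sum>p\<leftarrow>T. int (deg p) - 2) \<noteq> w" for T
    using assms that
  proof (induction T arbitrary: s w)
    case Nil
    show ?case by (simp add: coboundary_Nil)
  next
    case (Cons p T)
    have p: "2 \<le> deg p" using Cons.prems by simp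
    have "lie (mon p) s (map mon T) = 0"
      by (rule weightedD[OF weighted_lie[OF Cons.prems(3,2) p]]) (use Cons.prems in auto)
    moreover have "coboundary (contract (mon p) s) (map mon T) = 0"
      by (rule Cons.IH[OF alternating_contract multilinear_contract weighted_contract[OF _ p]])
         (use Cons.prems in auto)
    ultimately show ?case
      by (simp add: coboundary_Cons[OF Cons.prems(1)])
  qed
  then show ?thesis by (simp add: weighted_def)
qed

lemma of_length_coboundary:
  assumes "of_length m s"
  shows "of_length (Suc m) (coboundary s)"
  unfolding of_length_def
proof (intro allI impI)
  fix fs :: "ham list" assume l: "length fs \<noteq> Suc m"
  have "s (h # nths fs (- {i, j})) = 0" if "i < j" "j < length fs" for h i j
    using length_nths_drop2[OF that] l assms by (simp add: of_length_def)
  then show "coboundary s fs = 0"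
    unfolding coboundary_def by (intro sum.neutral ballI) simp
qed

lemma coboundary_cochains: "s \<in> cochains m w \<Longrightarrow> coboundary s \<in> cochains (Suc m) w"
  unfolding cochains_iff cochain_form_def
  by (blast intro: alternating_coboundary multilinear_coboundary weighted_coboundary of_length_coboundary)

section \<open>Relative cochains\<close>

text \<open>By \<open>range_J_hat\<close> the Hamiltonians run over all quadratic polynomials. By
  Cartan's formula, once \<open>contract X s = 0\<close>, the contraction of the coboundary is
  \<open>lie X s\<close>.\<close>

lemma relative_cochains_iff:
  "s \<in> relative_cochains m w \<longleftrightarrow> cochain_form m (int w) s \<and>
     (\<forall>X. homogeneous 2 (poly_of X) \<longrightarrow> contract X s = 0 \<and> lie X s = 0)"
proof -
  have q: "(\<forall>A\<in>sp4. P (J_hat A)) \<longleftrightarrow> (\<forall>X. homogeneous 2 (poly_of X) \<longrightarrow> P X)" for P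
  proof -
    have "(\<forall>A\<in>sp4. P (J_hat A)) \<longleftrightarrow> (\<forall>X\<in>J_hat ` sp4. P X)" by simp
    then show ?thesis unfolding range_J_hat by simp
  qed
  have "s \<in> relative_cochains m w \<longleftrightarrow> cochain_form m (int w) s \<and>
      (\<forall>X. homogeneous 2 (poly_of X) \<longrightarrow> contract X s = 0 \<and> contract X (coboundary s) = 0)"
    unfolding relative_cochains_def cochains_iff mem_Collect_eq
      q[of "\<lambda>X. contract X s = 0 \<and> contract X (coboundary s) = 0"] ..
  moreover have "contract X (coboundary s) = lie X s - coboundary (contract X s)" if "cochain_form m (int w) s" for X
    using that contract_coboundary by (simp add: cochain_form_def)
  moreover have "coboundary 0 = 0" by (rule linear_0[OF linear_coboundary])
  ultimately show ?thesis by auto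
qed

lemma coboundary_relative_cochains:
  assumes "s \<in> relative_cochains m w"
  shows "coboundary s \<in> relative_cochains (Suc m) w"
proof -
  have s: "alternating s" "multilinear s" "cochain_form m (int w) s"
    and X: "\<And>X. homogeneous 2 (poly_of X) \<Longrightarrow> contract X s = 0 \<and> lie X s = 0"
    using assms by (auto simp: relative_cochains_iff cochain_form_def)
  have "cochain_form (Suc m) (int w) (coboundary s)"
    using coboundary_cochains[of s m w] s(3) by (simp add: cochains_iff)
  moreover have "contract X (coboundary s) = 0" "lie X (coboundary s) = 0" if "homogeneous 2 (poly_of X)" for X
    using X[OF that] linear_0[OF linear_coboundary]
    by (simp_all add: contract_coboundary[OF s(1)] lie_coboundary[OF s(1,2)])
  ultimately show ?thesis by (simp add: relative_cochains_iff)
qed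

lemma subspace_relative_cochains: "subspace (relative_cochains m w)"
  unfolding relative_cochains_def subspace_def
  using subspace_cochains[of m w]
  by (auto simp: subspace_def contract_zero contract_add contract_scaleR coboundary_add
      coboundary_scaleR linear_0[OF linear_coboundary])

section \<open>Invariant forms are determined by few coordinates\<close>

lemma alternating_perm:
  "mset xs = mset ys \<Longrightarrow> alternating s \<Longrightarrow> s xs = s ys \<or> s xs = - s ys"
proof (induction xs arbitrary: ys s)
  case (Cons x xs)
  then have "x \<in> set ys" by (metis list.set_intros(1) mset_eq_setD)
  then obtain us vs where ys: "ys = us @ x # vs" by (meson split_list)
  then have "mset xs = mset (us @ vs)" using Cons.prems by simp
  from Cons.IH[OF this alternating_contract[OF Cons.prems(2)], of x]
  have "s (x # xs) = s (x # us @ vs) \<or> s (x # xs) = - s (x # us @ vs)"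
    by (simp add: contract_def)
  moreover have "(- 1 :: real) ^ length us = 1 \<or> (- 1 :: real) ^ length us = - 1"
    using neg_one_even_power neg_one_odd_power by blast
  ultimately show ?case
    using alternating_move[OF Cons.prems(2), of us x vs] unfolding ys by auto
qed simp

lemma alternating_eq_0:
  assumes "alternating s" "\<not> distinct fs"
  shows "s fs = 0"
proof -
  obtain xs ys zs a where fs: "fs = xs @ [a] @ ys @ [a] @ zs"
    using not_distinct_decomp[OF assms(2)] by blast
  have "s (a # a # xs @ ys @ zs) = 0"
    using alternatingD[OF assms(1), of "[]" a a] by simp
  moreover have "mset fs = mset (a # a # xs @ ys @ zs)" by (simp add: fs)
  ultimately show ?thesis using alternating_perm[OF _ assms(1)] by fastforce
qed

text \<open>Cartan's recursion in symbols. The first sign comes from \<open>lie_lterms\<close>, the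
  second from the subtracted coboundary in \<open>coboundary_Cons\<close>.\<close>

fun dterms :: "expo list \<Rightarrow> (int \<times> expo list) list" where
  "dterms [] = []"
| "dterms (p # T) = map (\<lambda>(k, U). (- k, U)) (lterms p T) @ map (\<lambda>(k, U). (- k, p # U)) (dterms T)"

lemma lincomb_neg: "lincomb s (map (\<lambda>(k, U). (- k, f U)) L) = - lincomb s (map (\<lambda>(k, U). (k, f U)) L)"
  by (induction L) auto

lemma coboundary_dterms:
  assumes "alternating s" "multilinear s" "\<forall>p\<in>set T. 2 \<le> deg p"
  shows "coboundary s (map mon T) = lincomb s (dterms T)"
  using assms
proof (induction T arbitrary: s)
  case Nil
  show ?case by (simp add: coboundary_Nil)
next
  case (Cons p T)
  have "coboundary (contract (mon p) s) (map mon T) = lincomb (contract (mon p) s) (dterms T)"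
    by (rule Cons.IH) (use Cons.prems in \<open>auto intro: alternating_contract multilinear_contract\<close>)
  moreover have "lie (mon p) s (map mon T) = - lincomb s (lterms p T)"
    by (rule lie_lterms) (use Cons.prems in auto)
  moreover have "lincomb s (map (\<lambda>(k, U). (k, U)) L) = lincomb s L" for L
    by (induction L) auto
  ultimately show ?case
    unfolding dterms.simps lincomb_simps lincomb_neg lincomb_Cons
    using lincomb_neg[of s "\<lambda>U. U"] by (simp add: coboundary_Cons[OF Cons.prems(1)])
qed

text \<open>In contrast to the connectives, \<open>if\<close> is evaluated lazily by the simplifier.\<close>

fun expo_eq :: "expo \<Rightarrow> expo \<Rightarrow> bool" where
  "expo_eq (a, b, c, d) (a', b', c', d') =
     (if a = a' then if b = b' then if c = c' then d = d' else False else False else False)"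

lemma expo_eq [simp]: "expo_eq p q \<longleftrightarrow> p = q"
  by (cases p; cases q) simp

fun expo_less :: "expo \<Rightarrow> expo \<Rightarrow> bool" where
  "expo_less (a, b, c, d) (a', b', c', d') =
     (if a = a' then if b = b' then if c = c' then d < d' else c < c' else b < b' else a < a')"

fun expos_eq :: "expo list \<Rightarrow> expo list \<Rightarrow> bool" where
  "expos_eq [] [] = True"
| "expos_eq (p # T) (q # U) = (if expo_eq p q then expos_eq T U else False)"
| "expos_eq _ _ = False"

lemma expos_eq [simp]: "expos_eq T U \<longleftrightarrow> T = U"
  by (induction T U rule: expos_eq.induct) auto

text \<open>The sign is 0, and the list is meaningless, if there are repetitions.\<close>

fun insort_sign :: "expo \<Rightarrow> expo list \<Rightarrow> int \<times> expo list" where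
  "insort_sign x [] = (1, [x])"
| "insort_sign x (y # ys) = (if expo_less x y then (1, x # y # ys) else if expo_eq x y then (0, [])
     else case insort_sign x ys of (e, zs) \<Rightarrow> (- e, y # zs))"

fun sort_sign :: "expo list \<Rightarrow> int \<times> expo list" where
  "sort_sign [] = (1, [])"
| "sort_sign (x # xs) = (case sort_sign xs of (e, ys) \<Rightarrow>
     case insort_sign x ys of (e', zs) \<Rightarrow> (e * e', zs))"

lemma insort_sign:
  "alternating s \<Longrightarrow> insort_sign x ys = (e, zs) \<Longrightarrow> s (mon x # map mon ys) = real_of_int e * s (map mon zs)"
proof (induction x ys arbitrary: s e zs rule: insort_sign.induct)
  case (2 x y ys)
  obtain e' zs' where i: "insort_sign x ys = (e', zs')" by fastforce
  consider "expo_less x y" | "\<not> expo_less x y" "x = y" | "\<not> expo_less x y" "x \<noteq> y" by blast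
  then show ?case
  proof cases
    case 1
    then show ?thesis using 2(3) by auto
  next
    case 2
    then have "s (mon x # map mon (y # ys)) = 0"
      by (intro alternating_eq_0[OF \<open>alternating s\<close>]) simp
    then show ?thesis using 2 \<open>insort_sign x (y # ys) = (e, zs)\<close> by auto
  next
    case 3
    then have "contract (mon y) s (mon x # map mon ys) = real_of_int e' * contract (mon y) s (map mon zs')"
      using 2(1)[OF _ _ alternating_contract[OF 2(2)] i] by simp
    moreover have "s (mon x # mon y # map mon ys) = - s (mon y # mon x # map mon ys)"
      using alternatingD[OF 2(2), of "[]" "mon x" "mon y" "map mon ys"] by simp
    moreover have "e = - e'" "zs = y # zs'" using 3 2(3) i by auto
    ultimately show ?thesis by (simp add: contract_def)
  qed
qed auto

lemma sort_sign: "alternating s \<Longrightarrow> sort_sign T = (e, U) \<Longrightarrow> s (map mon T) = real_of_int e * s (map mon U)"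
proof (induction T arbitrary: s e U)
  case (Cons x T)
  obtain e1 ys where 1: "sort_sign T = (e1, ys)" by fastforce
  obtain e2 zs where 2: "insort_sign x ys = (e2, zs)" by fastforce
  have "s (mon x # map mon T) = real_of_int e1 * s (mon x # map mon ys)"
    using Cons.IH[OF alternating_contract[OF Cons.prems(1)] 1, of "mon x"] by (simp add: contract_def)
  moreover have "e = e1 * e2" "U = zs" using Cons.prems(2) 1 2 by auto
  ultimately show ?case
    using insort_sign[OF Cons.prems(1) 2] by simp
qed simp

text \<open>Normal form modulo antisymmetry. Dropping zero coefficients ensures that the unknown
  left over in a step has a nonzero coefficient, so that the equation determines it.\<close>

definition sort_terms :: "(int \<times> expo list) list \<Rightarrow> (int \<times> expo list) list" where
  "sort_terms L = filter (\<lambda>(k, _). k \<noteq> 0) (map (\<lambda>(k, U). case sort_sign U of (e, V) \<Rightarrow> (k * e, V)) L)"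

lemma lincomb_sort_terms: "alternating s \<Longrightarrow> lincomb s (sort_terms L) = lincomb s L"
proof (induction L)
  case (Cons kU L)
  obtain k U e V where k: "kU = (k, U)" "sort_sign U = (e, V)"
    by (metis prod.exhaust)
  have "lincomb s (sort_terms (kU # L)) = real_of_int (k * e) * s (map mon V) + lincomb s (sort_terms L)"
    by (simp add: sort_terms_def k)
  then show ?case
    using Cons sort_sign[OF Cons.prems k(2)] by (simp add: k)
qed (simp add: sort_terms_def)

section \<open>Tables of coordinates as integral combinations of parameters\<close>

type_synonym vec = "int \<times> int \<times> int \<times> int"

text \<open>Four parameters are the most that any degree needs; with fewer, the vectors are padded
  with zeros.\<close>

fun dot :: "vec \<Rightarrow> (nat \<Rightarrow> real) \<Rightarrow> real" where
  "dot (a, b, c, d) y = of_int a * y 0 + of_int b * y 1 + of_int c * y 2 + of_int d * y 3"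

fun add_mult :: "int \<Rightarrow> vec \<Rightarrow> vec \<Rightarrow> vec" where
  "add_mult k (a, b, c, d) (a', b', c', d') = (k * a + a', k * b + b', k * c + c', k * d + d')"

lemma dot_add_mult: "dot (add_mult k u v) y = of_int k * dot u y + dot v y"
  by (cases u; cases v) (simp add: algebra_simps)

text \<open>A table entry \<open>(U, v)\<close> says that the coordinate \<open>s (map mon U)\<close> has the value \<open>dot v y\<close>.\<close>

type_synonym table = "(expo list \<times> vec) list"

definition sound :: "form \<Rightarrow> (nat \<Rightarrow> real) \<Rightarrow> table \<Rightarrow> bool" where
  "sound s y tbl \<longleftrightarrow> (\<forall>(U, v)\<in>set tbl. s (map mon U) = dot v y)"

text \<open>Evaluation by rewriting traverses the table whenever it occurs in a branch of a conditional or
  a case distinction; these are therefore replaced with pattern matching in the functions on tables.\<close>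

fun find_entry :: "table \<Rightarrow> expo list \<Rightarrow> vec option"
  and find_rest :: "bool \<Rightarrow> vec \<Rightarrow> table \<Rightarrow> expo list \<Rightarrow> vec option" where
  "find_entry [] U = None"
| "find_entry ((V, v) # tbl) U = find_rest (expos_eq V U) v tbl U"
| "find_rest True v tbl U = Some v"
| "find_rest False v tbl U = find_entry tbl U"

fun lookups :: "table \<Rightarrow> (int \<times> expo list) list \<Rightarrow> (int \<times> expo list \<times> vec option) list" where
  "lookups tbl [] = []"
| "lookups tbl ((k, U) # L) = (k, U, find_entry tbl U) # lookups tbl L"

fun collect :: "(int \<times> expo list \<times> vec option) list \<Rightarrow> vec \<times> (int \<times> expo list) list" where
  "collect [] = ((0, 0, 0, 0), [])"
| "collect ((k, U, None) # L) = (case collect L of (v, R) \<Rightarrow> (v, (k, U) # R))"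
| "collect ((k, U, Some u) # L) = (case collect L of (v, R) \<Rightarrow> (add_mult k u v, R))"

definition residual :: "table \<Rightarrow> (int \<times> expo list) list \<Rightarrow> vec \<times> (int \<times> expo list) list" where
  "residual tbl L = collect (lookups tbl L)"

lemma residual_simps:
  "residual tbl [] = ((0, 0, 0, 0), [])"
  "residual tbl ((k, U) # L) = (case residual tbl L of (v, R) \<Rightarrow>
     case find_entry tbl U of None \<Rightarrow> (v, (k, U) # R) | Some u \<Rightarrow> (add_mult k u v, R))"
  by (cases "find_entry tbl U"; simp add: residual_def)+

lemma soundD: "sound s y tbl \<Longrightarrow> find_entry tbl U = Some v \<Longrightarrow> s (map mon U) = dot v y"
proof (induction tbl)
  case (Cons e tbl)
  obtain V w where "e = (V, w)" by (rule prod.exhaust)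
  then show ?case using Cons by (cases "V = U") (auto simp: sound_def)
qed simp

lemma residual: "sound s y tbl \<Longrightarrow> residual tbl L = (v, R) \<Longrightarrow> lincomb s L = dot v y + lincomb s R"
proof (induction L arbitrary: v R)
  case (Cons kU L)
  obtain k U where k: "kU = (k, U)" by fastforce
  obtain v' R' where r: "residual tbl L = (v', R')" by fastforce
  show ?case
    using Cons.IH[OF Cons.prems(1) r] Cons.prems(2) soundD[OF Cons.prems(1), of U]
    by (auto simp: k r residual_simps dot_add_mult split: option.splits)
qed (auto simp: residual_simps)

text \<open>A step \<open>(X, T, v)\<close> solves the equation \<open>lie X s T = 0\<close> for its only unknown coordinate,
  which has the value \<open>v\<close>.\<close>

fun solved :: "bool \<Rightarrow> vec \<times> (int \<times> expo list) list \<Rightarrow> vec \<Rightarrow> expo list option" where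
  "solved valid (u, [(k, U)]) v = (if valid \<and> add_mult k v u = (0, 0, 0, 0) then Some U else None)"
| "solved valid _ v = None"

fun extend :: "expo list option \<Rightarrow> vec \<Rightarrow> table \<Rightarrow> table option" where
  "extend None v tbl = None"
| "extend (Some U) v tbl = Some ((U, v) # tbl)"

text \<open>The value is supplied and merely verified through \<open>add_mult k v u\<close>, so that
  the computation stays within the integers and never divides.\<close>

fun step :: "expo \<times> expo list \<times> vec \<Rightarrow> table \<Rightarrow> table option" where
  "step (X, T, v) tbl = extend (solved (deg X = 2 \<and> list_all (\<lambda>p. 2 \<le> deg p) T)
     (residual tbl (sort_terms (lterms X T))) v) v tbl"

fun steps :: "(expo \<times> expo list \<times> vec) list \<Rightarrow> table option \<Rightarrow> table option" where
  "steps [] t = t"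
| "steps (e # es) None = None"
| "steps (e # es) (Some tbl) = steps es (step e tbl)"

lemma steps_None: "steps es None = None"
  by (cases es) simp_all

lemma solved_Some:
  assumes "solved valid (u, R) v = Some U"
  obtains k where "valid" "R = [(k, U)]" "add_mult k v u = (0, 0, 0, 0)"
proof (cases R rule: list.exhaust)
  case (Cons kU R')
  then show ?thesis using assms that by (cases kU; cases R') (auto split: if_splits)
qed (use assms in simp)

lemma extend_Some: "extend o' v tbl = Some tbl' \<longleftrightarrow> (\<exists>U. o' = Some U \<and> tbl' = (U, v) # tbl)"
  by (cases o') auto

definition invariant :: "form \<Rightarrow> bool" where
  "invariant s \<longleftrightarrow> alternating s \<and> multilinear s \<and> (\<forall>X. deg X = 2 \<longrightarrow> lie (mon X) s = 0)"

lemma invariant_lterms: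
  assumes "invariant s" "deg X = 2" "\<forall>p\<in>set T. 2 \<le> deg p"
  shows "lincomb s (lterms X T) = 0"
proof -
  have "lie (mon X) s = 0" "multilinear s" using assms(1,2) unfolding invariant_def by blast+
  then show ?thesis using lie_lterms[of s X T] assms(2,3) by simp
qed

lemma residual_nonzero:
  "residual tbl L = (v, R) \<Longrightarrow> set R \<subseteq> set L"
proof (induction L arbitrary: v R)
  case (Cons kU L)
  obtain k U where k: "kU = (k, U)" by fastforce
  obtain v' R' where r: "residual tbl L = (v', R')" by fastforce
  show ?case
    using Cons.IH[OF r] Cons.prems by (auto simp: k r residual_simps split: option.splits)
qed (auto simp: residual_simps)

lemma step_sound:
  assumes "invariant s" "sound s y tbl" "step e tbl = Some tbl'"
  shows "sound s y tbl'"
proof -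
  obtain X T v where e: "e = (X, T, v)" by (metis prod_cases3)
  obtain u R where r: "residual tbl (sort_terms (lterms X T)) = (u, R)" by fastforce
  obtain U where U: "solved (deg X = 2 \<and> list_all (\<lambda>p. 2 \<le> deg p) T) (u, R) v = Some U" "tbl' = (U, v) # tbl"
    using assms(3) unfolding e step.simps extend_Some r by blast
  obtain k where d: "deg X = 2" "\<forall>p\<in>set T. 2 \<le> deg p" and R: "R = [(k, U)]" "add_mult k v u = (0, 0, 0, 0)"
    using solved_Some[OF U(1)] by (auto simp: list_all_iff)
  have alt: "alternating s" using assms(1) by (simp add: invariant_def)
  have k: "k \<noteq> 0"
    using residual_nonzero[OF r] by (auto simp: R sort_terms_def)
  have "dot u y + of_int k * s (map mon U) = 0"
    using invariant_lterms[OF assms(1) d] residual[OF assms(2) r]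
    by (simp add: R lincomb_sort_terms[OF alt])
  moreover have "dot u y + of_int k * dot v y = 0"
    using dot_add_mult[of k v u y] by (simp add: R(2))
  ultimately have "of_int k * s (map mon U) = of_int k * dot v y" by linarith
  then have "s (map mon U) = dot v y" using k by simp
  then show ?thesis
    using assms(2) by (simp add: U(2) sound_def)
qed

lemma steps_sound:
  "invariant s \<Longrightarrow> sound s y tbl \<Longrightarrow> steps es (Some tbl) = Some tbl' \<Longrightarrow> sound s y tbl'"
proof (induction es arbitrary: tbl)
  case (Cons e es)
  then obtain tbl1 where "step e tbl = Some tbl1"
    by (cases "step e tbl") (auto simp: steps_None)
  then show ?case using Cons.IH[of tbl1] Cons.prems step_sound[OF Cons.prems(1,2), of e tbl1] by simp
qed simp

section \<open>Torus weights and extremal monomials\<close>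

fun weight1 :: "expo \<Rightarrow> int" where "weight1 (a, b, c, d) = int d - int a"
fun weight2 :: "expo \<Rightarrow> int" where "weight2 (a, b, c, d) = int c - int b"

lemma lincomb_diagonal:
  assumes "\<And>p. br X p = filter (\<lambda>(k, _). k \<noteq> 0) [(h p, p)]"
  shows "lincomb s (lterms X T) = of_int (\<Sum>p\<leftarrow>T. h p) * s (map mon T)"
  by (induction T arbitrary: s) (auto simp: assms lincomb_Cons contract_def algebra_simps)

text \<open>The Hamiltonians x1 x4 and x2 x3 span a Cartan subalgebra and act diagonally on
  monomials. Their relations multiply the coordinate by its total weight.\<close>

lemma weight_zero:
  assumes "invariant s" "\<forall>p\<in>set T. 2 \<le> deg p" "(\<Sum>p\<leftarrow>T. weight1 p) \<noteq> 0 \<or> (\<Sum>p\<leftarrow>T. weight2 p) \<noteq> 0"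
  shows "s (map mon T) = 0"
proof -
  have "br (1, 0, 0, 1) p = filter (\<lambda>(k, _). k \<noteq> 0) [(weight1 p, p)]"
    "br (0, 1, 1, 0) p = filter (\<lambda>(k, _). k \<noteq> 0) [(weight2 p, p)]" for p
    by (cases p; simp)+
  from this[THEN lincomb_diagonal] show ?thesis
    using invariant_lterms[OF assms(1) _ assms(2), of "(1, 0, 0, 1)"]
      invariant_lterms[OF assms(1) _ assms(2), of "(0, 1, 1, 0)"] assms(3) by auto
qed

text \<open>The monomials of degree \<open>l\<close> arise from \<open>x\<^sub>4\<^sup>l\<close> by the raising operators, which fix \<open>x\<^sub>1\<^sup>k\<close>, and from
  \<open>x\<^sub>1\<^sup>l\<close> by the lowering operators.\<close>

lemma br_step:
  assumes s: "multilinear s" and X: "deg X = 2" "lie (mon X) s = 0"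
    and P: "\<And>T. map deg T = ls \<Longrightarrow> s (mon q # map mon T) = 0"
    and q: "2 \<le> deg q" "\<forall>l\<in>set ls. 2 \<le> l" and T: "map deg T = ls"
  shows "(\<Sum>(k, r)\<leftarrow>br X q. real_of_int k * s (mon r # map mon T)) = 0"
proof -
  have d: "\<forall>p\<in>set T. 2 \<le> deg p" using q(2) unfolding T[symmetric] by simp
  have "lincomb s (lterms X (q # T)) = 0"
    using lie_lterms[OF s, of X "q # T"] X d q(1) by simp
  \<comment> \<open>Where \<open>X\<close> acts on a later slot, \<open>q\<close> stays in front and
    the degrees \<open>ls\<close> persist, so the hypothesis on \<open>q\<close> removes these
    terms. What remains is the action on the first slot.\<close>
  moreover have "lincomb (contract (mon q) s) (lterms X T) = 0"
    using P lterms_deg[OF _ _ d] X(1) T by (intro lincomb_eq_0) (fastforce simp: contract_def)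
  moreover have "lincomb s (map (\<lambda>(k, q). (k, q # T)) xs) = (\<Sum>(k, r)\<leftarrow>xs. real_of_int k * s (mon r # map mon T))" for xs
    by (induction xs) auto
  ultimately show ?thesis by (simp add: lincomb_Cons)
qed

text \<open>Invariance is assumed only for the three operators that annihilate powers of x1. It
  therefore survives contraction with such a power, as \<open>two_slots\<close> requires.\<close>

lemma raise_all:
  assumes s: "multilinear s" and l: "2 \<le> l" "\<forall>l\<in>set ls. 2 \<le> l"
    and X: "lie (mon (2, 0, 0, 0)) s = 0" "lie (mon (1, 1, 0, 0)) s = 0" "lie (mon (1, 0, 1, 0)) s = 0"
    and z: "\<And>T. map deg T = ls \<Longrightarrow> s (mon (0, 0, 0, l) # map mon T) = 0"
    and p: "deg p = l" and T: "map deg T = ls"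
  shows "s (mon p # map mon T) = 0"
proof -
  define P where "P q \<longleftrightarrow> (\<forall>T. map deg T = ls \<longrightarrow> s (mon q # map mon T) = 0)" for q
  have step: "(\<Sum>(k, r)\<leftarrow>br X q. real_of_int k * s (mon r # map mon T)) = 0"
    if "deg X = 2" "lie (mon X) s = 0" "P q" "deg q = l" "map deg T = ls" for X q T
    by (rule br_step[OF s that(1,2) _ _ l(2) that(5)]) (use that l in \<open>auto simp: P_def\<close>)
  have a: "P (a, 0, 0, d)" if "a + d = l" for a d
    using that
  proof (induction a arbitrary: d)
    case 0
    then show ?case using z by (simp add: P_def)
  next
    case (Suc a)
    have "P (a, 0, 0, Suc d)" using Suc by simp
    then show ?case
      using step[OF _ X(1), of "(a, 0, 0, Suc d)"] Suc.prems by (auto simp: P_def)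
  qed
  have b: "P (a, b, 0, d)" if "a + b + d = l" for a b d
    using that
  proof (induction b arbitrary: d)
    case 0
    then show ?case using a by simp
  next
    case (Suc b)
    have "P (a, b, 0, Suc d)" using Suc by simp
    then show ?case
      using step[OF _ X(2), of "(a, b, 0, Suc d)"] Suc.prems by (auto simp: P_def)
  qed
  have "P (a, b, c, d)" if "a + b + c + d = l" for a b c d
    using that
  proof (induction c arbitrary: a b d)
    case 0
    then show ?case using b by simp
  next
    case (Suc c)
    have 1: "P (a, b, c, Suc d)" using Suc by simp
    \<comment> \<open>The bracket of x1 x3 with the monomial of \<open>1\<close> has a second term,
      with these exponents and the coefficient \<open>- b\<close>. Its exponent of x3 is still
      \<open>c\<close>, so the induction hypothesis covers it.\<close>
    have 2: "P (Suc a, b - 1, c, Suc d)" if "b \<noteq> 0" using Suc that by simp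
    show ?case
      using step[OF _ X(3) 1] 2 Suc.prems by (cases "b = 0") (auto simp: P_def)
  qed
  then show ?thesis using p T by (cases p) (auto simp: P_def)
qed

lemma lower_all:
  assumes s: "multilinear s" and l: "2 \<le> l" "\<forall>l\<in>set ls. 2 \<le> l"
    and X: "lie (mon (0, 0, 0, 2)) s = 0" "lie (mon (0, 0, 1, 1)) s = 0" "lie (mon (0, 1, 0, 1)) s = 0"
    and z: "\<And>T. map deg T = ls \<Longrightarrow> s (mon (l, 0, 0, 0) # map mon T) = 0"
    and p: "deg p = l" and T: "map deg T = ls"
  shows "s (mon p # map mon T) = 0"
proof -
  define P where "P q \<longleftrightarrow> (\<forall>T. map deg T = ls \<longrightarrow> s (mon q # map mon T) = 0)" for q
  have step: "(\<Sum>(k, r)\<leftarrow>br X q. real_of_int k * s (mon r # map mon T)) = 0"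
    if "deg X = 2" "lie (mon X) s = 0" "P q" "deg q = l" "map deg T = ls" for X q T
    by (rule br_step[OF s that(1,2) _ _ l(2) that(5)]) (use that l in \<open>auto simp: P_def\<close>)
  have d: "P (a, 0, 0, d)" if "a + d = l" for a d
    using that
  proof (induction d arbitrary: a)
    case 0
    then show ?case using z by (simp add: P_def)
  next
    case (Suc d)
    have "P (Suc a, 0, 0, d)" using Suc by simp
    then show ?case
      using step[OF _ X(1), of "(Suc a, 0, 0, d)"] Suc.prems by (auto simp: P_def)
  qed
  have c: "P (a, 0, c, d)" if "a + c + d = l" for a c d
    using that
  proof (induction c arbitrary: a)
    case 0
    then show ?case using d by simp
  next
    case (Suc c)
    have "P (Suc a, 0, c, d)" using Suc by simp
    then show ?case
      using step[OF _ X(2), of "(Suc a, 0, c, d)"] Suc.prems by (auto simp: P_def)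
  qed
  have "P (a, b, c, d)" if "a + b + c + d = l" for a b c d
    using that
  proof (induction b arbitrary: a c d)
    case 0
    then show ?case using c by simp
  next
    case (Suc b)
    have 1: "P (Suc a, b, c, d)" using Suc by simp
    have 2: "P (Suc a, b, c - 1, Suc d)" if "c \<noteq> 0" using Suc that by simp
    show ?case
      using step[OF _ X(3) 1] 2 Suc.prems by (cases "c = 0") (auto simp: P_def)
  qed
  then show ?thesis using p T by (cases p) (auto simp: P_def)
qed

text \<open>Lowering operators reduce the first slot to a power of x1. The raising operators that
  fix this power commute with contraction by it, and they reduce the second slot to a power of
  x4.\<close>

lemma two_slots:
  assumes s: "invariant s" and l: "2 \<le> l1" "2 \<le> l2" "\<forall>l\<in>set ls. 2 \<le> l"
    and z: "\<And>T. map deg T = ls \<Longrightarrow> s (mon (l1, 0, 0, 0) # mon (0, 0, 0, l2) # map mon T) = 0"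
    and T: "map deg T = l1 # l2 # ls"
  shows "s (map mon T) = 0"
proof -
  have lie: "\<And>X. deg X = 2 \<Longrightarrow> lie (mon X) s = 0" and mult: "multilinear s"
    using s by (auto simp: invariant_def)
  define t where "t = contract (mon (l1, 0, 0, 0)) s"
  have t: "lie (mon X) t = 0" if "br X (l1, 0, 0, 0) = []" "deg X = 2" for X
  proof -
    have "lie (mon X) t = contract (mon (l1, 0, 0, 0)) (lie (mon X) s) + contract (bracket (mon X) (mon (l1, 0, 0, 0))) s"
      by (simp add: contract_lie t_def)
    also have "bracket (mon X) (mon (l1, 0, 0, 0)) = 0"
      using bracket_mon[of X "(l1, 0, 0, 0)"] that l(1) by simp
    finally show ?thesis
      by (simp only: lie[OF that(2)] contract_0_left[OF mult] contract_zero add_0_left)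
  qed
  have "t (mon q # map mon U) = 0" if "deg q = l2" "map deg U = ls" for q U
  proof (rule raise_all[where l = l2 and ls = ls])
    show "multilinear t" unfolding t_def by (rule multilinear_contract[OF mult])
    show "t (mon (0, 0, 0, l2) # map mon T) = 0" if "map deg T = ls" for T
      using z[OF that] by (simp add: t_def contract_def)
  qed (use that l in \<open>auto intro!: t\<close>)
  then have first: "s (mon (l1, 0, 0, 0) # map mon U) = 0" if "map deg U = l2 # ls" for U
    using that by (cases U) (auto simp: t_def contract_def)
  obtain p U where pU: "T = p # U" "deg p = l1" "map deg U = l2 # ls"
    using T by (cases T) auto
  have "s (mon p # map mon U) = 0"
    by (rule lower_all[OF mult l(1) _ _ _ _ first pU(2,3)]) (use l lie in auto)
  then show ?thesis by (simp add: pU(1))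
qed

section \<open>Enumerating the coordinates that have to be known\<close>

fun complements :: "nat \<Rightarrow> expo list \<Rightarrow> int \<Rightarrow> int \<Rightarrow> expo list list" where
  "complements 0 xs v w = (if v = 0 \<and> w = 0 then [[]] else [])"
| "complements (Suc k) [] v w = []"
| "complements (Suc k) (x # xs) v w =
     map ((#) x) (complements k xs (v + weight1 x) (w + weight2 x)) @ complements (Suc k) xs v w"

text \<open>The enumeration is of unordered tuples without repetition whose weights cancel
  \<open>v\<close> and \<open>w\<close>. For an alternating invariant form, the order matters only
  up to sign and all other tuples give 0.\<close>

lemma complements_complete:
  "distinct T \<Longrightarrow> set T \<subseteq> set xs \<Longrightarrow> length T = k \<Longrightarrow> v + (\<Sum>p\<leftarrow>T. weight1 p) = 0 \<Longrightarrow>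
    w + (\<Sum>p\<leftarrow>T. weight2 p) = 0 \<Longrightarrow> \<exists>S\<in>set (complements k xs v w). mset S = mset T"
proof (induction k xs v w arbitrary: T rule: complements.induct)
  case (3 k x xs v w)
  show ?case
  proof (cases "x \<in> set T")
    case True
    then obtain us vs where T: "T = us @ x # vs" by (meson split_list)
    obtain S where "S \<in> set (complements k xs (v + weight1 x) (w + weight2 x))" "mset S = mset (us @ vs)"
      using 3(1)[of "us @ vs"] 3(3-7) unfolding T by auto
    then show ?thesis by (intro bexI[of _ "x # S"]) (auto simp: T)
  next
    case False
    then show ?thesis using 3(2)[of T] 3(3-7) by auto
  qed
qed auto

definition monomials :: "nat \<Rightarrow> expo list" where
  "monomials l = concat (map (\<lambda>a. concat (map (\<lambda>b. map (\<lambda>c. (a, b, c, l - a - b - c))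
     [0..<Suc (l - a - b)]) [0..<Suc (l - a)])) [0..<Suc l])"

lemma set_monomials: "deg p = l \<Longrightarrow> p \<in> set (monomials l)"
proof (cases p)
  case (fields a b c d)
  assume "deg p = l"
  then have "d = l - a - b - c" "a < Suc l" "b < Suc (l - a)" "c < Suc (l - a - b)"
    by (auto simp: fields)
  then have "\<exists>x\<in>{0..<Suc l}. \<exists>y\<in>{0..<Suc (l - x)}. p \<in> (\<lambda>c. (x, y, c, l - x - y - c)) ` {0..<Suc (l - x - y)}"
    unfolding fields by (intro bexI[of _ a] bexI[of _ b] image_eqI[of _ _ c]) auto
  then show ?thesis by (simp add: monomials_def del: upt_Suc)
qed

text \<open>The tuple \<open>(l1, l2, k, l)\<close> stands for the degrees \<open>l1, l2, l, \<dots>, l\<close> with \<open>k\<close> copies of \<open>l\<close>.\<close>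

type_synonym shape = "nat \<times> nat \<times> nat \<times> nat"

fun shape_list :: "shape \<Rightarrow> nat list" where
  "shape_list (l1, l2, k, l) = l1 # l2 # replicate k l"

fun known :: "int \<times> expo list \<times> vec option \<Rightarrow> bool" where
  "known (e, U, v) \<longleftrightarrow> e = 0 \<or> v \<noteq> None"

lemma known_lookups: "list_all known (lookups tbl L) \<longleftrightarrow> (\<forall>(e, U)\<in>set L. e = 0 \<or> find_entry tbl U \<noteq> None)"
  by (induction tbl L rule: lookups.induct) auto

text \<open>\<open>int l2 - int l1\<close> and 0 are the combined weights of x1^l1 and x4^l2, which
  the remaining entries have to cancel.\<close>

fun covers :: "table \<Rightarrow> shape \<Rightarrow> bool" where
  "covers tbl (l1, l2, k, l) = (2 \<le> l1 \<and> 2 \<le> l2 \<and> 2 \<le> l \<and>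
     list_all known (lookups tbl (map (\<lambda>S. sort_sign ((l1, 0, 0, 0) # (0, 0, 0, l2) # S))
       (complements k (monomials l) (int l2 - int l1) 0))))"

text \<open>With all parameters 0, soundness makes every listed coordinate vanish. It therefore
  suffices that each relevant coordinate occurs in the table, whatever its vector.\<close>

lemma covers_zero:
  assumes s: "invariant s" and tbl: "sound s (\<lambda>_. 0) tbl" and sh: "covers tbl sh"
    and T: "map deg T = shape_list sh"
  shows "s (map mon T) = 0"
proof -
  obtain l1 l2 k l where shape: "sh = (l1, l2, k, l)" by (metis prod_cases4)
  have l: "2 \<le> l1" "2 \<le> l2" "2 \<le> l" using sh by (simp_all add: shape)
  have alt: "alternating s" using s by (simp add: invariant_def)
  show ?thesis
  proof (rule two_slots[OF s l(1,2)])
    show "map deg T = l1 # l2 # replicate k l" using T by (simp add: shape)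
    show "\<forall>l'\<in>set (replicate k l). 2 \<le> l'" using l(3) by simp
    fix T assume T: "map deg T = replicate k l"
    show "s (mon (l1, 0, 0, 0) # mon (0, 0, 0, l2) # map mon T) = 0"
    proof (cases "distinct T")
      case False
      then have "\<not> distinct (mon (l1, 0, 0, 0) # mon (0, 0, 0, l2) # map mon T)"
        by (auto simp: distinct_map)
      then show ?thesis by (rule alternating_eq_0[OF alt])
    next
      case True
      have dT: "deg p = l" if "p \<in> set T" for p
        using that T by (metis imageI in_set_replicate list.set_map)
      have len: "length T = k" using T by (metis length_map length_replicate)
      let ?V = "\<lambda>S. (l1, 0, 0, 0) # (0, 0, 0, l2) # S"
      show ?thesis
      proof (cases "(\<Sum>p\<leftarrow>?V T. weight1 p) = 0 \<and> (\<Sum>p\<leftarrow>?V T. weight2 p) = 0")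
        case False
        then show ?thesis using weight_zero[OF s, of "?V T"] l dT by auto
      next
        case True
        have sub: "set T \<subseteq> set (monomials l)" using set_monomials dT by blast
        obtain S where S: "S \<in> set (complements k (monomials l) (int l2 - int l1) 0)" "mset S = mset T"
          using complements_complete[OF \<open>distinct T\<close> sub len, of "int l2 - int l1" 0] True by auto
        obtain e U where e: "sort_sign (?V S) = (e, U)" by fastforce
        have "e = 0 \<or> find_entry tbl U \<noteq> None"
          using sh S(1) e unfolding shape covers.simps known_lookups by fastforce
        then have "s (map mon (?V S)) = 0"
        proof
          assume "find_entry tbl U \<noteq> None"
          then obtain v where "find_entry tbl U = Some v" by blast
          then have "s (map mon U) = 0" using soundD[OF tbl] by (cases v) simp
          then show ?thesis using sort_sign[OF alt e] by simp
        next
          assume "e = 0" then show ?thesis using sort_sign[OF alt e] by simp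
        qed
        moreover have "mset (map mon (?V S)) = mset (mon (l1, 0, 0, 0) # mon (0, 0, 0, l2) # map mon T)"
          using S(2) by simp
        ultimately show ?thesis
          using alternating_perm[OF _ alt] by fastforce
      qed
    qed
  qed
qed

fun compositions :: "nat \<Rightarrow> nat \<Rightarrow> nat list list" where
  "compositions 0 w = (if w = 0 then [[]] else [])"
| "compositions (Suc m) w = concat (map (\<lambda>i. map ((#) i) (compositions m (w - i))) [1..<Suc w])"

lemma compositions_complete:
  "\<forall>i\<in>set ls. 1 \<le> i \<Longrightarrow> sum_list ls = w \<Longrightarrow> length ls = m \<Longrightarrow> ls \<in> set (compositions m w)"
proof (induction m arbitrary: ls w)
  case (Suc m)
  obtain i ls' where ls: "ls = i # ls'" using Suc.prems(3) by (cases ls) auto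
  have "ls' \<in> set (compositions m (w - i))"
    by (rule Suc.IH) (use Suc.prems in \<open>auto simp: ls\<close>)
  then show ?case using Suc.prems by (force simp: ls)
qed auto

text \<open>The parts of a composition are the degrees minus 2, which are positive because quadratic
  arguments give 0. Comparison after sorting is enough for alternating forms, and leaves the choice
  of the two extremal slots free.\<close>

definition all_shapes :: "nat \<Rightarrow> nat \<Rightarrow> shape list \<Rightarrow> bool" where
  "all_shapes m w shs \<longleftrightarrow> list_all (\<lambda>js. list_ex (\<lambda>sh. sort (map (\<lambda>i. i + 2) js) = sort (shape_list sh)) shs)
     (compositions m w)"

lemma reorder_map:
  "mset (map f T) = mset ls \<Longrightarrow> \<exists>T'. mset T' = mset T \<and> map f T' = ls"
proof (induction ls arbitrary: T)
  case (Cons l ls)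
  then have "l \<in> f ` set T" by (metis list.set_intros(1) list.set_map mset_eq_setD)
  then obtain p where "p \<in> set T" "f p = l" by blast
  then obtain us vs where T: "T = us @ p # vs" "f p = l" by (meson split_list)
  have "mset (map f (us @ vs)) = mset ls" using Cons.prems by (simp add: T)
  from Cons.IH[OF this] obtain T' where "mset T' = mset (us @ vs)" "map f T' = ls" by blast
  then show ?case by (intro exI[of _ "p # T'"]) (simp add: T)
qed simp

lemma homogeneous_2_mon: "deg X = 2 \<Longrightarrow> homogeneous 2 (poly_of (mon X))"
  using homogeneous_mon[of X] by simp

lemma relative_invariant: "s \<in> relative_cochains m w \<Longrightarrow> invariant s"
  using homogeneous_2_mon unfolding relative_cochains_iff invariant_def cochain_form_def by blast

text \<open>An argument of degree 2 is annihilated by the relative condition, and \<open>mon\<close>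
  is 0 in lower degrees.\<close>

lemma relative_eq_0I:
  assumes s: "s \<in> relative_cochains m w"
    and z: "\<And>T. \<forall>p\<in>set T. 3 \<le> deg p \<Longrightarrow> length T = m \<Longrightarrow> (\<Sum>p\<leftarrow>T. deg p - 2) = w \<Longrightarrow> s (map mon T) = 0"
  shows "s = 0"
proof (rule form_eq_0I)
  have cf: "alternating s" "multilinear s" "of_length m s" "weighted (int w) s"
    and c2: "\<And>X. homogeneous 2 (poly_of X) \<Longrightarrow> contract X s = 0"
    using s by (auto simp: relative_cochains_iff cochain_form_def)
  show "multilinear s" by (rule cf)
  fix T
  show "s (map mon T) = 0"
  proof (cases "\<forall>p\<in>set T. 3 \<le> deg p")
    case True
    then have "(\<Sum>p\<leftarrow>T. int (deg p) - 2) = int (\<Sum>p\<leftarrow>T. deg p - 2)"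
      by (induction T) (auto simp: of_nat_diff simp del: deg.simps)
    moreover have "\<forall>p\<in>set T. 2 \<le> deg p" 
    proof
      fix p assume "p \<in> set T"
      then have "3 \<le> deg p" using True by blast
      then show "2 \<le> deg p" by simp
    qed
    ultimately have "(\<Sum>p\<leftarrow>T. deg p - 2) \<noteq> w \<Longrightarrow> s (map mon T) = 0"
      using weightedD[OF cf(4), of T] by (simp del: deg.simps)
    then show ?thesis
      using z[OF True] cf(3) by (cases "length T = m") (auto simp: of_length_def)
  next
    case False
    then obtain q where "q \<in> set T" "\<not> 3 \<le> deg q" by blast
    then obtain us vs where T: "T = us @ q # vs" "\<not> 3 \<le> deg q" by (meson split_list)
    have "contract (mon q) s = 0"
    proof (cases "deg q = 2")
      case True
      then show ?thesis using c2 homogeneous_mon[of q] by simp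
    next
      case False
      then have "mon q = 0" using T(2) by (simp add: mon_eq_0 del: deg.simps)
      then show ?thesis using contract_0_left[OF cf(2)] by simp
    qed
    then have "s (mon q # map mon us @ map mon vs) = 0"
      by (simp add: contract_Cons)
    then show ?thesis
      using alternating_move[OF cf(1), of "map mon us" "mon q" "map mon vs"] by (simp add: T(1))
  qed
qed

text \<open>The result lists the values of the coboundary on \<open>Ts\<close>.\<close>

fun conclude :: "table option \<Rightarrow> shape list \<Rightarrow> expo list list \<Rightarrow> (vec \<times> (int \<times> expo list) list) list option" where
  "conclude None shs Ts = None"
| "conclude (Some tbl) shs Ts = (if list_all (covers tbl) shs
     then Some (map (\<lambda>T. residual tbl (sort_terms (dterms T))) Ts) else None)"

definition certificate :: "nat \<Rightarrow> nat \<Rightarrow> shape list \<Rightarrow> table \<Rightarrow> (expo \<times> expo list \<times> vec) list \<Rightarrow> expo list list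
    \<Rightarrow> (vec \<times> (int \<times> expo list) list) list option" where
  "certificate m w shs base es Ts =
     (if all_shapes m w shs then conclude (steps es (Some base)) shs Ts else None)"

lemma certificate_Some:
  assumes "certificate m w shs base es Ts = Some R"
  obtains tbl where "all_shapes m w shs" "steps es (Some base) = Some tbl" "list_all (covers tbl) shs"
    "map (\<lambda>T. residual tbl (sort_terms (dterms T))) Ts = R"
  using assms by (cases "steps es (Some base)") (auto simp: certificate_def split: if_splits)

lemma certificate_zero:
  assumes "certificate m w shs base es Ts = Some R" "s \<in> relative_cochains m w"
    and "sound s (\<lambda>_. 0) base"
  shows "s = 0"
proof (rule relative_eq_0I[OF assms(2)])
  fix T :: "expo list"
  assume T: "\<forall>p\<in>set T. 3 \<le> deg p" "length T = m" "(\<Sum>p\<leftarrow>T. deg p - 2) = w"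
  have inv: "invariant s" and alt: "alternating s"
    using relative_invariant[OF assms(2)] by (auto simp: invariant_def)
  obtain tbl where tbl: "all_shapes m w shs" "steps es (Some base) = Some tbl" "list_all (covers tbl) shs"
    using certificate_Some[OF assms(1)] by blast
  have snd: "sound s (\<lambda>_. 0) tbl" by (rule steps_sound[OF inv assms(3) tbl(2)])
  have "map (\<lambda>p. deg p - 2) T \<in> set (compositions m w)"
    by (rule compositions_complete) (use T in auto)
  then have "\<exists>sh\<in>set shs. sort (map (\<lambda>i. i + 2) (map (\<lambda>p. deg p - 2) T)) = sort (shape_list sh)"
    using tbl(1) unfolding all_shapes_def list_all_iff list_ex_iff by (rule bspec[rotated])
  moreover have "map (\<lambda>i. i + 2) (map (\<lambda>p. deg p - 2) T) = map deg T"
    using T(1) by (auto simp del: deg.simps)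
  ultimately obtain sh where sh: "sh \<in> set shs" "sort (map deg T) = sort (shape_list sh)"
    by metis
  then have "mset (map deg T) = mset (shape_list sh)" by (metis mset_sort)
  then obtain T' where T': "mset T' = mset T" "map deg T' = shape_list sh"
    using reorder_map by blast
  have "covers tbl sh" using tbl(3) sh(1) by (simp add: list_all_iff)
  then have "s (map mon T') = 0"
    using covers_zero[OF inv snd _ T'(2)] by blast
  moreover have "mset (map mon T) = mset (map mon T')" using T'(1) by simp
  ultimately show "s (map mon T) = 0"
    using alternating_perm[OF _ alt] by fastforce
qed

text \<open>An empty remainder means that all terms of the coboundary on a test tuple occur in the
  table, so a cocycle satisfies one linear equation in the parameters per test tuple.\<close>

lemma certificate_coboundary:
  assumes "certificate m w shs base es Ts = Some (map (\<lambda>v. (v, [])) vs)" "s \<in> relative_cochains m w"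
    and "sound s y base" "coboundary s = 0" "list_all (list_all (\<lambda>p. 2 \<le> deg p)) Ts"
  shows "\<forall>v\<in>set vs. dot v y = 0"
proof
  fix v assume v: "v \<in> set vs"
  have inv: "invariant s" and alt: "alternating s" and mult: "multilinear s"
    using relative_invariant[OF assms(2)] by (auto simp: invariant_def)
  obtain tbl where tbl: "steps es (Some base) = Some tbl"
      "map (\<lambda>T. residual tbl (sort_terms (dterms T))) Ts = map (\<lambda>v. (v, [])) vs"
    using certificate_Some[OF assms(1)] by blast
  have snd: "sound s y tbl" by (rule steps_sound[OF inv assms(3) tbl(1)])
  have "(v, []) \<in> set (map (\<lambda>T. residual tbl (sort_terms (dterms T))) Ts)"
    using v unfolding tbl(2) by auto
  then obtain T where T: "T \<in> set Ts" "residual tbl (sort_terms (dterms T)) = (v, [])"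
    by auto
  have "\<forall>p\<in>set T. 2 \<le> deg p" using assms(5) T(1) by (simp add: list_all_iff)
  then show "dot v y = 0"
    using coboundary_dterms[OF alt mult, of T] residual[OF snd T(2)] assms(4)
    by (simp add: lincomb_sort_terms[OF alt])
qed

section \<open>Certificates\<close>

text \<open>The equations were found by a computer search for relations with a single unknown coordinate, where the
  initial coordinates were added whenever no such relation was left. The values of the initial coordinates are
  chosen such that all values are integral.\<close>

abbreviation (input) zero_values :: "(expo \<times> expo list) list \<Rightarrow> (expo \<times> expo list \<times> vec) list" where
  "zero_values xs \<equiv> map (\<lambda>(X, T). (X, T, 0, 0, 0, 0)) xs"

definition base2 :: table where
  "base2 = [
   ([(0,0,0,5),(5,0,0,0)], (20,0,0,0))]"

definition steps2 :: "(expo \<times> expo list \<times> vec) list" where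
  "steps2 = [
   ((0,0,2,0), [(1,0,0,4),(3,2,0,0)], (0,0,0,0)), ((2,0,0,0), [(1,1,1,0),(1,1,1,4)], (0,0,0,0)),
   ((0,0,1,1), [(0,1,0,4),(5,0,0,0)], (-4,0,0,0)), ((1,0,1,0), [(0,1,0,4),(3,1,1,0)], (-1,0,0,0))]"

definition tests2 :: "expo list list" where
  "tests2 = [
   [(0,0,0,4),(1,1,1,0),(3,1,1,0)]]"

text \<open>Both slots are extremal here; the trailing \<open>0, 2\<close> in the shapes says that
  there are no further slots. The result -4 is nonzero, which gives injectivity of the
  coboundary.\<close>

lemma certificate2:
  "certificate 2 6 [(7,3,0,2),(6,4,0,2),(5,5,0,2)] base2 steps2 tests2 =
    Some (map (\<lambda>v. (v, [])) [(-4,0,0,0)])"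
  by code_simp

definition base3 :: table where
  "base3 = [
   ([(0,0,0,4),(1,0,0,2),(5,0,0,0)], (0,0,0,0))]"

definition steps3 :: "(expo \<times> expo list) list" where
  "steps3 = [
   ((0,0,2,0), [(0,0,0,4),(0,3,1,0),(4,0,0,0)]), ((0,2,0,0), [(0,0,0,4),(1,0,2,1),(4,0,0,0)]),
   ((0,0,2,0), [(0,0,0,4),(0,2,0,1),(5,0,0,0)]), ((2,0,0,0), [(0,0,0,4),(1,0,0,3),(4,0,0,0)])]"

lemma certificate3: "certificate 3 6 [(6,3,1,3),(5,4,1,3),(4,4,1,4)] base3 (zero_values steps3) [] = Some []"
  by code_simp

text \<open>No free coordinate: the relations alone force every coordinate to be 0.\<close>

definition base4 :: table where
  "base4 = []"

definition steps4 :: "(expo \<times> expo list) list" where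
  "steps4 = [
   ((0,0,0,2), [(0,0,3,0),(0,2,1,0),(0,2,1,1),(3,1,0,0)]),
   ((2,0,0,0), [(0,0,3,0),(0,1,0,3),(0,2,1,0),(1,2,1,0)]),
   ((0,0,2,0), [(0,0,0,4),(0,2,0,1),(2,0,0,1),(4,0,0,0)]),
   ((0,2,0,0), [(0,0,3,0),(0,1,2,0),(1,1,0,2),(2,1,0,1)]),
   ((0,0,0,2), [(0,0,3,0),(0,3,0,0),(2,0,0,2),(3,0,0,1)]),
   ((0,0,2,0), [(0,0,0,3),(0,2,0,1),(1,0,0,2),(5,0,0,0)]),
   ((2,0,0,0), [(0,1,2,0),(0,2,1,0),(1,0,0,3),(2,0,0,2)]),
   ((0,0,2,0), [(0,0,0,4),(1,0,0,2),(1,2,0,0),(4,0,0,0)]),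
   ((2,0,0,0), [(0,0,0,4),(1,0,0,3),(2,0,0,1),(3,0,0,0)]),
   ((0,0,0,2), [(0,0,0,3),(1,0,0,2),(3,0,0,1),(4,0,0,0)]),
   ((0,0,2,0), [(0,0,0,4),(0,3,0,0),(1,0,1,1),(4,0,0,0)]),
   ((2,0,0,0), [(0,0,3,0),(0,1,0,3),(1,1,0,2),(2,1,0,0)]),
   ((0,0,0,2), [(0,0,1,2),(0,3,0,0),(2,0,1,1),(3,0,1,0)]),
   ((0,0,2,0), [(0,0,0,3),(0,0,1,2),(0,3,0,0),(5,0,0,0)]),
   ((2,0,0,0), [(0,1,1,1),(1,0,0,3),(1,1,1,0),(2,0,0,2)]),
   ((2,0,0,0), [(0,1,0,3),(0,1,2,0),(1,1,0,2),(2,0,1,0)]),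
   ((0,2,0,0), [(0,0,3,0),(0,1,2,0),(1,2,0,1),(2,0,0,2)]),
   ((0,0,2,0), [(0,0,1,3),(0,3,0,0),(1,0,0,2),(4,0,0,0)]),
   ((0,2,0,0), [(0,0,3,0),(0,1,2,0),(1,1,1,1),(1,2,0,1)]),
   ((0,2,0,0), [(0,0,0,3),(0,0,3,0),(0,1,0,2),(5,0,0,0)]),
   ((0,0,2,0), [(0,0,0,3),(0,1,1,1),(0,2,0,1),(5,0,0,0)]),
   ((0,2,0,0), [(0,0,3,0),(0,1,0,3),(0,1,2,0),(3,1,0,0)]),
   ((0,2,0,0), [(0,0,0,4),(0,0,3,0),(2,0,0,1),(3,1,0,0)]),
   ((0,2,0,0), [(0,0,3,0),(0,1,0,3),(1,0,0,2),(4,0,0,0)]),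
   ((0,2,0,0), [(0,0,0,4),(0,0,3,0),(1,1,0,1),(4,0,0,0)]),
   ((2,0,0,0), [(0,0,1,2),(0,0,1,3),(0,3,0,0),(3,0,1,0)]),
   ((0,0,0,2), [(0,0,3,0),(0,3,0,0),(1,0,0,3),(4,0,0,0)]),
   ((0,0,0,2), [(1,0,0,3),(2,0,0,1),(2,0,0,2),(3,0,0,0)]),
   ((0,0,0,2), [(0,1,1,1),(1,0,0,3),(1,1,1,0),(4,0,0,0)]),
   ((0,0,0,2), [(0,0,3,0),(0,1,0,3),(2,1,0,0),(3,1,0,0)]),
   ((0,0,0,2), [(0,1,2,0),(0,2,1,0),(1,0,0,3),(4,0,0,0)]),
   ((0,0,0,2), [(0,1,0,3),(0,1,2,0),(2,0,1,0),(3,1,0,0)]),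
   ((2,0,0,0), [(0,0,0,3),(1,0,0,2),(1,0,0,3),(4,0,0,0)]),
   ((1,1,0,0), [(0,0,0,3),(0,0,2,1),(0,1,0,2),(5,0,0,0)]),
   ((1,0,1,0), [(0,0,0,3),(0,0,1,2),(0,2,0,1),(5,0,0,0)]),
   ((0,0,1,1), [(0,0,3,0),(0,2,1,0),(1,2,0,1),(2,1,0,1)]),
   ((1,0,1,0), [(0,0,3,0),(0,2,1,0),(1,1,0,2),(1,2,0,1)]),
   ((0,0,2,0), [(0,0,0,4),(0,1,1,1),(1,2,0,0),(4,0,0,0)]),
   ((2,0,0,0), [(1,0,0,2),(1,0,0,3),(2,0,0,1),(2,0,0,2)]),
   ((0,0,2,0), [(0,0,1,3),(0,3,0,0),(1,0,1,1),(3,1,0,0)]),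
   ((0,0,0,2), [(0,0,3,0),(0,1,1,1),(1,2,0,1),(3,1,0,0)]),
   ((0,2,0,0), [(0,0,0,4),(0,1,1,1),(1,0,2,0),(4,0,0,0)]),
   ((2,0,0,0), [(0,0,3,0),(0,1,0,3),(1,1,1,0),(1,2,0,1)]),
   ((2,0,0,0), [(0,0,0,3),(1,0,0,3),(2,0,0,2),(3,0,0,0)]),
   ((1,0,1,0), [(0,0,0,4),(0,1,1,1),(0,2,1,0),(4,0,0,0)]),
   ((1,1,0,0), [(0,0,0,4),(0,1,1,1),(0,1,2,0),(4,0,0,0)]),
   ((0,1,0,1), [(0,0,0,4),(0,1,2,0),(1,1,1,0),(4,0,0,0)]),
   ((0,0,0,2), [(0,0,0,3),(1,0,0,3),(3,0,0,0),(4,0,0,0)]),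
   ((0,0,0,2), [(1,0,0,2),(1,0,0,3),(2,0,0,1),(4,0,0,0)]),
   ((0,1,0,1), [(0,0,3,0),(0,1,0,3),(1,1,1,0),(3,1,0,0)]),
   ((1,1,0,0), [(0,0,0,4),(0,1,2,0),(1,0,1,1),(3,1,0,0)]),
   ((1,1,0,0), [(0,0,3,0),(0,1,0,3),(0,1,1,1),(3,1,0,0)]),
   ((0,1,0,1), [(0,1,0,3),(0,1,2,0),(1,0,1,1),(4,0,0,0)]),
   ((0,1,0,1), [(0,0,1,3),(0,2,1,0),(1,0,1,1),(4,0,0,0)]),
   ((0,1,0,1), [(0,1,0,3),(0,1,1,1),(1,0,2,0),(4,0,0,0)]),
   ((1,0,1,0), [(0,0,0,4),(0,2,0,1),(1,0,1,1),(4,0,0,0)]),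
   ((1,1,0,0), [(0,0,0,4),(0,0,2,1),(1,1,1,0),(3,1,0,0)]),
   ((0,1,0,1), [(0,0,0,4),(0,0,2,1),(2,1,0,0),(4,0,0,0)]),
   ((1,1,0,0), [(0,0,0,4),(0,1,0,2),(1,0,2,0),(4,0,0,0)])]"

lemma certificate4: "certificate 4 6 [(5,3,2,3),(4,4,2,3)] base4 (zero_values steps4) [] = Some []"
  by code_simp

definition base5 :: table where
  "base5 = [
   ([(0,0,0,3),(0,0,3,0),(0,1,0,2),(1,2,0,0),(4,0,0,0)], (72,0,0,0)),
   ([(0,0,0,3),(0,1,0,2),(1,0,1,1),(1,1,1,0),(4,0,0,0)], (0,12,0,0)),
   ([(0,0,0,3),(0,2,0,1),(1,0,0,2),(1,0,2,0),(4,0,0,0)], (0,0,12,0)),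
   ([(0,0,0,3),(0,0,1,2),(0,2,0,1),(2,0,1,0),(4,0,0,0)], (0,0,0,24))]"

definition steps5 :: "(expo \<times> expo list \<times> vec) list" where
  "steps5 = [
   ((0,0,2,0), [(0,0,0,3),(0,0,1,2),(0,3,0,0),(2,0,0,1),(4,0,0,0)], (0,0,0,0)),
   ((0,2,0,0), [(0,0,0,3),(0,0,3,0),(0,1,0,2),(2,0,0,1),(4,0,0,0)], (0,0,0,0)),
   ((0,2,0,0), [(0,0,1,2),(0,1,0,2),(1,0,0,2),(1,0,2,0),(4,0,0,0)], (0,0,0,0)),
   ((0,2,0,0), [(0,0,0,3),(0,0,3,0),(1,0,0,2),(2,0,0,1),(3,1,0,0)], (0,0,0,0)),
   ((0,0,2,0), [(0,0,1,2),(0,1,0,2),(0,3,0,0),(1,0,1,1),(4,0,0,0)], (0,0,0,0)),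
   ((0,0,2,0), [(0,0,0,3),(0,3,1,0),(1,0,0,2),(2,0,0,1),(3,0,0,0)], (0,0,0,0)),
   ((0,2,0,0), [(0,0,0,3),(1,0,0,2),(1,0,2,0),(1,1,1,0),(3,0,0,1)], (0,0,0,0)),
   ((2,0,0,0), [(0,0,1,2),(0,3,0,0),(1,0,0,3),(1,0,1,1),(2,0,1,0)], (0,0,0,0)),
   ((0,0,2,0), [(0,0,0,3),(0,2,0,1),(1,0,1,1),(1,1,0,1),(4,0,0,0)], (0,0,0,0)),
   ((0,2,0,0), [(0,0,0,3),(0,1,3,0),(1,0,0,2),(2,0,1,0),(2,1,0,0)], (0,0,0,0)),
   ((0,0,2,0), [(0,0,0,3),(0,2,0,1),(1,0,0,2),(2,0,0,1),(4,0,0,0)], (0,0,0,0)),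
   ((0,2,0,0), [(0,0,0,3),(0,0,2,1),(0,1,1,1),(2,0,0,1),(4,0,0,0)], (0,0,0,0)),
   ((0,0,2,0), [(0,0,0,3),(0,0,1,2),(0,4,0,0),(2,0,1,0),(3,0,0,0)], (0,0,0,0)),
   ((0,0,2,0), [(0,0,0,3),(0,0,2,1),(0,2,1,0),(0,3,0,0),(4,0,0,0)], (0,0,0,0)),
   ((0,0,2,0), [(0,0,0,3),(0,3,0,0),(1,0,0,2),(1,0,1,1),(4,0,0,0)], (0,0,0,0)),
   ((0,2,0,0), [(0,0,0,3),(0,0,3,0),(1,0,0,2),(1,1,0,1),(4,0,0,0)], (0,0,0,0)),
   ((2,0,0,0), [(0,0,0,3),(0,0,3,0),(0,3,0,0),(1,0,0,2),(2,1,1,0)], (0,0,0,0)),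
   ((0,2,0,0), [(0,0,0,3),(0,0,3,0),(0,1,2,0),(0,2,0,1),(4,0,0,0)], (0,0,0,0)),
   ((0,0,2,0), [(0,0,0,3),(0,0,3,0),(0,2,0,1),(0,3,0,0),(4,0,0,0)], (0,0,0,0)),
   ((0,0,0,2), [(0,0,0,3),(0,0,3,0),(0,3,0,0),(2,1,1,0),(3,0,0,0)], (0,0,0,0)),
   ((0,0,2,0), [(0,0,0,3),(0,0,1,2),(0,3,1,0),(2,1,0,0),(3,0,0,0)], (0,0,0,0)),
   ((0,2,0,0), [(0,0,0,3),(0,0,2,1),(0,1,2,0),(0,2,1,0),(4,0,0,0)], (0,0,0,0)),
   ((0,2,0,0), [(0,0,0,3),(0,0,3,0),(0,1,0,2),(1,1,1,0),(4,0,0,0)], (24,0,0,0)),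
   ((0,2,0,0), [(0,0,0,3),(0,0,1,2),(0,0,3,0),(1,2,0,0),(4,0,0,0)], (24,0,0,0)),
   ((1,1,0,0), [(0,0,0,3),(0,0,3,0),(0,1,0,2),(0,2,1,0),(4,0,0,0)], (-24,0,0,0)),
   ((0,0,2,0), [(0,0,0,3),(0,1,0,2),(0,3,0,0),(1,0,2,0),(4,0,0,0)], (72,0,0,0)),
   ((0,0,2,0), [(0,0,0,3),(0,0,1,2),(0,2,1,0),(1,2,0,0),(4,0,0,0)], (-24,0,0,0)),
   ((0,0,2,0), [(0,0,0,3),(0,1,0,2),(1,0,1,1),(1,2,0,0),(4,0,0,0)], (0,-24,0,0)),
   ((0,2,0,0), [(0,0,0,3),(0,1,0,2),(1,0,1,1),(1,0,2,0),(4,0,0,0)], (0,24,0,0)),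
   ((2,0,0,0), [(0,0,0,3),(0,0,1,2),(0,1,0,2),(1,1,1,0),(4,0,0,0)], (0,12,0,0)),
   ((1,1,0,0), [(0,0,0,3),(0,1,0,2),(0,1,2,0),(1,0,1,1),(4,0,0,0)], (12,-12,0,0)),
   ((1,0,1,0), [(0,0,0,3),(0,1,0,2),(0,2,1,0),(1,0,1,1),(4,0,0,0)], (12,-12,0,0)),
   ((0,2,0,0), [(0,0,0,3),(0,0,3,0),(0,2,0,1),(1,0,1,1),(4,0,0,0)], (-36,36,0,0)),
   ((0,0,2,0), [(0,0,0,3),(0,1,1,1),(0,3,0,0),(1,0,1,1),(4,0,0,0)], (-36,36,0,0)),
   ((0,2,0,0), [(0,0,0,3),(0,1,1,1),(0,1,2,0),(1,0,1,1),(4,0,0,0)], (-12,12,0,0)),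
   ((2,0,0,0), [(0,0,0,3),(0,0,1,2),(0,1,2,0),(0,2,0,1),(4,0,0,0)], (16,-8,0,0)),
   ((0,0,1,1), [(0,0,0,3),(0,1,1,1),(0,2,1,0),(2,0,0,1),(4,0,0,0)], (-6,6,0,0)),
   ((0,0,1,1), [(0,0,0,3),(0,1,2,0),(0,2,0,1),(2,0,0,1),(4,0,0,0)], (-6,6,0,0)),
   ((1,0,1,0), [(0,0,0,3),(0,0,1,2),(0,2,1,0),(1,1,0,1),(4,0,0,0)], (12,-12,0,0)),
   ((2,0,0,0), [(0,0,0,3),(0,1,1,1),(0,2,1,0),(1,0,0,2),(3,0,1,0)], (12,-12,0,0)),
   ((0,2,0,0), [(0,0,1,2),(0,0,3,0),(0,2,0,1),(1,0,0,2),(4,0,0,0)], (48,-24,0,0)),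
   ((0,0,0,2), [(0,0,0,3),(0,1,2,0),(0,2,0,1),(3,0,0,0),(3,0,1,0)], (-6,6,0,0)),
   ((0,0,0,2), [(0,1,2,0),(0,2,0,1),(1,0,0,2),(2,0,0,1),(3,0,1,0)], (2,-2,0,0)),
   ((0,1,0,1), [(0,0,0,3),(0,1,1,1),(0,1,2,0),(2,0,0,1),(4,0,0,0)], (6,-6,0,0)),
   ((0,1,0,1), [(0,0,0,3),(0,0,2,1),(0,2,1,0),(2,0,0,1),(4,0,0,0)], (-6,6,0,0)),
   ((2,0,0,0), [(0,0,0,3),(0,1,1,1),(0,1,2,0),(1,0,0,2),(3,1,0,0)], (-12,12,0,0)),
   ((0,0,2,0), [(0,0,0,3),(0,3,0,0),(1,0,0,2),(1,1,1,0),(3,0,1,0)], (-36,36,0,0)),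
   ((2,0,0,0), [(0,0,0,3),(0,0,2,1),(0,2,1,0),(1,0,0,2),(3,1,0,0)], (12,-12,0,0)),
   ((0,0,0,2), [(0,1,2,0),(0,2,0,1),(1,0,0,2),(2,0,1,1),(3,0,0,0)], (6,-6,0,0)),
   ((2,0,0,0), [(0,0,0,3),(0,1,2,0),(0,2,0,1),(1,0,1,2),(3,0,0,0)], (6,-6,0,0)),
   ((0,2,0,0), [(0,0,0,3),(0,0,3,0),(1,0,1,2),(1,2,0,0),(3,0,0,0)], (-18,18,0,0)),
   ((0,2,0,0), [(0,0,0,3),(0,1,1,1),(1,0,0,2),(1,0,2,0),(4,0,0,0)], (0,0,-6,0)),
   ((0,0,0,2), [(0,0,0,3),(1,0,0,2),(1,0,2,0),(1,2,0,0),(4,0,0,0)], (0,0,12,0)),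
   ((1,1,0,0), [(0,0,0,3),(0,1,0,2),(1,0,0,2),(1,0,2,0),(4,0,0,0)], (0,24,-12,0)),
   ((1,1,0,0), [(0,0,0,3),(0,0,3,0),(0,2,0,1),(1,0,0,2),(4,0,0,0)], (216,-144,-36,0)),
   ((0,1,0,1), [(0,0,0,3),(0,2,1,0),(1,0,0,2),(1,0,2,0),(4,0,0,0)], (-72,48,12,0)),
   ((2,0,0,0), [(0,0,0,3),(0,0,3,0),(0,3,0,0),(1,0,0,2),(3,0,0,1)], (-108,72,18,0)),
   ((0,2,0,0), [(0,0,0,3),(0,0,1,2),(1,0,0,2),(2,0,1,0),(4,0,0,0)], (0,-24,12,0)),
   ((1,1,0,0), [(0,0,0,3),(0,0,1,2),(0,0,3,0),(0,3,0,0),(4,0,0,0)], (0,48,12,0)),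
   ((0,0,1,1), [(0,0,0,3),(0,0,3,0),(0,3,0,0),(1,1,0,1),(4,0,0,0)], (-27,9,9,0)),
   ((0,1,0,1), [(0,0,0,3),(0,0,3,0),(0,3,0,0),(1,0,1,1),(4,0,0,0)], (27,-9,-9,0)),
   ((0,0,0,2), [(0,0,3,0),(0,3,0,0),(1,0,0,2),(2,0,0,1),(3,0,0,1)], (36,-24,-6,0)),
   ((0,0,0,2), [(0,0,1,2),(0,0,3,0),(0,3,0,0),(1,1,0,1),(4,0,0,0)], (0,12,3,0)),
   ((0,0,0,2), [(0,0,0,3),(0,0,3,0),(0,3,0,0),(3,0,0,0),(3,0,0,1)], (-108,72,18,0)),
   ((0,0,0,2), [(0,0,0,3),(0,0,3,0),(0,3,0,0),(2,0,1,0),(3,1,0,0)], (-18,6,6,0)),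
   ((0,0,0,2), [(0,0,0,3),(0,0,3,0),(0,3,0,0),(2,1,0,0),(3,0,1,0)], (-18,6,6,0)),
   ((2,0,0,0), [(0,0,0,3),(0,0,3,0),(0,3,0,0),(1,0,0,3),(3,0,0,0)], (108,-72,-18,0)),
   ((0,0,0,2), [(0,0,1,2),(0,0,3,0),(0,3,0,0),(2,1,0,0),(3,0,0,1)], (0,8,2,0)),
   ((2,0,0,0), [(0,0,0,3),(0,0,3,0),(0,3,0,0),(1,1,0,2),(2,0,1,0)], (-12,4,4,0)),
   ((2,0,0,0), [(0,0,0,3),(0,0,3,0),(0,3,0,0),(1,0,1,2),(2,1,0,0)], (12,-4,-4,0)),
   ((1,0,1,0), [(0,0,0,3),(0,0,3,0),(0,3,0,0),(1,1,0,2),(3,0,0,0)], (-18,6,6,0)),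
   ((0,0,0,2), [(0,0,3,0),(0,3,0,0),(1,0,0,3),(2,0,0,1),(3,0,0,0)], (216,-144,-36,0)),
   ((2,0,0,0), [(0,0,1,2),(0,0,3,0),(0,3,0,0),(1,0,0,3),(2,1,0,0)], (0,12,3,0)),
   ((2,0,0,0), [(0,0,0,4),(0,0,3,0),(0,3,0,0),(1,0,1,1),(2,1,0,0)], (0,-48,-12,0)),
   ((0,0,2,0), [(0,0,0,3),(0,1,0,2),(0,2,0,1),(2,0,1,0),(4,0,0,0)], (0,0,0,-12)),
   ((0,0,2,0), [(0,0,0,3),(0,0,1,2),(0,2,0,1),(2,1,0,0),(4,0,0,0)], (0,0,0,-12)),
   ((0,0,1,1), [(0,0,0,3),(0,0,1,2),(0,3,0,0),(2,0,1,0),(4,0,0,0)], (-36,0,0,-18)),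
   ((0,0,1,1), [(0,0,0,3),(0,2,0,1),(1,0,0,2),(2,0,1,0),(4,0,0,0)], (0,-12,0,6)),
   ((1,0,1,0), [(0,0,0,3),(0,0,1,2),(0,2,0,1),(1,1,1,0),(4,0,0,0)], (12,12,0,12)),
   ((1,0,1,0), [(0,0,0,3),(0,0,1,2),(0,2,0,1),(2,0,0,1),(4,0,0,0)], (0,0,0,12)),
   ((0,0,2,0), [(0,0,0,3),(0,2,0,1),(1,0,0,2),(2,0,1,0),(3,1,0,0)], (0,6,0,-3)),
   ((0,2,0,0), [(0,0,0,3),(0,0,1,2),(1,0,1,1),(2,0,0,1),(4,0,0,0)], (0,0,0,-12)),
   ((0,2,0,0), [(0,0,0,3),(0,0,2,1),(0,1,1,1),(1,1,1,0),(4,0,0,0)], (-12,-12,0,-12)),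
   ((0,2,0,0), [(0,0,0,3),(0,0,2,1),(0,1,0,2),(2,0,1,0),(4,0,0,0)], (0,0,0,-24)),
   ((0,2,0,0), [(0,0,0,3),(0,0,2,1),(0,2,0,1),(1,0,2,0),(4,0,0,0)], (-12,-12,0,-12)),
   ((0,0,0,2), [(0,0,0,3),(0,3,0,0),(1,0,1,1),(2,0,1,0),(3,0,1,0)], (-12,0,0,-6)),
   ((2,0,0,0), [(0,0,0,3),(0,0,1,2),(0,3,0,0),(1,0,1,1),(3,0,1,0)], (12,0,0,6)),
   ((0,0,2,0), [(0,0,0,3),(0,2,0,1),(1,0,0,2),(2,1,0,0),(3,0,1,0)], (0,6,0,-3)),
   ((0,1,0,1), [(0,0,0,3),(0,0,2,1),(1,1,0,1),(2,0,0,1),(4,0,0,0)], (0,0,0,6)),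
   ((2,0,0,0), [(0,0,0,3),(0,0,1,2),(1,0,0,2),(1,1,0,1),(4,0,0,0)], (0,-12,6,-12)),
   ((0,1,0,1), [(0,0,0,3),(0,0,1,2),(1,1,0,1),(2,0,1,0),(4,0,0,0)], (0,-6,0,-3)),
   ((1,1,0,0), [(0,0,0,3),(0,0,1,2),(0,1,0,2),(2,0,1,0),(4,0,0,0)], (0,24,-12,-72)),
   ((0,0,1,1), [(0,0,0,3),(0,3,0,0),(1,0,0,2),(2,0,1,0),(3,0,1,0)], (12,-12,0,-12)),
   ((0,1,0,1), [(0,0,0,3),(0,0,1,2),(1,1,1,0),(2,0,0,1),(4,0,0,0)], (0,6,0,3)),
   ((0,0,1,1), [(0,0,0,3),(0,1,1,1),(1,1,0,1),(2,0,0,1),(4,0,0,0)], (0,0,0,-3)),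
   ((0,1,0,1), [(0,0,0,3),(0,0,1,2),(1,0,1,1),(2,1,0,0),(4,0,0,0)], (0,6,3,3)),
   ((0,1,0,1), [(0,0,0,3),(0,1,0,2),(0,1,2,0),(2,0,1,0),(4,0,0,0)], (-12,0,0,-6)),
   ((2,0,0,0), [(0,0,0,3),(0,3,0,0),(1,0,0,2),(1,0,1,1),(2,0,2,0)], (6,-6,0,-6)),
   ((2,0,0,0), [(0,0,0,3),(0,3,0,0),(1,0,0,2),(1,0,2,1),(2,0,1,0)], (-6,6,0,6)),
   ((0,0,0,2), [(0,0,1,2),(0,3,0,0),(1,0,1,1),(2,0,0,1),(3,0,1,0)], (8,0,0,4)),
   ((0,1,0,1), [(0,0,0,3),(0,0,2,1),(0,1,0,2),(3,0,0,0),(4,0,0,0)], (0,12,-6,-18)),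
   ((0,1,0,1), [(0,0,0,3),(0,0,1,2),(2,0,0,1),(2,0,1,0),(3,1,0,0)], (0,8,0,4)),
   ((0,1,0,1), [(0,0,0,3),(0,0,1,2),(0,1,1,1),(3,0,0,0),(4,0,0,0)], (0,6,-3,-9)),
   ((0,0,0,2), [(0,0,0,3),(0,1,1,1),(2,0,0,1),(2,1,0,0),(3,0,1,0)], (0,4,0,0)),
   ((0,1,0,1), [(0,0,0,3),(0,0,1,2),(1,0,0,2),(3,0,0,0),(4,0,0,0)], (0,12,-6,18)),
   ((0,0,1,1), [(0,0,0,3),(0,0,1,2),(0,2,0,1),(3,0,0,0),(4,0,0,0)], (0,-12,6,18)),
   ((0,1,0,1), [(0,0,0,3),(0,1,2,0),(1,0,0,2),(2,0,1,0),(3,1,0,0)], (4,-4,0,-4)),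
   ((0,2,0,0), [(0,0,0,3),(0,0,3,0),(1,0,0,2),(2,0,1,0),(2,2,0,0)], (-12,12,0,12)),
   ((2,0,0,0), [(0,0,0,3),(0,0,1,2),(1,0,0,2),(2,0,1,0),(2,2,0,0)], (0,8,0,4)),
   ((0,2,0,0), [(0,0,0,3),(0,0,2,1),(2,0,0,1),(2,0,1,1),(2,1,0,0)], (0,8,0,0)),
   ((0,0,0,2), [(0,0,1,2),(0,3,0,0),(1,0,1,1),(2,0,1,1),(3,0,0,0)], (12,0,0,6)),
   ((0,0,0,2), [(0,0,0,3),(0,0,2,1),(1,1,0,1),(3,0,0,0),(3,1,0,0)], (0,4,-2,0)),
   ((0,0,1,1), [(0,0,0,3),(0,0,1,2),(0,3,0,0),(3,0,0,0),(3,0,1,0)], (-36,-12,6,0)),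
   ((0,1,0,1), [(0,0,0,3),(0,0,1,2),(1,0,1,1),(3,0,0,0),(3,1,0,0)], (0,4,4,-6)),
   ((2,0,0,0), [(0,0,0,3),(1,0,0,2),(1,0,1,1),(1,2,0,1),(2,0,1,0)], (0,4,0,2)),
   ((2,0,0,0), [(0,0,1,2),(0,0,1,3),(0,3,0,0),(1,0,1,1),(3,0,0,0)], (-36,0,0,-18)),
   ((0,0,0,2), [(0,0,0,3),(0,3,0,0),(1,0,1,1),(2,0,2,0),(3,0,0,0)], (-9,-15,3,-9)),
   ((0,0,0,2), [(0,0,0,3),(0,0,2,1),(2,1,0,0),(2,1,0,1),(3,0,0,0)], (0,16,-2,0)),
   ((0,0,0,2), [(0,0,0,3),(0,0,1,2),(2,0,1,0),(2,2,0,0),(3,0,0,0)], (0,16,4,0)),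
   ((0,1,0,1), [(0,0,0,3),(0,0,3,0),(1,1,0,2),(2,1,0,0),(3,0,0,0)], (36,12,-6,0)),
   ((0,0,0,2), [(0,0,0,3),(0,3,0,0),(1,0,2,1),(2,0,1,0),(3,0,0,0)], (36,12,-6,0)),
   ((0,0,0,2), [(0,0,0,3),(1,0,1,1),(1,2,0,1),(2,0,1,0),(3,0,0,0)], (0,4,4,-6))]"

definition tests5 :: "expo list list" where
  "tests5 = [
   [(0,0,0,3),(0,0,3,0),(0,3,0,0),(1,0,0,2),(2,0,0,1),(3,0,0,0)],
   [(0,0,0,3),(0,0,1,2),(0,0,3,0),(0,3,0,0),(2,1,0,0),(3,0,0,0)],
   [(0,0,0,3),(0,0,3,0),(0,3,0,0),(1,0,0,2),(2,0,1,0),(2,1,0,0)],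
   [(0,0,0,3),(0,0,1,2),(0,3,0,0),(1,0,1,1),(2,0,1,0),(3,0,0,0)]]"

text \<open>The four rows are 540, 36, 24 and 36 times integral vectors whose determinant is 1890,
  so that only the zero parameters solve the system.\<close>

lemma certificate5:
  "certificate 5 6 [(4,3,3,3)] base5 steps5 tests5 =
    Some (map (\<lambda>v. (v, [])) [(3240,-2160,-540,0), (-324,-144,72,0), (432,-312,-168,72), (540,36,-72,252)])"
  by code_simp

definition base6 :: table where
  "base6 = [
   ([(0,0,0,3),(0,0,1,2),(0,1,2,0),(1,1,0,1),(2,1,0,0),(3,0,0,0)], (0,0,0,0)),
   ([(0,0,0,3),(0,0,3,0),(0,2,0,1),(0,3,0,0),(1,0,2,0),(3,0,0,0)], (0,0,0,0)),
   ([(0,0,0,3),(0,0,2,1),(0,1,0,2),(1,1,1,0),(2,1,0,0),(3,0,0,0)], (0,0,0,0)),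
   ([(0,0,0,3),(0,1,1,1),(0,1,2,0),(1,0,0,2),(2,1,0,0),(3,0,0,0)], (0,0,0,0))]"

definition steps6 :: "(expo \<times> expo list) list" where
  "steps6 = [
   ((0,0,0,2), [(0,0,1,2),(0,1,1,1),(0,2,1,0),(1,1,1,0),(2,0,0,1),(3,0,0,0)]),
   ((0,0,2,0), [(0,0,0,3),(0,3,0,0),(1,0,0,2),(1,0,1,1),(2,0,0,1),(3,0,0,0)]),
   ((0,2,0,0), [(0,0,3,0),(0,1,1,1),(0,1,2,0),(0,2,0,1),(1,0,0,2),(3,0,0,0)]),
   ((0,2,0,0), [(0,0,0,3),(0,0,3,0),(0,1,2,0),(0,2,1,0),(1,1,0,1),(3,0,0,0)]),
   ((0,0,2,0), [(0,0,0,3),(0,0,1,2),(0,2,1,0),(0,3,0,0),(2,0,1,0),(3,0,0,0)]),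
   ((0,2,0,0), [(0,0,1,2),(0,1,0,2),(1,0,0,2),(1,0,2,0),(1,1,1,0),(3,0,0,0)]),
   ((2,0,0,0), [(0,0,0,3),(0,1,2,0),(0,2,1,0),(1,0,0,2),(1,1,1,0),(2,0,0,1)]),
   ((0,2,0,0), [(0,0,0,3),(0,0,2,1),(1,0,1,1),(1,1,0,1),(2,0,0,1),(3,0,0,0)]),
   ((0,0,2,0), [(0,0,0,3),(1,0,0,2),(1,0,1,1),(1,1,0,1),(1,2,0,0),(3,0,0,0)]),
   ((0,0,0,2), [(0,0,2,1),(0,1,0,2),(0,3,0,0),(1,0,2,0),(2,0,0,1),(3,0,0,0)]),
   ((2,0,0,0), [(0,0,0,3),(0,1,1,1),(0,1,2,0),(1,0,0,2),(1,1,1,0),(2,1,0,0)]),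
   ((0,0,2,0), [(0,0,0,3),(0,1,1,1),(0,2,0,1),(2,0,0,1),(2,0,1,0),(2,1,0,0)]),
   ((0,0,2,0), [(0,0,0,3),(0,0,2,1),(0,2,1,0),(0,3,0,0),(2,0,1,0),(2,1,0,0)]),
   ((0,2,0,0), [(0,0,1,2),(0,1,0,2),(1,0,0,2),(1,0,2,0),(2,0,0,1),(3,0,0,0)]),
   ((0,0,0,2), [(0,0,0,3),(0,1,2,0),(1,0,0,2),(2,0,0,1),(2,1,0,0),(3,0,0,0)]),
   ((0,2,0,0), [(0,0,0,3),(0,0,3,0),(1,0,0,2),(1,1,0,1),(2,0,1,0),(2,1,0,0)]),
   ((0,0,0,2), [(0,0,2,1),(0,1,2,0),(0,3,0,0),(1,0,0,2),(2,0,0,1),(3,0,0,0)]),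
   ((0,2,0,0), [(0,0,1,2),(0,0,3,0),(0,1,0,2),(1,0,0,2),(2,1,0,0),(3,0,0,0)]),
   ((0,0,2,0), [(0,0,0,3),(0,2,1,0),(0,3,0,0),(1,0,0,2),(1,0,2,0),(3,0,0,0)]),
   ((2,0,0,0), [(0,0,0,3),(0,0,3,0),(0,3,0,0),(1,0,0,2),(1,1,1,0),(2,0,0,1)]),
   ((0,0,2,0), [(0,0,1,2),(0,1,0,2),(1,0,1,1),(1,1,0,1),(1,2,0,0),(3,0,0,0)]),
   ((0,2,0,0), [(0,0,3,0),(0,1,0,2),(1,0,0,2),(1,0,1,1),(1,1,0,1),(3,0,0,0)]),
   ((0,0,2,0), [(0,0,0,3),(0,1,2,0),(0,2,1,0),(0,3,0,0),(1,0,1,1),(3,0,0,0)]),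
   ((2,0,0,0), [(0,0,0,3),(0,0,3,0),(0,2,0,1),(1,0,0,2),(1,2,0,0),(2,0,1,0)]),
   ((0,0,0,2), [(0,1,0,2),(0,1,1,1),(0,1,2,0),(1,1,1,0),(2,0,0,1),(3,0,0,0)]),
   ((0,0,2,0), [(0,0,1,2),(0,1,0,2),(0,2,1,0),(0,3,0,0),(1,0,2,0),(3,0,0,0)]),
   ((0,0,0,2), [(0,0,2,1),(0,0,3,0),(0,2,0,1),(0,3,0,0),(2,0,0,1),(3,0,0,0)]),
   ((0,0,0,2), [(0,0,3,0),(0,2,0,1),(0,2,1,0),(1,0,0,2),(2,0,0,1),(3,0,0,0)]),
   ((0,2,0,0), [(0,0,1,2),(0,0,3,0),(0,1,0,2),(0,1,2,0),(1,2,0,0),(3,0,0,0)]),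
   ((0,2,0,0), [(0,0,0,3),(0,0,3,0),(1,0,1,1),(1,1,0,1),(2,0,0,1),(2,1,0,0)]),
   ((0,2,0,0), [(0,0,0,3),(0,0,3,0),(0,1,2,0),(1,0,0,2),(1,2,0,0),(3,0,0,0)]),
   ((0,0,0,2), [(0,1,1,1),(0,1,2,0),(0,2,1,0),(1,0,0,2),(2,0,0,1),(3,0,0,0)]),
   ((0,2,0,0), [(0,0,0,3),(0,0,3,0),(0,1,0,2),(0,1,2,0),(2,1,0,0),(3,0,0,0)]),
   ((0,0,2,0), [(0,0,2,1),(0,1,1,1),(0,2,1,0),(0,3,0,0),(1,0,0,2),(3,0,0,0)]),
   ((0,0,0,2), [(0,0,3,0),(0,1,1,1),(0,3,0,0),(1,0,0,2),(2,0,0,1),(3,0,0,0)]),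
   ((0,0,0,2), [(0,0,0,3),(0,0,3,0),(0,2,0,1),(1,2,0,0),(2,0,1,0),(3,0,0,0)]),
   ((2,0,0,0), [(0,0,0,3),(0,0,1,2),(0,1,1,1),(0,2,1,0),(1,1,1,0),(3,0,0,0)]),
   ((2,0,0,0), [(0,0,0,3),(0,0,2,1),(0,1,0,2),(0,3,0,0),(1,0,2,0),(3,0,0,0)]),
   ((0,0,0,2), [(0,0,0,3),(0,1,1,1),(0,1,2,0),(1,1,1,0),(2,1,0,0),(3,0,0,0)]),
   ((0,2,0,0), [(0,0,1,2),(0,1,0,2),(0,1,2,0),(0,2,1,0),(1,0,2,0),(3,0,0,0)]),
   ((0,2,0,0), [(0,0,1,2),(0,0,3,0),(0,1,0,2),(0,3,0,0),(1,0,2,0),(3,0,0,0)]),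
   ((0,2,0,0), [(0,0,0,3),(0,0,1,2),(0,0,3,0),(1,1,0,1),(2,1,0,0),(3,0,0,0)]),
   ((2,0,0,0), [(0,0,0,3),(0,0,1,2),(0,1,0,2),(0,1,2,0),(2,1,0,0),(3,0,0,0)]),
   ((0,2,0,0), [(0,0,0,3),(0,0,3,0),(0,1,0,2),(1,1,0,1),(2,0,1,0),(3,0,0,0)]),
   ((0,2,0,0), [(0,0,0,3),(0,0,1,2),(0,1,2,0),(1,0,1,1),(2,1,0,0),(3,0,0,0)]),
   ((0,0,2,0), [(0,0,0,3),(0,0,1,2),(0,3,0,0),(1,0,1,1),(2,1,0,0),(3,0,0,0)]),
   ((0,0,2,0), [(0,0,0,3),(0,0,1,2),(0,2,1,0),(1,1,0,1),(2,1,0,0),(3,0,0,0)]),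
   ((0,2,0,0), [(0,0,0,3),(0,1,0,2),(0,1,2,0),(1,0,1,1),(2,0,1,0),(3,0,0,0)]),
   ((0,0,1,1), [(0,0,0,3),(0,0,3,0),(0,2,0,1),(0,3,0,0),(2,0,1,0),(3,0,0,0)]),
   ((2,0,0,0), [(0,0,0,3),(0,0,2,1),(0,0,3,0),(0,2,0,1),(0,3,0,0),(3,0,0,0)]),
   ((1,1,0,0), [(0,0,0,3),(0,0,3,0),(0,1,0,2),(0,2,0,1),(2,0,1,0),(3,0,0,0)]),
   ((1,0,1,0), [(0,0,0,3),(0,0,1,2),(0,0,3,0),(0,3,0,0),(1,2,0,0),(3,0,0,0)]),
   ((0,2,0,0), [(0,0,0,3),(0,0,3,0),(0,1,0,2),(0,2,1,0),(2,0,1,0),(3,0,0,0)]),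
   ((1,0,1,0), [(0,0,0,3),(0,0,1,2),(0,0,2,1),(0,3,0,0),(2,1,0,0),(3,0,0,0)]),
   ((0,2,0,0), [(0,0,0,3),(0,0,1,2),(0,0,3,0),(0,2,1,0),(2,1,0,0),(3,0,0,0)]),
   ((0,2,0,0), [(0,0,0,3),(0,0,2,1),(0,1,0,2),(1,0,2,0),(2,1,0,0),(3,0,0,0)]),
   ((1,1,0,0), [(0,0,0,3),(0,0,2,1),(0,1,0,2),(0,1,2,0),(2,1,0,0),(3,0,0,0)]),
   ((0,2,0,0), [(0,0,0,3),(0,0,1,2),(0,0,2,1),(1,1,1,0),(2,1,0,0),(3,0,0,0)]),
   ((0,0,2,0), [(0,0,0,3),(0,0,2,1),(0,1,0,2),(1,2,0,0),(2,1,0,0),(3,0,0,0)]),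
   ((0,1,0,1), [(0,0,0,3),(0,0,3,0),(0,1,0,2),(1,1,1,0),(2,1,0,0),(3,0,0,0)]),
   ((0,2,0,0), [(0,0,0,3),(0,0,3,0),(0,1,0,2),(1,0,2,0),(1,2,0,0),(3,0,0,0)]),
   ((0,2,0,0), [(0,0,0,3),(0,0,2,1),(0,1,1,1),(0,1,2,0),(2,1,0,0),(3,0,0,0)]),
   ((0,2,0,0), [(0,0,0,3),(0,0,1,2),(0,0,3,0),(1,1,1,0),(1,2,0,0),(3,0,0,0)]),
   ((0,2,0,0), [(0,0,0,3),(0,0,2,1),(0,0,3,0),(0,2,0,1),(2,1,0,0),(3,0,0,0)]),
   ((0,2,0,0), [(0,0,0,3),(0,0,1,2),(0,0,2,1),(1,2,0,0),(2,0,1,0),(3,0,0,0)]),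
   ((0,0,2,0), [(0,0,0,3),(0,1,0,2),(0,2,0,1),(1,0,2,0),(2,1,0,0),(3,0,0,0)]),
   ((0,2,0,0), [(0,0,0,3),(0,0,2,1),(0,1,0,2),(1,1,1,0),(2,0,1,0),(3,0,0,0)]),
   ((1,1,0,0), [(0,0,0,3),(0,0,2,1),(0,1,0,2),(0,2,1,0),(2,0,1,0),(3,0,0,0)]),
   ((0,0,1,1), [(0,0,0,3),(0,0,2,1),(0,1,2,0),(0,3,0,0),(2,1,0,0),(3,0,0,0)]),
   ((1,0,1,0), [(0,0,0,3),(0,0,3,0),(0,1,0,2),(0,3,0,0),(1,1,1,0),(3,0,0,0)]),
   ((1,0,1,0), [(0,0,0,3),(0,0,3,0),(0,1,0,2),(0,2,1,0),(1,2,0,0),(3,0,0,0)]),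
   ((0,0,2,0), [(0,0,0,3),(0,0,1,2),(0,2,1,0),(1,1,1,0),(1,2,0,0),(3,0,0,0)]),
   ((0,0,2,0), [(0,0,0,3),(0,0,2,1),(0,2,1,0),(0,3,0,0),(1,1,1,0),(3,0,0,0)]),
   ((0,0,2,0), [(0,0,0,3),(0,0,1,2),(0,2,0,1),(1,2,0,0),(2,0,1,0),(3,0,0,0)]),
   ((0,0,2,0), [(0,0,0,3),(0,1,1,1),(0,2,0,1),(0,2,1,0),(2,0,1,0),(3,0,0,0)]),
   ((0,0,2,0), [(0,0,0,3),(0,0,2,1),(0,2,0,1),(0,3,0,0),(2,0,1,0),(3,0,0,0)]),
   ((0,2,0,0), [(0,0,0,3),(0,1,0,2),(0,1,2,0),(1,0,2,0),(1,1,1,0),(3,0,0,0)]),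
   ((0,2,0,0), [(0,0,0,3),(0,0,3,0),(0,1,1,1),(0,1,2,0),(1,2,0,0),(3,0,0,0)]),
   ((0,0,2,0), [(0,0,0,3),(0,0,3,0),(0,2,0,1),(0,3,0,0),(1,1,1,0),(3,0,0,0)]),
   ((0,0,2,0), [(0,0,0,3),(0,0,2,1),(0,1,2,0),(0,3,0,0),(1,2,0,0),(3,0,0,0)]),
   ((2,0,0,0), [(0,0,0,3),(0,0,2,1),(0,1,1,1),(0,1,2,0),(0,3,0,0),(3,0,0,0)]),
   ((1,0,1,0), [(0,0,0,3),(0,0,1,2),(0,1,2,0),(0,3,0,0),(1,1,1,0),(3,0,0,0)]),
   ((1,1,0,0), [(0,0,0,3),(0,0,1,2),(0,1,2,0),(0,2,1,0),(1,1,1,0),(3,0,0,0)]),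
   ((0,2,0,0), [(0,0,0,3),(0,0,3,0),(0,2,0,1),(0,2,1,0),(1,0,2,0),(3,0,0,0)]),
   ((0,0,0,2), [(0,0,0,3),(0,1,1,1),(0,1,2,0),(2,0,0,1),(2,1,0,0),(3,0,0,0)]),
   ((0,2,0,0), [(0,0,0,3),(0,0,3,0),(0,1,1,1),(1,0,0,2),(2,1,0,0),(3,0,0,0)]),
   ((0,2,0,0), [(0,0,0,3),(0,0,2,1),(0,1,2,0),(1,0,0,2),(2,1,0,0),(3,0,0,0)]),
   ((0,1,0,1), [(0,0,0,3),(0,1,1,1),(0,1,2,0),(1,0,1,1),(2,1,0,0),(3,0,0,0)]),
   ((1,0,1,0), [(0,0,0,3),(0,1,0,2),(0,1,2,0),(1,0,0,2),(2,1,0,0),(3,0,0,0)]),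
   ((1,0,1,0), [(0,0,0,3),(0,1,0,2),(0,1,1,1),(0,1,2,0),(2,1,0,0),(3,0,0,0)]),
   ((1,1,0,0), [(0,0,0,3),(0,0,1,2),(0,1,2,0),(1,0,0,2),(2,1,0,0),(3,0,0,0)]),
   ((1,1,0,0), [(0,0,0,3),(0,1,1,1),(0,1,2,0),(1,0,0,2),(1,1,1,0),(3,0,0,0)]),
   ((0,2,0,0), [(0,0,0,3),(0,0,3,0),(0,2,0,1),(1,0,0,2),(2,0,1,0),(3,0,0,0)]),
   ((0,2,0,0), [(0,0,0,3),(0,1,0,2),(1,0,0,2),(1,0,2,0),(2,0,1,0),(3,0,0,0)]),
   ((0,2,0,0), [(0,0,0,3),(0,0,3,0),(1,0,0,2),(1,1,0,1),(1,1,1,0),(3,0,0,0)]),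
   ((0,0,2,0), [(0,0,0,3),(0,0,1,2),(1,0,0,2),(1,2,0,0),(2,1,0,0),(3,0,0,0)]),
   ((0,2,0,0), [(0,0,1,2),(0,0,2,1),(0,1,0,2),(0,1,2,0),(2,1,0,0),(3,0,0,0)]),
   ((2,0,0,0), [(0,0,0,3),(0,0,3,0),(0,2,0,1),(1,0,0,2),(2,0,0,1),(2,1,0,0)]),
   ((0,2,0,0), [(0,0,0,3),(0,0,2,1),(0,1,2,0),(1,1,0,1),(2,0,0,1),(3,0,0,0)]),
   ((0,0,2,0), [(0,0,0,3),(0,0,2,1),(0,3,0,0),(1,0,0,2),(2,1,0,0),(3,0,0,0)]),
   ((0,0,0,2), [(0,0,0,3),(0,0,3,0),(0,2,0,1),(2,0,0,1),(2,1,0,0),(3,0,0,0)]),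
   ((2,0,0,0), [(0,0,0,3),(0,1,0,2),(1,0,0,2),(1,0,2,0),(1,1,0,1),(3,0,0,0)]),
   ((0,2,0,0), [(0,0,0,3),(0,1,2,0),(1,0,0,2),(1,0,2,0),(1,1,0,1),(3,0,0,0)]),
   ((2,0,0,0), [(0,0,0,3),(0,1,0,2),(0,1,2,0),(1,0,0,2),(1,1,1,0),(3,0,0,0)]),
   ((0,2,0,0), [(0,0,0,3),(0,0,3,0),(0,1,1,1),(1,0,1,1),(1,2,0,0),(3,0,0,0)]),
   ((0,0,2,0), [(0,0,0,3),(0,1,1,1),(0,2,1,0),(1,0,0,2),(2,1,0,0),(3,0,0,0)]),
   ((0,0,2,0), [(0,0,0,3),(0,1,1,1),(0,2,1,0),(1,0,1,1),(1,2,0,0),(3,0,0,0)]),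
   ((2,0,0,0), [(0,0,0,3),(0,0,1,2),(1,0,0,2),(1,1,0,1),(1,1,1,0),(3,0,0,0)]),
   ((0,0,2,0), [(0,0,0,3),(0,1,2,0),(0,2,0,1),(1,0,1,1),(1,2,0,0),(3,0,0,0)]),
   ((0,1,0,1), [(0,0,1,2),(0,1,0,2),(1,0,0,2),(1,0,2,0),(2,1,0,0),(3,0,0,0)]),
   ((1,0,1,0), [(0,0,0,3),(0,0,1,2),(0,1,0,2),(1,1,1,0),(2,1,0,0),(3,0,0,0)]),
   ((0,1,0,1), [(0,0,0,3),(0,1,0,2),(1,0,1,1),(1,0,2,0),(2,1,0,0),(3,0,0,0)]),
   ((0,1,0,1), [(0,0,0,3),(0,0,3,0),(0,2,0,1),(1,0,1,1),(2,1,0,0),(3,0,0,0)]),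
   ((1,1,0,0), [(0,0,0,3),(0,0,1,2),(0,1,2,0),(1,1,0,1),(1,1,1,0),(3,0,0,0)]),
   ((1,1,0,0), [(0,0,0,3),(0,1,2,0),(1,0,0,2),(1,0,1,1),(1,1,0,1),(3,0,0,0)]),
   ((0,1,0,1), [(0,0,0,3),(0,1,2,0),(1,0,1,1),(1,1,0,1),(2,0,0,1),(3,0,0,0)]),
   ((0,0,1,1), [(0,0,0,3),(0,1,2,0),(1,0,0,2),(1,1,0,1),(2,1,0,0),(3,0,0,0)]),
   ((0,0,2,0), [(0,0,0,3),(0,1,1,1),(0,2,0,1),(1,0,1,1),(2,1,0,0),(3,0,0,0)]),
   ((0,2,0,0), [(0,0,0,3),(0,0,2,1),(0,1,1,1),(1,0,1,1),(2,1,0,0),(3,0,0,0)]),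
   ((2,0,0,0), [(0,0,0,3),(0,0,1,2),(0,1,2,0),(1,0,0,2),(1,2,0,0),(3,0,0,0)]),
   ((0,2,0,0), [(0,0,0,3),(0,0,2,1),(1,0,0,2),(1,0,1,1),(2,1,0,0),(3,0,0,0)]),
   ((0,0,2,0), [(0,0,0,3),(0,0,2,1),(0,3,0,0),(1,1,0,1),(2,0,0,1),(3,0,0,0)]),
   ((0,2,0,0), [(0,0,0,3),(0,0,3,0),(0,1,0,2),(1,1,1,0),(2,0,0,1),(3,0,0,0)]),
   ((2,0,0,0), [(0,0,0,3),(0,1,0,2),(0,2,1,0),(1,0,0,2),(1,0,2,0),(3,0,0,0)]),
   ((0,0,2,0), [(0,0,0,3),(0,0,1,2),(1,1,0,1),(1,2,0,0),(2,0,0,1),(3,0,0,0)]),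
   ((0,0,2,0), [(0,0,0,3),(0,3,0,0),(1,0,0,2),(1,0,2,0),(1,1,0,1),(3,0,0,0)]),
   ((0,0,2,0), [(0,0,0,3),(0,1,0,2),(1,0,1,1),(1,1,1,0),(1,2,0,0),(3,0,0,0)]),
   ((0,0,2,0), [(0,0,0,3),(0,0,2,1),(0,3,0,0),(1,0,1,1),(1,2,0,0),(3,0,0,0)]),
   ((0,0,2,0), [(0,0,0,3),(0,2,0,1),(0,2,1,0),(1,0,1,1),(2,0,0,1),(3,0,0,0)]),
   ((0,2,0,0), [(0,0,0,3),(0,1,0,2),(1,0,1,1),(1,0,2,0),(1,1,1,0),(3,0,0,0)]),
   ((0,0,0,2), [(0,0,0,3),(0,0,2,1),(1,1,0,1),(2,0,0,1),(2,1,0,0),(3,0,0,0)]),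
   ((0,2,0,0), [(0,0,0,3),(0,0,2,1),(0,0,3,0),(1,1,0,1),(1,2,0,0),(3,0,0,0)]),
   ((0,0,0,2), [(0,1,2,0),(0,2,0,1),(1,0,0,2),(1,0,1,1),(2,0,0,1),(3,0,0,0)]),
   ((0,2,0,0), [(0,0,0,3),(0,1,0,2),(1,0,1,1),(1,0,2,0),(2,0,0,1),(3,0,0,0)]),
   ((0,0,2,0), [(0,0,0,3),(0,2,1,0),(1,0,0,2),(1,0,1,1),(1,2,0,0),(3,0,0,0)]),
   ((0,2,0,0), [(0,0,0,3),(0,0,2,1),(1,0,0,2),(1,1,0,1),(2,0,1,0),(3,0,0,0)]),
   ((0,2,0,0), [(0,0,0,3),(0,0,3,0),(0,1,1,1),(1,1,0,1),(1,1,1,0),(3,0,0,0)]),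
   ((0,0,0,2), [(0,0,0,3),(0,0,1,2),(1,1,1,0),(2,0,0,1),(2,1,0,0),(3,0,0,0)]),
   ((0,0,2,0), [(0,0,1,2),(0,1,0,2),(0,1,1,1),(0,2,1,0),(2,1,0,0),(3,0,0,0)]),
   ((2,0,0,0), [(0,0,1,2),(0,1,0,2),(0,1,1,1),(0,1,2,0),(1,1,0,1),(3,0,0,0)]),
   ((0,0,1,1), [(0,0,0,3),(0,1,1,1),(0,2,1,0),(1,1,0,1),(2,0,1,0),(3,0,0,0)]),
   ((0,0,2,0), [(0,0,0,3),(0,2,0,1),(0,2,1,0),(1,0,1,1),(1,1,1,0),(3,0,0,0)]),
   ((2,0,0,0), [(0,0,0,3),(0,0,1,2),(0,1,0,2),(1,0,1,1),(2,1,0,0),(3,0,0,0)]),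
   ((2,0,0,0), [(0,0,0,3),(0,0,1,2),(0,1,0,2),(1,0,2,0),(1,2,0,0),(3,0,0,0)]),
   ((0,0,0,2), [(0,0,0,3),(0,0,2,1),(0,2,0,1),(2,0,1,0),(2,1,0,0),(3,0,0,0)]),
   ((1,1,0,0), [(0,0,0,3),(0,0,2,1),(0,1,0,2),(1,0,2,0),(1,2,0,0),(3,0,0,0)]),
   ((0,0,1,1), [(0,0,0,3),(0,1,0,2),(1,0,0,2),(2,0,1,0),(2,1,0,0),(3,0,0,0)]),
   ((0,1,0,1), [(0,0,0,3),(0,0,1,2),(1,0,0,2),(2,0,1,0),(2,1,0,0),(3,0,0,0)]),
   ((1,0,1,0), [(0,0,0,3),(0,0,1,2),(0,2,1,0),(1,1,0,1),(2,0,0,1),(3,0,0,0)]),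
   ((0,0,1,1), [(0,0,0,3),(0,1,0,2),(0,1,1,1),(2,0,1,0),(2,1,0,0),(3,0,0,0)]),
   ((1,0,1,0), [(0,0,0,3),(0,1,0,2),(1,0,0,2),(1,0,2,0),(1,2,0,0),(3,0,0,0)]),
   ((0,0,1,1), [(0,0,0,3),(0,1,0,2),(1,0,1,1),(1,2,0,0),(2,0,1,0),(3,0,0,0)]),
   ((0,0,1,1), [(0,0,0,3),(0,0,1,2),(0,2,0,1),(2,0,1,0),(2,1,0,0),(3,0,0,0)]),
   ((0,1,0,1), [(0,0,0,3),(0,0,2,1),(1,0,0,2),(1,1,1,0),(2,1,0,0),(3,0,0,0)]),
   ((1,0,1,0), [(0,0,0,3),(0,0,3,0),(0,1,1,1),(0,2,0,1),(1,2,0,0),(3,0,0,0)]),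
   ((0,0,2,0), [(0,0,0,3),(0,2,0,1),(1,0,0,2),(1,0,2,0),(1,2,0,0),(3,0,0,0)]),
   ((0,0,0,2), [(0,0,0,3),(0,2,0,1),(1,0,1,1),(2,0,0,1),(2,0,1,0),(3,0,0,0)]),
   ((0,0,0,2), [(0,0,0,3),(1,0,0,2),(1,0,1,1),(2,0,0,1),(2,1,0,0),(3,0,0,0)]),
   ((0,0,2,0), [(0,0,0,3),(0,1,1,1),(0,2,0,1),(1,0,2,0),(1,2,0,0),(3,0,0,0)]),
   ((0,2,0,0), [(0,0,3,0),(0,1,0,2),(0,1,1,1),(1,0,1,1),(1,1,0,1),(3,0,0,0)]),
   ((0,2,0,0), [(0,0,2,1),(0,1,0,2),(0,1,2,0),(1,0,1,1),(1,1,0,1),(3,0,0,0)]),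
   ((0,0,1,1), [(0,0,1,2),(0,1,1,1),(0,2,0,1),(0,2,1,0),(2,0,1,0),(3,0,0,0)]),
   ((0,0,2,0), [(0,0,0,3),(0,1,0,2),(0,3,0,0),(1,0,2,0),(2,0,0,1),(3,0,0,0)]),
   ((0,0,2,0), [(0,0,0,3),(0,0,2,1),(0,2,0,1),(1,1,1,0),(1,2,0,0),(3,0,0,0)]),
   ((0,0,2,0), [(0,0,0,3),(0,2,0,1),(0,3,0,0),(1,0,1,1),(1,0,2,0),(3,0,0,0)]),
   ((0,2,0,0), [(0,0,0,3),(0,0,3,0),(0,2,0,1),(1,0,2,0),(1,1,0,1),(3,0,0,0)]),
   ((0,2,0,0), [(0,0,0,3),(0,0,2,1),(0,1,2,0),(1,1,0,1),(1,1,1,0),(3,0,0,0)]),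
   ((2,0,0,0), [(0,0,0,3),(0,0,2,1),(0,1,1,1),(1,0,0,2),(1,2,0,0),(3,0,0,0)]),
   ((1,1,0,0), [(0,0,0,3),(0,1,0,2),(1,0,0,2),(1,0,2,0),(2,0,0,1),(3,0,0,0)]),
   ((1,0,1,0), [(0,0,0,3),(0,0,3,0),(0,2,0,1),(0,2,1,0),(1,1,0,1),(3,0,0,0)]),
   ((0,0,1,1), [(0,0,0,3),(0,0,2,1),(0,2,0,1),(2,0,0,1),(2,1,0,0),(3,0,0,0)]),
   ((1,0,1,0), [(0,0,0,3),(0,0,1,2),(1,0,0,2),(1,2,0,0),(2,0,0,1),(3,0,0,0)]),
   ((0,0,1,1), [(0,0,0,3),(0,1,1,1),(0,2,0,1),(2,0,0,1),(2,0,1,0),(3,0,0,0)]),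
   ((1,1,0,0), [(0,0,0,3),(0,0,1,2),(1,0,0,2),(1,1,1,0),(2,0,0,1),(3,0,0,0)]),
   ((0,1,0,1), [(0,0,0,3),(0,0,2,1),(1,0,1,1),(1,1,0,1),(2,1,0,0),(3,0,0,0)]),
   ((1,1,0,0), [(0,0,0,3),(0,1,0,2),(1,0,1,1),(1,0,2,0),(1,1,0,1),(3,0,0,0)]),
   ((1,1,0,0), [(0,0,0,3),(0,0,1,2),(1,0,1,1),(1,1,0,1),(1,1,1,0),(3,0,0,0)]),
   ((0,1,0,1), [(0,0,0,3),(0,0,3,0),(1,0,0,2),(1,2,0,0),(2,0,0,1),(3,0,0,0)]),
   ((1,1,0,0), [(0,0,1,2),(0,0,3,0),(0,1,1,1),(0,2,0,1),(0,2,1,0),(3,0,0,0)]),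
   ((1,1,0,0), [(0,0,0,3),(0,0,2,1),(0,2,1,0),(1,0,1,1),(1,1,0,1),(3,0,0,0)]),
   ((1,0,1,0), [(0,0,0,3),(0,1,2,0),(0,2,0,1),(1,0,0,2),(2,0,0,1),(3,0,0,0)]),
   ((1,1,0,0), [(0,0,0,3),(0,0,3,0),(0,2,0,1),(1,0,1,1),(1,1,0,1),(3,0,0,0)]),
   ((1,0,1,0), [(0,0,0,3),(0,0,3,0),(0,1,1,1),(0,2,1,0),(0,3,0,0),(3,0,0,0)])]"

lemma certificate6: "certificate 6 6 [(3,3,4,3)] base6 (zero_values steps6) [] = Some []"
  by code_simp

section \<open>Invariants from graphs\<close>

text \<open>Both new entries are read from the original list, so for a loop the second update would
  overwrite the first; \<open>edges_in\<close> excludes loops.\<close>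

definition place :: "(poly4 \<Rightarrow> real) list \<Rightarrow> nat \<Rightarrow> 4 \<Rightarrow> nat \<Rightarrow> 4 \<Rightarrow> (poly4 \<Rightarrow> real) list" where
  "place zs i a j b = zs[i := zs ! i \<circ> pderiv4 a, j := zs ! j \<circ> pderiv4 b]"

text \<open>The vertices carry functionals on polynomials; an edge \<open>(i, j)\<close> applies the Poisson bivector to
  the functionals at \<open>i\<close> and \<open>j\<close>.\<close>

fun graph :: "(nat \<times> nat) list \<Rightarrow> (poly4 \<Rightarrow> real) list \<Rightarrow> form" where
  "graph [] zs = wedge_list (map (\<lambda>z f. z (poly_of f)) zs)"
| "graph ((i, j) # E) zs = graph E (place zs i 1 j 4) + graph E (place zs i 2 j 3)
     - graph E (place zs i 3 j 2) - graph E (place zs i 4 j 1)"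

definition edges_in :: "nat \<Rightarrow> (nat \<times> nat) list \<Rightarrow> bool" where
  "edges_in n E \<longleftrightarrow> (\<forall>(i, j)\<in>set E. i < n \<and> j < n \<and> i \<noteq> j)"

lemma edges_in_Cons: "edges_in n ((i, j) # E) \<longleftrightarrow> i < n \<and> j < n \<and> i \<noteq> j \<and> edges_in n E"
  by (auto simp: edges_in_def)

lemma length_place [simp]: "length (place zs i a j b) = length zs"
  by (simp add: place_def)

text \<open>Starting from zeros, this computes the valences of the vertices, which are the degrees
  of the polynomials that the form sees.\<close>

fun add_degrees :: "(nat \<times> nat) list \<Rightarrow> nat list \<Rightarrow> nat list" where
  "add_degrees [] ls = ls"
| "add_degrees ((i, j) # E) ls = add_degrees E (ls[i := Suc (ls ! i), j := Suc (ls ! j)])"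

text \<open>The functionals act on all of \<open>poly4\<close> rather than on \<open>ham\<close>,
  because derivatives lead out of \<open>ham\<close>.\<close>

definition functional :: "nat \<Rightarrow> (poly4 \<Rightarrow> real) \<Rightarrow> bool" where
  "functional l z \<longleftrightarrow> (\<forall>p q. z (p + q) = z p + z q) \<and> (\<forall>c p. z (const4 c * p) = c * z p) \<and>
     (\<forall>k p. k \<noteq> l \<longrightarrow> homogeneous k p \<longrightarrow> z p = 0)"

lemma functional_zero: "functional l z \<Longrightarrow> homogeneous k p \<Longrightarrow> k \<noteq> l \<Longrightarrow> z p = 0"
  unfolding functional_def by metis

lemma homogeneous_pderiv4: "homogeneous (Suc k) p \<Longrightarrow> homogeneous k (pderiv4 i p)"
  and homogeneous_0_pderiv4: "homogeneous 0 p \<Longrightarrow> pderiv4 i p = 0"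
proof -
  have d: "mono_degree a + 1 = k" if "homogeneous k p" "a \<in> Poly_Mapping.keys (pderiv4 i p)" for k a
    using that keys_pderiv4[OF that(2)] by (fastforce simp: homogeneous_def mono_degree_add mono_degree_single)
  show "homogeneous (Suc k) p \<Longrightarrow> homogeneous k (pderiv4 i p)"
    using d by (fastforce simp: homogeneous_def)
  show "homogeneous 0 p \<Longrightarrow> pderiv4 i p = 0"
    using d[of 0] by (metis Suc_eq_plus1 ex_in_conv keys_eq_empty old.nat.distinct(1))
qed

lemma functional_pderiv4:
  assumes "functional l z"
  shows "functional (Suc l) (z \<circ> pderiv4 a)"
proof -
  have "z (pderiv4 a p) = 0" if "k \<noteq> Suc l" "homogeneous k p" for k p
  proof (cases k)
    case 0
    have "z 0 = 0" using assms by (auto simp: functional_def homogeneous_def)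
       (metis add_0 add_left_cancel add.right_neutral)
    then show ?thesis using homogeneous_0_pderiv4 that 0 by metis
  next
    case (Suc k')
    then show ?thesis using assms that homogeneous_pderiv4[of k' p a] by (auto simp: functional_def)
  qed
  then show ?thesis
    using assms by (simp add: functional_def pderiv4_add pderiv4_const4_mult)
qed

lemma functional_hom_dual: "functional l z \<Longrightarrow> (\<lambda>f. z (poly_of f)) \<in> hom_dual l"
  unfolding hom_dual_def functional_def
  by (auto intro!: linearI simp: plus_ham.rep_eq scaleR_ham.rep_eq)

lemma list_all2_place:
  assumes "list_all2 functional ls zs" "i < length zs" "j < length zs" "i \<noteq> j"
  shows "list_all2 functional (ls[i := Suc (ls ! i), j := Suc (ls ! j)]) (place zs i a j b)"
  unfolding place_def
  using assms by (intro list_all2_update_cong functional_pderiv4) (auto simp: list_all2_conv_all_nth)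

lemma graph_cochains:
  assumes "list_all2 functional ls zs" "edges_in (length zs) E" "\<forall>l\<in>set (add_degrees E ls). 2 \<le> l"
  shows "graph E zs \<in> cochains (length zs) (\<Sum>l\<leftarrow>add_degrees E ls. l - 2)"
  using assms
proof (induction E zs arbitrary: ls rule: graph.induct)
  case (1 zs)
  have "list_all2 (\<lambda>l z. z \<in> hom_dual l) ls (map (\<lambda>z f. z (poly_of f)) zs)"
    using 1(1) functional_hom_dual by (auto simp: list_all2_map2 elim: list_all2_mono)
  then have "map (\<lambda>z f. z (poly_of f)) zs \<in> typed_lists (length zs) (\<Sum>l\<leftarrow>ls. l - 2)"
    unfolding typed_lists_def using 1 by (auto dest: list_all2_lengthD)
  then show ?case by (simp add: wedge_list_in_cochains)
next
  case (2 i j E zs)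
  have e: "i < length zs" "j < length zs" "i \<noteq> j" "edges_in (length zs) E"
    using 2(6) by (simp_all add: edges_in_Cons)
  note pl = list_all2_place[OF 2(5) e(1-3)]
  show ?case
    unfolding graph.simps
    using 2(1)[OF pl] 2(2)[OF pl] 2(3)[OF pl] 2(4)[OF pl] e 2(7)
    by (intro subspace_diff subspace_add subspace_cochains) simp_all
qed

lemma contract_wedge_list: "\<forall>z\<in>set zs. z f = 0 \<Longrightarrow> contract f (wedge_list zs) = 0"
proof (induction zs)
  case Nil
  show ?case by (simp add: wedge_list_def contract_def unit_form_def fun_eq_iff)
next
  case (Cons z zs)
  have "contract f (wedge_list zs) = 0" by (rule Cons.IH) (use Cons.prems in simp)
  moreover have "z f = 0" using Cons.prems by simp
  ultimately show ?case
    by (simp only: wedge_list_Cons contract_wedge_one_form wedge_zero_right scaleR_zero_left diff_zero)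
qed

lemma contract_graph:
  assumes "list_all2 functional ls zs" "edges_in (length zs) E" "\<forall>l\<in>set (add_degrees E ls). l \<noteq> k"
    and "homogeneous k (poly_of f)"
  shows "contract f (graph E zs) = 0"
  using assms(1-3)
proof (induction E zs arbitrary: ls rule: graph.induct)
  case (1 zs)
  have "z (poly_of f) = 0" if z: "z \<in> set zs" for z
  proof -
    obtain i where i: "i < length zs" "z = zs ! i" using z by (auto simp: in_set_conv_nth)
    then have "functional (ls ! i) z" "ls ! i \<in> set ls"
      using 1(1) by (auto simp: list_all2_conv_all_nth)
    moreover from this have "k \<noteq> ls ! i" using 1(3) by auto
    ultimately show ?thesis using functional_zero assms(4) by blast
  qed
  then show ?case unfolding graph.simps by (intro contract_wedge_list) auto
next
  case (2 i j E zs)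
  have e: "i < length zs" "j < length zs" "i \<noteq> j" "edges_in (length zs) E"
    using 2(6) by (simp_all add: edges_in_Cons)
  note pl = list_all2_place[OF 2(5) e(1-3)]
  show ?case
    unfolding graph.simps contract_add contract_diff
    using 2(1)[OF pl] 2(2)[OF pl] 2(3)[OF pl] 2(4)[OF pl] e 2(7)
    by simp
qed

section \<open>Linearity of graph forms in each vertex\<close>

lemma one_form_add: "one_form (z + z') = one_form z + one_form z'"
  and one_form_scaleR: "one_form (c *\<^sub>R z) = c *\<^sub>R one_form z"
  by (auto simp: one_form_def fun_eq_iff scaleR_fun_apply split: list.splits)

lemma wedge_list_add: "i < length zs \<Longrightarrow>
    wedge_list (zs[i := z + z']) = wedge_list (zs[i := z]) + wedge_list (zs[i := z'])"
proof (induction zs arbitrary: i)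
  case (Cons y zs)
  then show ?case
    by (cases i) (simp_all only: list_update.simps nat.case wedge_list_Cons one_form_add wedge_add_left
        wedge_add_right length_Cons Suc_less_eq)
qed simp

lemma wedge_list_scaleR: "i < length zs \<Longrightarrow> wedge_list (zs[i := c *\<^sub>R z]) = c *\<^sub>R wedge_list (zs[i := z])"
proof (induction zs arbitrary: i)
  case (Cons y zs)
  then show ?case
    by (cases i) (simp_all only: list_update.simps nat.case wedge_list_Cons one_form_scaleR wedge_scaleR_left
        wedge_scaleR_right length_Cons Suc_less_eq)
qed simp

lemma linear_pullback: "linear (\<lambda>z :: 'a \<Rightarrow> real. z \<circ> g)"
  by (rule linearI) (simp_all add: fun_eq_iff scaleR_fun_def)

lemma linear_graph:
  "i < length zs \<Longrightarrow> edges_in (length zs) E \<Longrightarrow> linear (\<lambda>z. graph E (zs[i := z]))"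
proof (induction E arbitrary: zs i)
  case Nil
  have a: "(\<lambda>f. (z + z') (poly_of f)) = (\<lambda>f. z (poly_of f)) + (\<lambda>f. z' (poly_of f))"
    "(\<lambda>f. (c *\<^sub>R z) (poly_of f)) = c *\<^sub>R (\<lambda>f. z (poly_of f))" for z z' :: "poly4 \<Rightarrow> real" and c
    by (simp_all add: fun_eq_iff scaleR_fun_def)
  show ?case
    by (rule linearI) (use Nil in \<open>simp_all only: graph.simps map_update a length_map wedge_list_add wedge_list_scaleR\<close>)
next
  case (Cons e E)
  obtain k l where e: "e = (k, l)" by fastforce
  have kl: "k < length zs" "l < length zs" "k \<noteq> l" "edges_in (length zs) E"
    using Cons.prems by (simp_all add: e edges_in_Cons)
  have "linear (\<lambda>z. graph E (place (zs[i := z]) k a l b))" for a b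
  proof -
    consider "i = k" | "i = l" "i \<noteq> k" | "i \<noteq> k" "i \<noteq> l" by blast
    then show ?thesis
    proof cases
      case 1
      have "place (zs[i := z]) k a l b = zs[l := zs ! l \<circ> pderiv4 b, k := z \<circ> pderiv4 a]" for z
        using 1 kl by (simp add: place_def list_update_swap)
      moreover have "linear (\<lambda>z. graph E (zs[l := zs ! l \<circ> pderiv4 b, k := z \<circ> pderiv4 a]))"
        using linear_compose[OF linear_pullback Cons.IH[of k "zs[l := zs ! l \<circ> pderiv4 b]"]] kl
        by (simp add: comp_def)
      ultimately show ?thesis by simp
    next
      case 2
      have "place (zs[i := z]) k a l b = zs[k := zs ! k \<circ> pderiv4 a, l := z \<circ> pderiv4 b]" for z
        using 2 kl by (simp add: place_def list_update_swap)
      moreover have "linear (\<lambda>z. graph E (zs[k := zs ! k \<circ> pderiv4 a, l := z \<circ> pderiv4 b]))"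
        using linear_compose[OF linear_pullback Cons.IH[of l "zs[k := zs ! k \<circ> pderiv4 a]"]] kl
        by (simp add: comp_def)
      ultimately show ?thesis by simp
    next
      case 3
      have "place (zs[i := z]) k a l b = (place zs k a l b)[i := z]" for z
        using 3 kl by (simp add: place_def list_update_swap)
      then show ?thesis using Cons.IH[of i "place zs k a l b"] Cons.prems(1) kl by simp
    qed
  qed
  then show ?case
    unfolding e graph.simps by (intro linear_compose_sub linear_compose_add)
qed

section \<open>Lie derivatives of graph forms\<close>

lemma lie_one_form: "lie f (one_form z) = - one_form (\<lambda>g. z (bracket f g))"
proof
  fix fs
  show "lie f (one_form z) fs = (- one_form (\<lambda>g. z (bracket f g))) fs"
  proof (cases "length fs = 1")
    case True
    then obtain g where "fs = [g]" by (auto simp: length_Suc_conv)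
    then show ?thesis by (simp add: lie_def one_form_def)
  next
    case False
    then have "one_form z' gs = 0" if "length gs = length fs" for z' gs
      using that by (auto simp: one_form_def split: list.splits)
    then show ?thesis by (simp add: lie_def)
  qed
qed

lemma lie_wedge_list:
  "lie f (wedge_list zs) = - (\<Sum>k<length zs. wedge_list (zs[k := \<lambda>g. (zs ! k) (bracket f g)]))"
proof (induction zs)
  case Nil
  show ?case by (simp add: wedge_list_def lie_def unit_form_def fun_eq_iff)
next
  case (Cons z zs)
  have sum: "wedge s (\<Sum>k\<in>K. g k) = (\<Sum>k\<in>K. wedge s (g k))" for s K and g :: "nat \<Rightarrow> form"
    by (induction K rule: infinite_finite_induct) (simp_all only: sum.infinite sum.empty sum.insert wedge_zero_right wedge_add_right not_False_eq_True)
  show ?case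
    unfolding wedge_list_Cons lie_wedge lie_one_form Cons.IH wedge_minus_left wedge_minus_right sum
      length_Cons sum.lessThan_Suc_shift nth_Cons_0 nth_Cons_Suc list_update.simps nat.case
    by simp
qed

lemma poisson_linear:
  assumes "\<And>b. pderiv4 b l = const4 (h b)"
  shows "poisson l p = const4 (h 1) * pderiv4 4 p + const4 (h 2) * pderiv4 3 p
    - const4 (h 3) * pderiv4 2 p - const4 (h 4) * pderiv4 1 p"
  by (simp add: poisson_def assms)

lemma homogeneous_0_const4:
  assumes "homogeneous 0 p"
  shows "p = const4 (Poly_Mapping.lookup p 0)"
proof (rule poly_mapping_eqI)
  fix a
  have "Poly_Mapping.lookup p a = 0" if "a \<noteq> 0"
  proof -
    have "mono_degree a \<noteq> 0"
    proof
      assume "mono_degree a = 0"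
      then have "a = 0" by (intro poly_mapping_eqI) (simp add: mono_degree_def)
      then show False using that by simp
    qed
    then show ?thesis using assms by (metis homogeneous_def in_keys_iff)
  qed
  then show "Poly_Mapping.lookup p a = Poly_Mapping.lookup (const4 (Poly_Mapping.lookup p 0)) a"
    by (auto simp: const4_def lookup_single when_def)
qed

text \<open>Moving a quadratic Hamiltonian past the derivatives at the two ends of an edge produces two extra
  terms, which cancel as the Poisson bivector is invariant.\<close>

lemma lie_graph:
  assumes X: "homogeneous 2 (poly_of X)"
  shows "\<forall>z\<in>set zs. \<exists>l. functional l z \<Longrightarrow> edges_in (length zs) E \<Longrightarrow>
    lie X (graph E zs) = - (\<Sum>k<length zs. graph E (zs[k := zs ! k \<circ> poisson (poly_of X)]))"
proof (induction E arbitrary: zs)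
  case Nil
  show ?case
    unfolding graph.simps lie_wedge_list length_map
    by (intro arg_cong[of _ _ uminus] sum.cong refl arg_cong[of _ _ wedge_list])
       (simp add: map_update bracket.rep_eq comp_def)
next
  case (Cons e E)
  obtain i j where e: "e = (i, j)" by fastforce
  let ?n = "length zs"
  have ij: "i < ?n" "j < ?n" "i \<noteq> j" "edges_in ?n E"
    using Cons.prems by (simp_all add: e edges_in_Cons)
  \<comment> \<open>The Hessian of the quadratic polynomial, which is constant.\<close>
  define h where "h a b = Poly_Mapping.lookup (pderiv4 b (pderiv4 a (poly_of X))) 0" for a b
  have hsym: "h a b = h b a" for a b unfolding h_def by (simp add: pderiv4_commute)
  have h: "pderiv4 b (pderiv4 a (poly_of X)) = const4 (h a b)" for a b
    unfolding h_def using X by (intro homogeneous_0_const4 homogeneous_pderiv4) (simp add: numeral_2_eq_2)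
  define ad where "ad z = z \<circ> poisson (poly_of X)" for z :: "poly4 \<Rightarrow> real"
  \<comment> \<open>The commutator of a derivative with the adjoint action: by
    \<open>pderiv4_poisson\<close> it is the bracket with the linear form
    \<open>pderiv4 a (poly_of X)\<close>, whose gradient is row \<open>a\<close> of
    \<open>h\<close>.\<close>
  define ex where "ex a z = h a 1 *\<^sub>R (z \<circ> pderiv4 4) + h a 2 *\<^sub>R (z \<circ> pderiv4 3)
      - h a 3 *\<^sub>R (z \<circ> pderiv4 2) - h a 4 *\<^sub>R (z \<circ> pderiv4 1)" for a and z :: "poly4 \<Rightarrow> real"
  have ad: "ad (z \<circ> pderiv4 a) = (ad z \<circ> pderiv4 a) + ex a z" if "functional l z" for l z a
  proof
    fix p
    have add: "z (p + q) = z p + z q" and sc: "z (const4 c * p) = c * z p" for p q c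
      using that by (simp_all add: functional_def)
    have neg: "z (p - q) = z p - z q" for p q
      using add[of "p - q" q] by simp
    show "ad (z \<circ> pderiv4 a) p = ((ad z \<circ> pderiv4 a) + ex a z) p"
      by (simp add: ad_def ex_def pderiv4_poisson poisson_linear[of "pderiv4 a (poly_of X)" "h a", OF h]
          add neg sc scaleR_fun_apply)
  qed
  define G where "G a b = graph E (place zs i a j b)" for a b
  have lin_i: "graph E (zs[i := ex a (zs ! i), j := zs ! j \<circ> pderiv4 b]) =
      h a 1 *\<^sub>R G 4 b + h a 2 *\<^sub>R G 3 b - h a 3 *\<^sub>R G 2 b - h a 4 *\<^sub>R G 1 b" for a b
  proof -
    have l: "linear (\<lambda>z. graph E ((zs[j := zs ! j \<circ> pderiv4 b])[i := z]))"
      by (rule linear_graph) (use ij in simp_all)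
    show ?thesis
      using ij(3) unfolding ex_def G_def place_def
      by (simp add: list_update_swap[of i j] linear_add[OF l] linear_diff[OF l] linear_cmul[OF l])
  qed
  have lin_j: "graph E (zs[i := zs ! i \<circ> pderiv4 a, j := ex b (zs ! j)]) =
      h b 1 *\<^sub>R G a 4 + h b 2 *\<^sub>R G a 3 - h b 3 *\<^sub>R G a 2 - h b 4 *\<^sub>R G a 1" for a b
  proof -
    have l: "linear (\<lambda>z. graph E ((zs[i := zs ! i \<circ> pderiv4 a])[j := z]))"
      by (rule linear_graph) (use ij in simp_all)
    show ?thesis
      unfolding ex_def G_def place_def by (simp add: linear_add[OF l] linear_diff[OF l] linear_cmul[OF l])
  qed
  have fz: "\<exists>l. functional l (zs ! k)" if "k < ?n" for k
    using Cons.prems(1) that by simp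
  have one: "graph E ((place zs i a j b)[k := ad (place zs i a j b ! k)]) =
      graph E (place (zs[k := ad (zs ! k)]) i a j b)
      + (if k = i then graph E (zs[i := ex a (zs ! i), j := zs ! j \<circ> pderiv4 b]) else 0)
      + (if k = j then graph E (zs[i := zs ! i \<circ> pderiv4 a, j := ex b (zs ! j)]) else 0)"
    if k: "k < ?n" for k a b
  proof -
    consider "k = i" | "k = j" "k \<noteq> i" | "k \<noteq> i" "k \<noteq> j" by blast
    then show ?thesis
    proof cases
      case 1
      have l: "linear (\<lambda>z. graph E ((zs[j := zs ! j \<circ> pderiv4 b])[i := z]))"
        by (rule linear_graph) (use ij in simp_all)
      obtain l' where "functional l' (zs ! i)" using fz ij(1) by blast
      note ad_i = ad[OF this, of a]
      have "(place zs i a j b)[k := ad (place zs i a j b ! k)] =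
          zs[j := zs ! j \<circ> pderiv4 b, i := (ad (zs ! i) \<circ> pderiv4 a) + ex a (zs ! i)]"
        using 1 ij by (simp only: ad_i[symmetric]) (simp add: place_def list_update_swap[of i j])
      moreover have "place (zs[k := ad (zs ! k)]) i a j b = zs[j := zs ! j \<circ> pderiv4 b, i := ad (zs ! i) \<circ> pderiv4 a]"
        using 1 ij by (simp add: place_def list_update_swap[of i j])
      moreover have "zs[i := ex a (zs ! i), j := zs ! j \<circ> pderiv4 b] = zs[j := zs ! j \<circ> pderiv4 b, i := ex a (zs ! i)]"
        using ij by (simp add: list_update_swap[of i j])
      ultimately show ?thesis
        using 1 ij(3) by (simp only: linear_add[OF l] if_True if_False add_0_right simp_thms)
    next
      case 2
      have l: "linear (\<lambda>z. graph E ((zs[i := zs ! i \<circ> pderiv4 a])[j := z]))"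
        by (rule linear_graph) (use ij in simp_all)
      obtain l' where "functional l' (zs ! j)" using fz ij(2) by blast
      note ad_j = ad[OF this, of b]
      have "(place zs i a j b)[k := ad (place zs i a j b ! k)] =
          zs[i := zs ! i \<circ> pderiv4 a, j := (ad (zs ! j) \<circ> pderiv4 b) + ex b (zs ! j)]"
        using 2 ij by (simp only: ad_j[symmetric]) (simp add: place_def)
      moreover have "place (zs[k := ad (zs ! k)]) i a j b = zs[i := zs ! i \<circ> pderiv4 a, j := ad (zs ! j) \<circ> pderiv4 b]"
        using 2 ij by (simp add: place_def list_update_swap[of j i])
      ultimately show ?thesis
        using 2 ij(3) by (simp only: linear_add[OF l] if_True if_False add_0_right simp_thms)
    next
      case 3
      then show ?thesis
        by (simp add: place_def list_update_swap[of k])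
    qed
  qed
  have place: "lie X (G a b) = - (\<Sum>k<?n. graph E (place (zs[k := ad (zs ! k)]) i a j b))
      - (h a 1 *\<^sub>R G 4 b + h a 2 *\<^sub>R G 3 b - h a 3 *\<^sub>R G 2 b - h a 4 *\<^sub>R G 1 b)
      - (h b 1 *\<^sub>R G a 4 + h b 2 *\<^sub>R G a 3 - h b 3 *\<^sub>R G a 2 - h b 4 *\<^sub>R G a 1)" for a b
  proof -
    have fctl: "\<forall>z\<in>set (place zs i a j b). \<exists>l. functional l z"
    proof -
      have "\<exists>l. functional l (zs ! k \<circ> pderiv4 c)" if "k < ?n" for k c
        using fz[OF that] functional_pderiv4 by blast
      then show ?thesis
        using Cons.prems(1) ij unfolding place_def
        by (auto dest!: subsetD[OF set_update_subset_insert])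
    qed
    have "lie X (G a b) = - (\<Sum>k<?n. graph E ((place zs i a j b)[k := ad (place zs i a j b ! k)]))"
      using Cons.IH[OF fctl, unfolded length_place, OF ij(4)] unfolding G_def ad_def .
    also have "(\<Sum>k<?n. graph E ((place zs i a j b)[k := ad (place zs i a j b ! k)])) =
        (\<Sum>k<?n. graph E (place (zs[k := ad (zs ! k)]) i a j b)
        + (if k = i then graph E (zs[i := ex a (zs ! i), j := zs ! j \<circ> pderiv4 b]) else 0)
        + (if k = j then graph E (zs[i := zs ! i \<circ> pderiv4 a, j := ex b (zs ! j)]) else 0))"
      by (intro sum.cong refl one) simp
    finally have e: "lie X (G a b) = - (\<Sum>k<?n. graph E (place (zs[k := ad (zs ! k)]) i a j b)
        + (if k = i then graph E (zs[i := ex a (zs ! i), j := zs ! j \<circ> pderiv4 b]) else 0)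
        + (if k = j then graph E (zs[i := zs ! i \<circ> pderiv4 a, j := ex b (zs ! j)]) else 0))" .
    have s: "(\<Sum>k<?n. if k = i then A else 0) = A" "(\<Sum>k<?n. if k = j then A else 0) = A" for A :: form
      using ij by (simp_all only: sum.delta finite_lessThan lessThan_iff if_True)
    show ?thesis
      unfolding e sum.distrib s lin_i lin_j by (simp only: minus_add_distrib diff_conv_add_uminus)
  qed
  show ?case
  proof
    fix fs
    show "lie X (graph (e # E) zs) fs = (- (\<Sum>k<?n. graph (e # E) (zs[k := zs ! k \<circ> poisson (poly_of X)]))) fs"
      \<comment> \<open>After summation over the four terms of the bivector, the corrections at the
        two ends of the edge cancel, because \<open>h\<close> is symmetric and the bivector
        antisymmetric.\<close>
      unfolding e graph.simps ad_def[symmetric] G_def[symmetric] lie_add lie_diff place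
        sum.distrib sum_subtractf hsym[of 2 1] hsym[of 3 1] hsym[of 4 1] hsym[of 3 2] hsym[of 4 2] hsym[of 4 3]
      by (simp only: uminus_apply plus_fun_apply minus_apply scaleR_fun_apply sum_form_apply real_scaleR_def)
  qed
qed

section \<open>Evaluation at the origin as vertex functional\<close>

lemma lookup_mult_0: "Poly_Mapping.lookup (p * q) 0 = Poly_Mapping.lookup p 0 * Poly_Mapping.lookup (q :: poly4) 0"
proof -
  have ab: "a + b = 0 \<longleftrightarrow> a = 0 \<and> b = 0" for a b :: mono4
    by (auto simp: poly_mapping_eq_iff fun_eq_iff lookup_add)
  have "Poly_Mapping.lookup (Poly_Mapping.single a c * q) 0 =
      Poly_Mapping.lookup (Poly_Mapping.single a c) 0 * Poly_Mapping.lookup q 0" for a c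
    by (induction q rule: poly4_induct)
       (auto simp: mult_single lookup_single when_def ab distrib_left lookup_add)
  then show ?thesis
    by (induction p rule: poly4_induct) (simp_all add: distrib_right lookup_add)
qed

lemma homogeneous_at_0: "homogeneous k p \<Longrightarrow> k \<noteq> 0 \<Longrightarrow> Poly_Mapping.lookup p 0 = 0"
proof -
  have "mono_degree 0 = 0" by (simp add: mono_degree_def)
  then show "homogeneous k p \<Longrightarrow> k \<noteq> 0 \<Longrightarrow> Poly_Mapping.lookup p 0 = 0"
    by (metis homogeneous_def in_keys_iff)
qed

text \<open>A quadratic Hamiltonian generates a linear vector field, which vanishes at the
  origin.\<close>

lemma poisson_at_0:
  assumes "homogeneous 2 p"
  shows "Poly_Mapping.lookup (poisson p q) 0 = 0"
proof -
  have "Poly_Mapping.lookup (pderiv4 i p) 0 = 0" for i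
  proof -
    have "homogeneous 1 (pderiv4 i p)" using assms by (intro homogeneous_pderiv4) (simp add: numeral_2_eq_2)
    then show ?thesis by (rule homogeneous_at_0) simp
  qed
  then show ?thesis by (simp add: poisson_def lookup_add lookup_minus lookup_mult_0)
qed

abbreviation at_0 :: "poly4 \<Rightarrow> real" where
  "at_0 \<equiv> \<lambda>p. Poly_Mapping.lookup p 0"

lemma functional_at_0: "functional 0 at_0"
  using homogeneous_at_0 by (auto simp: functional_def lookup_add lookup_const4_mult)

text \<open>By \<open>lie_graph\<close> the quadratic Hamiltonian ends up acting on the vertex
  functionals, and \<open>at_0\<close> is annihilated. Valences of at least 3 make the contraction
  with quadratic polynomials vanish.\<close>

lemma graph_relative_cochains:
  assumes "edges_in n E" "\<forall>l\<in>set (add_degrees E (replicate n 0)). 3 \<le> l"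
    and "(\<Sum>l\<leftarrow>add_degrees E (replicate n 0). l - 2) = w"
  shows "graph E (replicate n at_0) \<in> relative_cochains n w"
proof -
  let ?zs = "replicate n at_0"
  have fctl: "list_all2 functional (replicate n 0) ?zs"
    by (simp add: list_all2_conv_all_nth functional_at_0)
  have "graph E ?zs \<in> cochains n w"
    using graph_cochains[OF fctl, of E] assms by fastforce
  moreover have "contract X (graph E ?zs) = 0" if "homogeneous 2 (poly_of X)" for X
    by (rule contract_graph[OF fctl _ _ that]) (use assms in auto)
  moreover have "lie X (graph E ?zs) = 0" if "homogeneous 2 (poly_of X)" for X
  proof -
    have "graph E (?zs[k := ?zs ! k \<circ> poisson (poly_of X)]) = 0" if k: "k < n" for k
    proof -
      have "?zs ! k \<circ> poisson (poly_of X) = 0"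
        using k poisson_at_0[OF \<open>homogeneous 2 (poly_of X)\<close>] by (simp add: fun_eq_iff)
      moreover have "graph E (?zs[k := 0]) = 0"
        using linear_0[OF linear_graph[of k ?zs E]] k assms(1) by simp
      ultimately show ?thesis by simp
    qed
    then show ?thesis
      using lie_graph[OF that, of ?zs E] assms(1) functional_at_0 by auto
  qed
  ultimately show ?thesis by (simp add: relative_cochains_iff flip: cochains_iff)
qed

section \<open>Evaluation of graph invariants\<close>

fun picks :: "'a list \<Rightarrow> (int \<times> 'a \<times> 'a list) list" where
  "picks [] = []"
| "picks (x # xs) = (1, x, xs) # map (\<lambda>(e, y, ys). (- e, y, x # ys)) (picks xs)"

fun signed_perms :: "nat \<Rightarrow> 'a list \<Rightarrow> (int \<times> 'a list) list" where
  "signed_perms 0 xs = [(1, [])]"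
| "signed_perms (Suc n) xs = concat (map (\<lambda>(e, y, ys). map (\<lambda>(e', zs). (e * e', y # zs)) (signed_perms n ys))
     (picks xs))"

text \<open>Laplace expansion along the first factor.\<close>

lemma wedge_one_form_picks:
  "wedge (one_form z) t fs = (\<Sum>(e, g, gs)\<leftarrow>picks fs. of_int e * z g * t gs)"
proof (induction fs arbitrary: t)
  case Nil
  show ?case by (simp add: one_form_def)
next
  case (Cons f fs)
  have "(\<Sum>(e, g, gs)\<leftarrow>map (\<lambda>(e, y, ys). (- e, y, f # ys)) xs. of_int e * z g * t gs) =
      - (\<Sum>(e, g, gs)\<leftarrow>xs. of_int e * z g * contract f t gs)" for xs
    by (induction xs) (auto simp: contract_def)
  then show ?case
    using Cons[of "contract f t"]
    by (simp add: contract_one_form wedge_scaleR_left wedge_unit_form parity_one_form wedge_minus_left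
        scaleR_fun_apply)
qed

lemma picks_length: "(e, y, ys) \<in> set (picks xs) \<Longrightarrow> length xs = Suc (length ys)"
  by (induction xs arbitrary: e y ys) auto

lemma signed_perms_length: "(e, ys) \<in> set (signed_perms n xs) \<Longrightarrow> length ys = n"
  by (induction n xs arbitrary: e ys rule: signed_perms.induct) auto

lemma signed_perms_sum_cong:
  assumes "\<And>e ys. length ys = n \<Longrightarrow> f e ys = g e ys"
  shows "(\<Sum>(e, ys)\<leftarrow>signed_perms n xs. f e ys) = (\<Sum>(e, ys)\<leftarrow>signed_perms n xs. g e ys)"
proof (intro arg_cong[of _ _ sum_list] map_cong refl)
  fix x assume "x \<in> set (signed_perms n xs)"
  then show "(case x of (e, ys) \<Rightarrow> f e ys) = (case x of (e, ys) \<Rightarrow> g e ys)"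
    using assms signed_perms_length[of "fst x" "snd x" n xs] by (simp add: case_prod_beta)
qed

lemma picks_map: "picks (map f xs) = map (\<lambda>(e, y, ys). (e, f y, map f ys)) (picks xs)"
  by (induction xs) (auto simp: comp_def case_prod_beta)

lemma signed_perms_map: "signed_perms n (map f xs) = map (\<lambda>(e, ys). (e, map f ys)) (signed_perms n xs)"
proof (induction n arbitrary: xs)
  case (Suc n)
  show ?case by (simp add: picks_map map_concat comp_def case_prod_beta Suc)
qed simp

text \<open>Iterating the expansion gives the Leibniz formula for the determinant of the values
  \<open>z f\<close>.\<close>

lemma wedge_list_perms:
  "length fs = length zs \<Longrightarrow> wedge_list zs fs =
    (\<Sum>(e, gs)\<leftarrow>signed_perms (length zs) fs. of_int e * prod_list (map2 (\<lambda>z g. z g) zs gs))"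
proof (induction zs arbitrary: fs)
  case Nil
  then show ?case by (simp add: wedge_list_def unit_form_def)
next
  case (Cons z zs)
  have *: "(\<Sum>(e', gs')\<leftarrow>map (\<lambda>(e', hs). (e * e', g # hs)) xs. of_int e' * prod_list (map2 (\<lambda>z g. z g) (z # zs) gs')) =
      of_int e * z g * (\<Sum>(e', hs)\<leftarrow>xs. of_int e' * prod_list (map2 (\<lambda>z g. z g) zs hs))" for e g xs
    by (induction xs) (auto simp: algebra_simps)
  have "(\<Sum>(e, gs)\<leftarrow>concat (map (\<lambda>(e, y, ys). map (\<lambda>(e', zs). (e * e', y # zs)) (S ys)) P).
        of_int e * prod_list (map2 (\<lambda>z g. z g) (z # zs) gs)) =
      (\<Sum>(e, g, gs)\<leftarrow>P. of_int e * z g * (\<Sum>(e', hs)\<leftarrow>S gs. of_int e' * prod_list (map2 (\<lambda>z g. z g) zs hs)))"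
    for S :: "ham list \<Rightarrow> (int \<times> ham list) list" and P
  proof (induction P)
    case (Cons x P)
    obtain e g gs where x: "x = (e, g, gs)" by (rule prod_cases3)
    show ?case
      unfolding x list.map concat.simps map_append sum_list.append sum_list.Cons prod.case * Cons.IH ..
  qed simp
  then have "(\<Sum>(e, gs)\<leftarrow>signed_perms (length (z # zs)) fs. of_int e * prod_list (map2 (\<lambda>z g. z g) (z # zs) gs)) =
      (\<Sum>(e, g, gs)\<leftarrow>picks fs. of_int e * z g *
        (\<Sum>(e', hs)\<leftarrow>signed_perms (length zs) gs. of_int e' * prod_list (map2 (\<lambda>z g. z g) zs hs)))"
    unfolding list.size add_0_right add_Suc_right signed_perms.simps .
  also have "\<dots> = (\<Sum>(e, g, gs)\<leftarrow>picks fs. of_int e * z g * wedge_list zs gs)"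
  proof (intro arg_cong[of _ _ sum_list] map_cong refl)
    fix x assume x: "x \<in> set (picks fs)"
    obtain e g gs where egs: "x = (e, g, gs)" by (rule prod_cases3)
    have len: "length gs = length zs"
      using picks_length x[unfolded egs] Cons.prems by fastforce
    show "(case x of (e, g, gs) \<Rightarrow> of_int e * z g *
        (\<Sum>(e', hs)\<leftarrow>signed_perms (length zs) gs. of_int e' * prod_list (map2 (\<lambda>z g. z g) zs hs))) =
      (case x of (e, g, gs) \<Rightarrow> of_int e * z g * wedge_list zs gs)"
      unfolding egs prod.case Cons.IH[OF len] ..
  qed
  finally show ?case
    unfolding wedge_list_Cons wedge_one_form_picks ..
qed

section \<open>Graph forms on exponentials of linear forms\<close>

type_synonym point = "int \<times> int \<times> int \<times> int"

fun entry :: "point \<Rightarrow> 4 \<Rightarrow> real" where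
  "entry (a, b, c, d) i = of_int (if i = 1 then a else if i = 2 then b else if i = 3 then c else d)"

fun pairing :: "point \<Rightarrow> point \<Rightarrow> int" where
  "pairing (a, b, c, d) (a', b', c', d') = a * d' + b * c' - c * b' - d * a'"

lemma pairing_entry:
  "of_int (pairing u v) = entry u 1 * entry v 4 + entry u 2 * entry v 3 - entry u 3 * entry v 2 - entry u 4 * entry v 1"
  by (cases u; cases v) simp

text \<open>The coefficient of x^a in the power series of exp(u1 x1 + u2 x2 + u3 x3 + u4
  x4).\<close>

definition exp_coeff :: "point \<Rightarrow> mono4 \<Rightarrow> real" where
  "exp_coeff u a = (\<Prod>i\<in>UNIV. entry u i ^ Poly_Mapping.lookup a i / fact (Poly_Mapping.lookup a i))"

text \<open>The exponential is an eigenvector of the i-th derivative, with eigenvalue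
  \<open>entry u i\<close>; this is that fact coefficient by coefficient.\<close>

lemma exp_coeff_step:
  "real (Poly_Mapping.lookup a i + 1) * exp_coeff u (a + Poly_Mapping.single i 1) = entry u i * exp_coeff u a"
proof -
  define g where "g k n = entry u k ^ n / fact n" for k n
  have "(\<Prod>k\<in>UNIV. g k (Poly_Mapping.lookup (a + Poly_Mapping.single i 1) k)) =
      g i (Suc (Poly_Mapping.lookup a i)) * (\<Prod>k\<in>UNIV - {i}. g k (Poly_Mapping.lookup a k))"
    by (subst prod.remove[of _ i]) (auto intro!: prod.cong simp: lookup_add lookup_single when_def)
  moreover have "(\<Prod>k\<in>UNIV. g k (Poly_Mapping.lookup a k)) =
      g i (Poly_Mapping.lookup a i) * (\<Prod>k\<in>UNIV - {i}. g k (Poly_Mapping.lookup a k))"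
    by (subst prod.remove[of _ i]) auto
  moreover have "real (n + 1) * g i (Suc n) = entry u i * g i n" for n
  proof -
    define c where "c = real (n + 1)"
    have "c \<noteq> 0" "fact (Suc n) = c * fact n" by (simp_all add: c_def)
    then show ?thesis unfolding g_def c_def[symmetric] by (simp add: field_simps)
  qed
  ultimately show ?thesis
    unfolding exp_coeff_def g_def[symmetric] by (metis mult.assoc)
qed

fun ev :: "4 list \<Rightarrow> poly4 \<Rightarrow> real" where
  "ev [] p = Poly_Mapping.lookup p 0"
| "ev (a # J) p = ev J (pderiv4 a p)"

text \<open>Only the coefficients of degree \<open>length J\<close> influence the result, which is
  why truncated exponentials suffice. The factor \<open>c\<close> collects the eigenvalues in the
  induction.\<close>

lemma ev_exp:
  "\<forall>a. mono_degree a = length J \<longrightarrow> Poly_Mapping.lookup p a = c * exp_coeff u a \<Longrightarrow>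
    ev J p = c * prod_list (map (entry u) J)"
proof (induction J arbitrary: p c)
  case Nil
  have "mono_degree 0 = 0" "exp_coeff u 0 = 1" by (simp_all add: mono_degree_def exp_coeff_def)
  then show ?case using Nil by simp
next
  case (Cons i J)
  have "Poly_Mapping.lookup (pderiv4 i p) a = (c * entry u i) * exp_coeff u a" if "mono_degree a = length J" for a
    using Cons.prems that exp_coeff_step[of a i u]
    by (simp add: lookup_pderiv4 mono_degree_add mono_degree_single algebra_simps)
  then show ?case using Cons.IH[of "pderiv4 i p" "c * entry u i"] by simp
qed

text \<open>The bound 5 is the largest valence in the graphs used, attained in degree 2. The terms
  of degree below 2 disappear because \<open>mon\<close> is 0 there.\<close>

definition trunc_exp :: "point \<Rightarrow> ham" where
  "trunc_exp u = (\<Sum>p\<in>{p. deg p \<le> 5}. exp_coeff u (expo_map p) *\<^sub>R mon p)"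

lemma lookup_trunc_exp:
  assumes "2 \<le> mono_degree a" "mono_degree a \<le> 5"
  shows "Poly_Mapping.lookup (poly_of (trunc_exp u)) a = exp_coeff u a"
proof -
  obtain q where q: "a = expo_map q" using expo_map_surj by blast
  have "coef q (trunc_exp u) = (\<Sum>p\<in>{p. deg p \<le> 5}. if p = q then exp_coeff u a else 0)"
    unfolding trunc_exp_def coef_sum
    using assms by (intro sum.cong refl) (auto simp: coef_scaleR coef_mon q mono_degree_expo_map simp del: deg.simps)
  also have "\<dots> = exp_coeff u a"
    using assms finite_deg_le[of 5] by (simp add: q mono_degree_expo_map del: deg.simps)
  finally show ?thesis by (simp add: coef_def q)
qed

lemma ev_trunc_exp:
  "2 \<le> length J \<Longrightarrow> length J \<le> 5 \<Longrightarrow> ev J (poly_of (trunc_exp u)) = prod_list (map (entry u) J)"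
  using ev_exp[of J "poly_of (trunc_exp u)" 1 u] lookup_trunc_exp by simp

lemma prod_list_update:
  "i < length Js \<Longrightarrow> length vs = length Js \<Longrightarrow>
    prod_list (map2 (\<lambda>J v. prod_list (map (entry v) J)) (Js[i := a # Js ! i]) vs) =
    entry (vs ! i) a * prod_list (map2 (\<lambda>J v. prod_list (map (entry v) J)) Js vs)"
proof (induction Js arbitrary: i vs)
  case (Cons J Js)
  then obtain v vs' where "vs = v # vs'" by (cases vs) auto
  then show ?case using Cons by (cases i) auto
qed simp

lemma place_ev:
  "i < length Js \<Longrightarrow> j < length Js \<Longrightarrow> i \<noteq> j \<Longrightarrow>
    place (map ev Js) i a j b = map ev (Js[i := a # Js ! i, j := b # Js ! j])"
proof -
  have "ev J \<circ> pderiv4 c = ev (c # J)" for J c by (simp add: fun_eq_iff)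
  then show "i < length Js \<Longrightarrow> j < length Js \<Longrightarrow> i \<noteq> j \<Longrightarrow> ?thesis"
    by (simp add: place_def map_update)
qed

text \<open>On exponentials a derivative multiplies by a component of the point, so the four terms
  of an edge add up to the pairing of its end points. \<open>Js\<close> records the derivatives
  already placed, as the recursion of \<open>graph\<close> requires.\<close>

lemma graph_trunc_exp:
  assumes "length us = length Js" "edges_in (length Js) E" "\<forall>l\<in>set (add_degrees E (map length Js)). 2 \<le> l \<and> l \<le> 5"
  shows "graph E (map ev Js) (map trunc_exp us) =
    (\<Sum>(e, vs)\<leftarrow>signed_perms (length Js) us. of_int e *
      (of_int (prod_list (map (\<lambda>(i, j). pairing (vs ! i) (vs ! j)) E)) *
       prod_list (map2 (\<lambda>J v. prod_list (map (entry v) J)) Js vs)))"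
  using assms
proof (induction E arbitrary: Js)
  case Nil
  have *: "prod_list (map2 (\<lambda>z g. z g) (map (\<lambda>z f. z (poly_of f)) (map ev Js)) (map trunc_exp vs)) =
      prod_list (map2 (\<lambda>J v. prod_list (map (entry v) J)) Js vs)" for vs
    using Nil(3)
  proof (induction Js arbitrary: vs)
    case (Cons J Js)
    then show ?case by (cases vs) (auto simp: ev_trunc_exp)
  qed simp
  have "graph [] (map ev Js) (map trunc_exp us) = (\<Sum>(e, gs)\<leftarrow>signed_perms (length Js) (map trunc_exp us).
      of_int e * prod_list (map2 (\<lambda>z g. z g) (map (\<lambda>z f. z (poly_of f)) (map ev Js)) gs))"
    using Nil(1) wedge_list_perms[of "map trunc_exp us" "map (\<lambda>z f. z (poly_of f)) (map ev Js)"]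
    unfolding graph.simps length_map by simp
  also have "\<dots> = (\<Sum>(e, vs)\<leftarrow>signed_perms (length Js) us. of_int e *
      prod_list (map2 (\<lambda>z g. z g) (map (\<lambda>z f. z (poly_of f)) (map ev Js)) (map trunc_exp vs)))"
    unfolding signed_perms_map map_map by (intro arg_cong[of _ _ sum_list] map_cong refl) auto
  finally show ?case unfolding * by simp
next
  case (Cons ij E)
  obtain i j where e: "ij = (i, j)" by fastforce
  have ij: "i < length Js" "j < length Js" "i \<noteq> j" "edges_in (length Js) E"
    using Cons.prems by (simp_all add: e edges_in_Cons)
  define P where "P vs = (of_int (prod_list (map (\<lambda>(i, j). pairing (vs ! i) (vs ! j)) E)) :: real)" for vs
  define Q where "Q vs = prod_list (map2 (\<lambda>J v. prod_list (map (entry v) J)) Js vs)" for vs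
  have deg: "map length (Js[i := a # Js ! i, j := b # Js ! j]) =
      (map length Js)[i := Suc (map length Js ! i), j := Suc (map length Js ! j)]" for a b
    using ij by (simp add: map_update)
  have 1: "graph E (place (map ev Js) i a j b) (map trunc_exp us) =
      (\<Sum>(e, vs)\<leftarrow>signed_perms (length Js) us. of_int e * (P vs * (entry (vs ! i) a * entry (vs ! j) b * Q vs)))" for a b
  proof -
    let ?Js = "Js[i := a # Js ! i, j := b # Js ! j]"
    have "prod_list (map2 (\<lambda>J v. prod_list (map (entry v) J)) ?Js vs) = entry (vs ! i) a * entry (vs ! j) b * Q vs"
      if "length vs = length Js" for vs
      using prod_list_update[of j "Js[i := a # Js ! i]" vs b] prod_list_update[of i Js vs a] ij that
      by (simp add: Q_def)
    then have c: "of_int e * (P vs * prod_list (map2 (\<lambda>J v. prod_list (map (entry v) J)) ?Js vs)) =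
        of_int e * (P vs * (entry (vs ! i) a * entry (vs ! j) b * Q vs))" if "length vs = length Js" for e vs
      using that by simp
    have g: "graph E (map ev ?Js) (map trunc_exp us) =
       (\<Sum>(e, vs)\<leftarrow>signed_perms (length ?Js) us. of_int e *
         (P vs * prod_list (map2 (\<lambda>J v. prod_list (map (entry v) J)) ?Js vs)))"
      unfolding P_def
    proof (rule Cons.IH)
      show "length us = length ?Js" "edges_in (length ?Js) E" using Cons.prems(1) ij(4) by simp_all
      show "\<forall>l\<in>set (add_degrees E (map length ?Js)). 2 \<le> l \<and> l \<le> 5"
        using Cons.prems(3) unfolding deg e add_degrees.simps .
    qed
    show ?thesis
      unfolding place_ev[OF ij(1-3)] g unfolding length_list_update
      by (rule signed_perms_sum_cong) (rule c)
  qed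
  have "(\<Sum>(e, vs)\<leftarrow>xs. of_int e * (P vs * (entry (vs ! i) 1 * entry (vs ! j) 4 * Q vs)))
    + (\<Sum>(e, vs)\<leftarrow>xs. of_int e * (P vs * (entry (vs ! i) 2 * entry (vs ! j) 3 * Q vs)))
    - (\<Sum>(e, vs)\<leftarrow>xs. of_int e * (P vs * (entry (vs ! i) 3 * entry (vs ! j) 2 * Q vs)))
    - (\<Sum>(e, vs)\<leftarrow>xs. of_int e * (P vs * (entry (vs ! i) 4 * entry (vs ! j) 1 * Q vs))) =
    (\<Sum>(e, vs)\<leftarrow>xs. of_int e * (of_int (pairing (vs ! i) (vs ! j)) * P vs * Q vs))" for xs
    unfolding pairing_entry by (induction xs) (auto simp: algebra_simps)
  then show ?case
    unfolding e graph.simps minus_apply plus_fun_apply 1 by (simp add: P_def Q_def)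
qed

definition graph_value :: "(nat \<times> nat) list \<Rightarrow> point list \<Rightarrow> int" where
  "graph_value E us = (\<Sum>(e, vs)\<leftarrow>signed_perms (length us) us. e * prod_list (map (\<lambda>(i, j). pairing (vs ! i) (vs ! j)) E))"

lemma graph_eval:
  assumes "length us = n" "edges_in n E" "\<forall>l\<in>set (add_degrees E (replicate n 0)). 2 \<le> l \<and> l \<le> 5"
  shows "graph E (replicate n at_0) (map trunc_exp us) = of_int (graph_value E us)"
proof -
  have "at_0 = ev []" by (rule ext) simp
  then have r: "replicate n at_0 = map ev (replicate n [])" by (simp only: map_replicate)
  have one: "prod_list (map2 (\<lambda>J v. prod_list (map (entry v) J)) (replicate n []) vs) = 1" for vs
    by (induction n arbitrary: vs) (simp, case_tac vs, auto)
  have int: "(\<Sum>(e, vs)\<leftarrow>xs. of_int e * (of_int (h vs) * 1)) = (of_int (\<Sum>(e, vs)\<leftarrow>xs. e * h vs) :: real)"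
    for xs and h :: "point list \<Rightarrow> int"
    by (induction xs) auto
  have g: "graph E (map ev (replicate n [])) (map trunc_exp us) =
    (\<Sum>(e, vs)\<leftarrow>signed_perms (length (replicate n ([] :: 4 list))) us. of_int e *
      (of_int (prod_list (map (\<lambda>(i, j). pairing (vs ! i) (vs ! j)) E)) *
       prod_list (map2 (\<lambda>J v. prod_list (map (entry v) J)) (replicate n []) vs)))"
    by (rule graph_trunc_exp) (use assms in \<open>simp_all add: map_replicate del: map_replicate_const\<close>)
  show ?thesis unfolding r g length_replicate one int graph_value_def assms(1) ..
qed

section \<open>Dimensions and Betti numbers\<close>

text \<open>The linear map \<open>e\<close>, injective on \<open>V\<close>, bounds the dimension
  from above, and \<open>B\<close> attains the bound. An element outside the span of
  \<open>B\<close> would give one independent vector too many in the target.\<close>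

lemma has_dimension_span:
  fixes e :: "'a::real_vector \<Rightarrow> 'b::euclidean_space"
  assumes V: "subspace V" and e: "linear e" "\<And>v. v \<in> V \<Longrightarrow> e v = 0 \<Longrightarrow> v = 0"
    and B: "finite B" "card B = DIM('b)" "independent B" "B \<subseteq> V"
  shows "span B = V" "has_dimension V DIM('b)"
proof -
  have inj: "inj_on e V"
    using e V by (simp add: linear_injective_on_subspace_0)
  show eq: "span B = V"
  proof
    show "span B \<subseteq> V" by (rule span_minimal[OF B(4) V])
    show "V \<subseteq> span B"
    proof (rule ccontr)
      assume "\<not> V \<subseteq> span B"
      then obtain v where v: "v \<in> V" "v \<notin> span B" by blast
      let ?C = "insert v B"
      have sub: "span ?C \<subseteq> V"
        using v(1) B(4) V by (intro span_minimal) auto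
      have "independent ?C" using v(2) B(3) by (simp add: independent_insert)
      then have "independent (e ` ?C)"
        using linear_independent_injective_image[OF e(1)] inj_on_subset[OF inj sub] by blast
      then have "card (e ` ?C) \<le> DIM('b)" by (rule independent_card_le)
      moreover have "inj_on e ?C" by (rule inj_on_subset[OF inj]) (use v(1) B(4) in blast)
      then have "card (e ` ?C) = card ?C" by (rule card_image)
      moreover have "v \<notin> B" using v(2) span_base by blast
      ultimately show False using B(1,2) by simp
    qed
  qed
  then show "has_dimension V DIM('b)"
    using B unfolding has_dimension_def by blast
qed

lemma independent_family:
  fixes b :: "nat \<Rightarrow> 'a::real_vector"
  assumes "\<And>c. (\<Sum>i<n. c i *\<^sub>R b i) = 0 \<Longrightarrow> \<forall>i<n. c i = 0"
  shows "independent (b ` {..<n})" "card (b ` {..<n}) = n"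
proof -
  have inj: "inj_on b {..<n}"
  proof (rule inj_onI, rule ccontr)
    fix i j assume ij: "i \<in> {..<n}" "j \<in> {..<n}" "b i = b j" "i \<noteq> j"
    have "(\<Sum>k<n. (if k = i then 1 else if k = j then - 1 else 0) *\<^sub>R b k) =
        (\<Sum>k<n. (if k = i then b i else 0) + (if k = j then - b j else 0))"
      using ij(4) by (intro sum.cong refl) auto
    also have "\<dots> = 0" using ij by (simp add: sum.distrib)
    finally show False using assms[of "\<lambda>k. if k = i then 1 else if k = j then - 1 else 0"] ij(1) by auto
  qed
  then show "card (b ` {..<n}) = n" by (simp add: card_image)
  show "independent (b ` {..<n})"
  proof
    assume "dependent (b ` {..<n})"
    then obtain u v where u: "v \<in> b ` {..<n}" "u v \<noteq> 0" "(\<Sum>v\<in>b ` {..<n}. u v *\<^sub>R v) = 0"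
      by (auto simp: dependent_finite)
    have "(\<Sum>i<n. u (b i) *\<^sub>R b i) = 0"
      using u(3) by (simp add: sum.reindex[OF inj])
    from assms[OF this] show False using u(1,2) by auto
  qed
qed

text \<open>The injective image of a basis of \<open>V\<close> already reaches the upper bound given
  by \<open>e\<close>, so no elements of \<open>W\<close> have to be constructed separately.\<close>

lemma has_dimension_image:
  fixes e :: "'a::real_vector \<Rightarrow> 'b::euclidean_space"
  assumes V: "subspace V" "V = span B" "finite B" "card B = DIM('b)" "independent B"
    and f: "linear f" "\<And>v. v \<in> V \<Longrightarrow> f v = 0 \<Longrightarrow> v = 0" "f ` V \<subseteq> W"
    and W: "subspace W" and e: "linear e" "\<And>w. w \<in> W \<Longrightarrow> e w = 0 \<Longrightarrow> w = 0"
  shows "f ` V = W" "has_dimension W DIM('b)"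
proof -
  have inj: "inj_on f (span B)"
    using f V(1) unfolding V(2) by (simp add: linear_injective_on_subspace_0)
  have B: "finite (f ` B)" "card (f ` B) = DIM('b)" "independent (f ` B)" "f ` B \<subseteq> W"
    using V(3,4) card_image[OF inj_on_subset[OF inj span_superset]]
      linear_independent_injective_image[OF f(1) V(5) inj] f(3) span_superset[of B] unfolding V(2) by auto
  show "f ` V = W"
    using has_dimension_span(1)[OF W e B] linear_span_image[OF f(1), of B] V(2) by simp
  show "has_dimension W DIM('b)" by (rule has_dimension_span(2)[OF W e B])
qed

lemma has_dimension_zero: "has_dimension {0} 0"
  unfolding has_dimension_def by (rule exI[of _ "{}"]) (simp add: independent_empty)

lemma has_betti_number_0: "cocycles m w \<subseteq> coboundaries m w \<Longrightarrow> has_betti_number m w 0"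
  unfolding has_betti_number_def quotient_has_dimension_def by (rule exI[of _ "{}"]) auto

lemma zero_in_coboundaries: "0 \<in> coboundaries m w"
proof (cases m)
  case (Suc k)
  have "coboundary 0 \<in> coboundary ` relative_cochains k w"
    by (intro imageI subspace_0 subspace_relative_cochains)
  then show ?thesis using Suc linear_0[OF linear_coboundary] by simp
qed simp

lemma has_betti_number_0_inj:
  "(\<And>s. s \<in> relative_cochains m w \<Longrightarrow> coboundary s = 0 \<Longrightarrow> s = 0) \<Longrightarrow> has_betti_number m w 0"
  using zero_in_coboundaries by (intro has_betti_number_0) (auto simp: cocycles_def)

lemma has_betti_number_0_surj:
  "coboundary ` relative_cochains m w = relative_cochains (Suc m) w \<Longrightarrow> has_betti_number (Suc m) w 0"
  by (intro has_betti_number_0) (auto simp: cocycles_def)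

lemma relative_cochains_zeroI:
  "(\<And>s. s \<in> relative_cochains m w \<Longrightarrow> s = 0) \<Longrightarrow> relative_cochains m w = {0}"
  using subspace_0[OF subspace_relative_cochains] by blast

section \<open>The cochain spaces of weight 6\<close>

definition value_on :: "ham list \<Rightarrow> form \<Rightarrow> real" where
  "value_on fs s = s fs"

lemma linear_value_on: "linear (value_on fs)"
  by (rule linearI) (simp_all add: value_on_def scaleR_fun_apply)

definition values4 :: "ham list \<Rightarrow> ham list \<Rightarrow> ham list \<Rightarrow> ham list \<Rightarrow> form \<Rightarrow> real ^ 4" where
  "values4 fs1 fs2 fs3 fs4 s = (\<chi> i. if i = 1 then s fs1 else if i = 2 then s fs2 else if i = 3 then s fs3 else s fs4)"

lemma linear_values4: "linear (values4 fs1 fs2 fs3 fs4)"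
  by (rule linearI) (simp_all add: values4_def vec_eq_iff scaleR_fun_apply)

lemma values4_eq_0: "values4 fs1 fs2 fs3 fs4 s = 0 \<longleftrightarrow> s fs1 = 0 \<and> s fs2 = 0 \<and> s fs3 = 0 \<and> s fs4 = 0"
  by (simp add: values4_def vec_eq_iff forall_4)

text \<open>The only tuple is empty and has weight 0.\<close>

lemma relative_0: "relative_cochains 0 6 = {0}"
  by (rule relative_cochains_zeroI, erule relative_eq_0I) auto

lemma relative_1: "relative_cochains 1 6 = {0}"
proof (rule relative_cochains_zeroI)
  fix s assume s: "s \<in> relative_cochains 1 6"
  have inv: "invariant s" by (rule relative_invariant[OF s])
  have lie: "lie (mon X) s = 0" if "deg X = 2" for X
    using inv that unfolding invariant_def by blast
  have mult: "multilinear s" using inv unfolding invariant_def by blast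
  show "s = 0"
  proof (rule relative_eq_0I[OF s])
    fix T :: "expo list" assume T: "\<forall>p\<in>set T. 3 \<le> deg p" "length T = 1" "(\<Sum>p\<leftarrow>T. deg p - 2) = 6"
    then obtain p where p: "T = [p]" by (auto simp: length_Suc_conv)
    have "s (mon p # map mon []) = 0"
    \<comment> \<open>Weight 6 forces degree 8. The monomial x1^8 has nonzero torus weight, so the
      form vanishes there, and lowering operators reach all other monomials of degree 8.\<close>
    proof (rule lower_all[OF mult, where l = 8 and ls = "[]"])
      show "s (mon (8, 0, 0, 0) # map mon T) = 0" if "map deg T = []" for T
        using weight_zero[OF inv, of "[(8, 0, 0, 0)]"] that by simp
    qed (use p T in \<open>auto intro!: lie\<close>)
    then show "s (map mon T) = 0" by (simp add: p)
  qed
qed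

lemma relative_4: "relative_cochains 4 6 = {0}"
  by (rule relative_cochains_zeroI, erule certificate_zero[OF certificate4])
     (simp add: sound_def base4_def)

abbreviation "mons \<equiv> map mon"

lemma relative_3_eq_0: "s \<in> relative_cochains 3 6 \<Longrightarrow> value_on (mons (fst (base3 ! 0))) s = 0 \<Longrightarrow> s = 0"
  by (erule certificate_zero[OF certificate3]) (simp add: sound_def base3_def value_on_def)

lemma relative_2_eq_0: "s \<in> relative_cochains 2 6 \<Longrightarrow> value_on (mons (fst (base2 ! 0))) s = 0 \<Longrightarrow> s = 0"
  by (erule certificate_zero[OF certificate2]) (simp add: sound_def base2_def value_on_def)

lemma relative_6_eq_0:
  "s \<in> relative_cochains 6 6 \<Longrightarrow> values4 (mons (fst (base6 ! 0))) (mons (fst (base6 ! 1)))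
     (mons (fst (base6 ! 2))) (mons (fst (base6 ! 3))) s = 0 \<Longrightarrow> s = 0"
  by (erule certificate_zero[OF certificate6]) (simp add: sound_def base6_def values4_eq_0)

lemma relative_5_eq_0:
  "s \<in> relative_cochains 5 6 \<Longrightarrow> values4 (mons (fst (base5 ! 0))) (mons (fst (base5 ! 1)))
     (mons (fst (base5 ! 2))) (mons (fst (base5 ! 3))) s = 0 \<Longrightarrow> s = 0"
  by (erule certificate_zero[OF certificate5]) (simp add: sound_def base5_def values4_eq_0)

lemma coboundary_inj_2:
  assumes "s \<in> relative_cochains 2 6" "coboundary s = 0"
  shows "s = 0"
proof (rule relative_2_eq_0[OF assms(1)])
  \<comment> \<open>The base entry equals 20 times the parameter.\<close>
  let ?y = "\<lambda>_::nat. s (mons (fst (base2 ! 0))) / 20"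
  have "\<forall>v\<in>set [(-4, 0, 0, 0)]. dot v ?y = 0"
    by (rule certificate_coboundary[OF certificate2 assms(1) _ assms(2)])
       (simp_all add: sound_def base2_def tests2_def)
  then show "value_on (mons (fst (base2 ! 0))) s = 0" by (simp add: value_on_def)
qed

lemma coboundary_inj_5:
  assumes "s \<in> relative_cochains 5 6" "coboundary s = 0"
  shows "s = 0"
proof (rule relative_5_eq_0[OF assms(1)])
  \<comment> \<open>The divisors are the multiples with which the parameters enter
    \<open>base5\<close>.\<close>
  define y where "y i = s (mons (fst (base5 ! i))) / [72, 12, 12, 24] ! i" for i
  have "\<forall>v\<in>set [(3240,-2160,-540,0), (-324,-144,72,0), (432,-312,-168,72), (540,36,-72,252)]. dot v y = 0"
    by (rule certificate_coboundary[OF certificate5 assms(1) _ assms(2)])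
       (simp_all add: sound_def base5_def tests5_def y_def)
  then have "y 0 = 0 \<and> y 1 = 0 \<and> y 2 = 0 \<and> y 3 = 0" by simp
  then show "values4 (mons (fst (base5 ! 0))) (mons (fst (base5 ! 1)))
     (mons (fst (base5 ! 2))) (mons (fst (base5 ! 3))) s = 0"
    by (simp add: values4_eq_0 y_def)
qed

text \<open>Exchanging the two vertices reverses all edges. As their number is odd, the resulting
  sign matches the antisymmetry of the exterior product, so the two permutations reinforce each
  other and give the value 2.\<close>

definition edges2 :: "(nat \<times> nat) list" where
  "edges2 = [(0,1), (0,1), (0,1), (0,1), (0,1)]"

lemma edges2: "graph edges2 (replicate 2 at_0) \<in> relative_cochains 2 6"
  "graph edges2 (replicate 2 at_0) (map trunc_exp [(1,0,0,0), (0,0,0,1)]) = 2"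
proof -
  have E: "edges_in 2 edges2" "add_degrees edges2 (replicate 2 0) = [5, 5]"
    "graph_value edges2 [(1,0,0,0), (0,0,0,1)] = 2"
    by code_simp+
  show "graph edges2 (replicate 2 at_0) \<in> relative_cochains 2 6"
    by (rule graph_relative_cochains) (simp_all add: E)
  show "graph edges2 (replicate 2 at_0) (map trunc_exp [(1,0,0,0), (0,0,0,1)]) = 2"
    by (subst graph_eval) (simp_all add: E)
qed

text \<open>The points are chosen such that the values of the graph invariants form a triangular matrix.\<close>

definition edges5 :: "(nat \<times> nat) list list" where
  "edges5 = [
     [(0,1), (0,1), (0,1), (2,3), (2,4), (2,4), (3,4), (3,4)],
     [(0,1), (0,1), (0,2), (1,3), (2,4), (2,4), (3,4), (3,4)],
     [(0,1), (0,1), (0,2), (1,4), (2,3), (2,4), (3,4), (3,4)],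
     [(0,1), (0,2), (0,3), (1,2), (1,4), (2,4), (3,4), (3,4)]]"

definition points5 :: "point list list" where
  "points5 = [
     [(1,0,0,0), (0,1,0,0), (0,0,0,1), (1,0,0,1), (0,1,1,0)],
     [(1,0,0,0), (0,0,0,1), (1,0,1,0), (0,1,0,1), (0,1,1,0)],
     [(0,1,0,0), (0,0,1,0), (1,1,0,0), (0,0,1,1), (1,0,0,1)],
     [(0,0,0,1), (1,1,0,0), (1,0,1,0), (1,0,0,1), (0,1,1,0)]]"

text \<open>Rows belong to tuples of points and columns to graphs. The diagonal -4, 2, -4, 4 has no
  zero, so a vanishing combination of the graph forms is trivial.\<close>

lemma edges5_values:
  "map (\<lambda>us. map (\<lambda>E. graph_value E us) edges5) points5 =
    [[-4, 0, 0, 0], [0, 2, 0, 0], [-24, 2, -4, 0], [12, -8, -4, 4]]"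
  by code_simp

lemma edges5_ok: "list_all (\<lambda>E. edges_in 5 E \<and> add_degrees E (replicate 5 0) = [3, 3, 3, 3, 4]) edges5"
  by code_simp

definition graph5 :: "nat \<Rightarrow> form" where
  "graph5 i = graph (edges5 ! i) (replicate 5 at_0)"

lemma edges5_nth:
  "i < 4 \<Longrightarrow> edges_in 5 (edges5 ! i) \<and> add_degrees (edges5 ! i) (replicate 5 0) = [3, 3, 3, 3, 4]"
  using edges5_ok by (simp add: list_all_length edges5_def)

lemma graph5_relative: "i < 4 \<Longrightarrow> graph5 i \<in> relative_cochains 5 6"
  unfolding graph5_def by (rule graph_relative_cochains) (simp_all add: edges5_nth)

lemma graph5_value:
  assumes "i < 4" "j < 4"
  shows "graph5 i (map trunc_exp (points5 ! j)) =
    of_int ([[-4, 0, 0, 0], [0, 2, 0, 0], [-24, 2, -4, 0], [12, -8, -4, 4]] ! j ! i)"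
proof -
  have l: "length (points5 ! j) = 5" "length points5 = 4" "length edges5 = 4"
    using assms(2) by (auto simp: points5_def less_Suc_eq numeral_eq_Suc edges5_def)
  have "map (\<lambda>us. map (\<lambda>E. graph_value E us) edges5) points5 ! j ! i = graph_value (edges5 ! i) (points5 ! j)"
    using assms l by simp
  moreover have "graph5 i (map trunc_exp (points5 ! j)) = of_int (graph_value (edges5 ! i) (points5 ! j))"
    unfolding graph5_def using l edges5_nth[OF assms(1)] by (intro graph_eval) simp_all
  ultimately show ?thesis unfolding edges5_values by simp
qed

lemma graph5_independent: "independent (graph5 ` {..<4})" "card (graph5 ` {..<4}) = 4"
proof -
  have "\<forall>i<4. c i = 0" if "(\<Sum>i<4. c i *\<^sub>R graph5 i) = 0" for c
  proof -
    have s4: "(\<Sum>i<4. f i) = f 0 + f 1 + f 2 + f 3" for f :: "nat \<Rightarrow> real"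
      by (simp add: numeral_eq_Suc)
    have "(\<Sum>i<4. c i * graph5 i (map trunc_exp (points5 ! j))) = 0" for j
      using fun_cong[OF that, of "map trunc_exp (points5 ! j)"]
      by (simp add: sum_form_apply scaleR_fun_apply)
    from this[of 0] this[of 1] this[of 2] this[of 3]
    have "c 0 = 0 \<and> c 1 = 0 \<and> c 2 = 0 \<and> c 3 = 0"
      unfolding s4 by (simp add: graph5_value)
    then show ?thesis by (auto simp: less_Suc_eq numeral_eq_Suc)
  qed
  then show "independent (graph5 ` {..<4})" "card (graph5 ` {..<4}) = 4"
    using independent_family by blast+
qed

lemma graph2_independent: "independent {graph edges2 (replicate 2 at_0)}"
proof -
  have "graph edges2 (replicate 2 at_0) \<noteq> 0"
    using edges2(2) by auto
  then show ?thesis by simp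
qed

lemma dim_2: "span {graph edges2 (replicate 2 at_0)} = relative_cochains 2 6" "has_dimension (relative_cochains 2 6) DIM(real)"
  by (rule has_dimension_span[OF subspace_relative_cochains linear_value_on relative_2_eq_0 _ _ graph2_independent];
      simp add: edges2(1))+

lemma dim_5: "span (graph5 ` {..<4}) = relative_cochains 5 6" "has_dimension (relative_cochains 5 6) DIM(real ^ 4)"
  by (rule has_dimension_span[OF subspace_relative_cochains linear_values4 relative_5_eq_0 _ _ graph5_independent(1)];
      use graph5_independent(2) graph5_relative in auto)+

lemma coboundary_image_subset:
  "coboundary ` relative_cochains m w \<subseteq> relative_cochains (Suc m) w"
  using coboundary_relative_cochains by blast

text \<open>The image of the coboundary is all of degree 3, which gives both the dimension and the
  vanishing cohomology there. The index \<open>Suc 2\<close> fits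
  \<open>has_betti_number_0_surj\<close>.\<close>

lemma dim_3: "coboundary ` relative_cochains 2 6 = relative_cochains (Suc 2) 6"
    "has_dimension (relative_cochains (Suc 2) 6) DIM(real)"
proof -
  have z: "s = 0" if "s \<in> relative_cochains (Suc 2) 6" "value_on (mons (fst (base3 ! 0))) s = 0" for s
    using relative_3_eq_0 that by simp
  show "coboundary ` relative_cochains 2 6 = relative_cochains (Suc 2) 6"
    "has_dimension (relative_cochains (Suc 2) 6) DIM(real)"
    by (rule has_dimension_image[OF subspace_relative_cochains dim_2(1)[symmetric] _ _ graph2_independent
        linear_coboundary coboundary_inj_2 coboundary_image_subset subspace_relative_cochains linear_value_on z];
        simp)+
qed

lemma dim_6: "coboundary ` relative_cochains 5 6 = relative_cochains (Suc 5) 6"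
    "has_dimension (relative_cochains (Suc 5) 6) DIM(real ^ 4)"
proof -
  have z: "s = 0" if "s \<in> relative_cochains (Suc 5) 6" "values4 (mons (fst (base6 ! 0))) (mons (fst (base6 ! 1)))
     (mons (fst (base6 ! 2))) (mons (fst (base6 ! 3))) s = 0" for s
    using relative_6_eq_0 that by simp
  show "coboundary ` relative_cochains 5 6 = relative_cochains (Suc 5) 6"
    "has_dimension (relative_cochains (Suc 5) 6) DIM(real ^ 4)"
    by (rule has_dimension_image[OF subspace_relative_cochains dim_5(1)[symmetric] _ _ graph5_independent(1)
        linear_coboundary coboundary_inj_5 coboundary_image_subset subspace_relative_cochains linear_values4 z];
        use graph5_independent(2) in simp)+
qed

theorem theorem2:
  shows "\<forall>m\<le>6. has_dimension (relative_cochains m 6) ([0, 0, 1, 1, 0, 4, 4] ! m) \<and>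
                has_betti_number m 6 0"
proof (intro allI impI)
  fix m :: nat assume "m \<le> 6"
  then consider "m = 0" | "m = 1" | "m = 2" | "m = Suc 2" | "m = 4" | "m = 5" | "m = Suc 5" by linarith
  then show "has_dimension (relative_cochains m 6) ([0, 0, 1, 1, 0, 4, 4] ! m) \<and> has_betti_number m 6 0"
  proof cases
    case 1 then show ?thesis using has_betti_number_0_inj[of 0 6] by (simp add: relative_0 has_dimension_zero)
  next
    case 2 then show ?thesis using has_betti_number_0_inj[of 1 6] relative_1 by (simp add: has_dimension_zero)
  next
    case 3 then show ?thesis using has_betti_number_0_inj[OF coboundary_inj_2] dim_2(2) by simp
  next
    case 4 then show ?thesis using has_betti_number_0_surj[OF dim_3(1)] dim_3(2) by simp
  next
    case 5 then show ?thesis using has_betti_number_0_inj[of 4 6] by (simp add: relative_4 has_dimension_zero)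
  next
    case 6 then show ?thesis using has_betti_number_0_inj[OF coboundary_inj_5] dim_5(2) by simp
  next
    case 7 then show ?thesis using has_betti_number_0_surj[OF dim_6(1)] dim_6(2) by simp
  qed
qed

end
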